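(* If $V\in L^1_{\mathrm{loc}}([0,\infty))$ is real-valued and the limit $$\lim_{x\to\infty}\int_0^xV(t)\,dt$$ is convergent, then the operator $-\frac{d^2}{dx^2}+V$ is limit point at $\infty$ and its arbitrary self-adjoint realization $H_V$ in $L^2(\mathbb R_+)$ satisfies $\mathrm{Spec}_{\mathrm{ess}}(H_V)=[0,\infty)$.
   Context: $\mathbb R_+=(0,\infty)$; convergent means that the limit exists and is finite. Self-adjoint realizations are the self-adjoint extensions in $L^2(\mathbb R_+)$ of the minimal operator associated with the differential expression $-u''+Vu$. $\mathrm{Spec}_{\mathrm{ess}}$ denotes the essential spectrum. *)

theory Defs
  imports "HOL-Analysis.Analysis"
begin

section \<open>The complex Hilbert space of square-integrable functions on the open half-line\<close>

abbreviation half_line :: "real measure" where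
  "half_line \<equiv> lebesgue_on {0<..}"

definition square_integrable :: "(real \<Rightarrow> complex) \<Rightarrow> bool" where
  "square_integrable u \<longleftrightarrow>
     u \<in> borel_measurable half_line \<and> integrable half_line (\<lambda>x. (cmod (u x))\<^sup>2)"

lemma square_integrable_mult:
  assumes "square_integrable u" "square_integrable v"
  shows "integrable half_line (\<lambda>x. cnj (u x) * v x)"
proof (rule Bochner_Integration.integrable_bound)
  show "integrable half_line (\<lambda>x. (cmod (u x))\<^sup>2 + (cmod (v x))\<^sup>2)"
    using assms by (auto simp: square_integrable_def)
  show "(\<lambda>x. cnj (u x) * v x) \<in> borel_measurable half_line"
  proof -
    have "(\<lambda>x. cnj (u x)) \<in> borel_measurable half_line"
      using assms(1)
      by (intro measurable_compose[of u half_line borel cnj] borel_measurable_continuous_onI)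
        (auto simp: square_integrable_def intro!: continuous_intros)
    then show ?thesis
      using assms(2) by (auto simp: square_integrable_def)
  qed
  have "a * b \<le> a\<^sup>2 + b\<^sup>2" for a b :: real
    using sum_squares_bound[of a b] zero_le_power2[of a] zero_le_power2[of b] by linarith
  then show "AE x in half_line. norm (cnj (u x) * v x) \<le> norm ((cmod (u x))\<^sup>2 + (cmod (v x))\<^sup>2)"
    by (auto simp: norm_mult)
qed

lemma square_integrable_0: "square_integrable (\<lambda>x. 0)"
  by (simp add: square_integrable_def)

lemma square_integrable_scale:
  "square_integrable u \<Longrightarrow> square_integrable (\<lambda>x. c * u x)"
  by (auto simp: square_integrable_def norm_mult power_mult_distrib)

lemma square_integrable_add:
  assumes "square_integrable u" "square_integrable v"
  shows "square_integrable (\<lambda>x. u x + v x)"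
  unfolding square_integrable_def
proof
  show "(\<lambda>x. u x + v x) \<in> borel_measurable half_line"
    using assms by (auto simp: square_integrable_def)
  show "integrable half_line (\<lambda>x. (cmod (u x + v x))\<^sup>2)"
  proof (rule Bochner_Integration.integrable_bound)
    show "integrable half_line (\<lambda>x. 2 * (cmod (u x))\<^sup>2 + 2 * (cmod (v x))\<^sup>2)"
      using assms by (auto simp: square_integrable_def)
    show "(\<lambda>x. (cmod (u x + v x))\<^sup>2) \<in> borel_measurable half_line"
      using assms by (auto simp: square_integrable_def)
    have "(cmod (a + b))\<^sup>2 \<le> 2 * (cmod a)\<^sup>2 + 2 * (cmod b)\<^sup>2" for a b
    proof -
      have "(cmod (a + b))\<^sup>2 \<le> (cmod a + cmod b)\<^sup>2"
        by (intro power_mono norm_triangle_ineq) auto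
      also have "\<dots> \<le> 2 * (cmod a)\<^sup>2 + 2 * (cmod b)\<^sup>2"
        using sum_squares_bound[of "cmod a" "cmod b"] by (simp add: power2_sum)
      finally show ?thesis .
    qed
    then show "AE x in half_line.
        norm ((cmod (u x + v x))\<^sup>2) \<le> norm (2 * (cmod (u x))\<^sup>2 + 2 * (cmod (v x))\<^sup>2)"
      by auto
  qed
qed

quotient_type L2 = "real \<Rightarrow> complex" / partial:
  "\<lambda>u v. square_integrable u \<and> square_integrable v \<and> (AE x in half_line. u x = v x)"
proof (rule part_equivpI)
  show "\<exists>u. square_integrable u \<and> square_integrable u \<and> (AE x in half_line. u x = u x)"
    using square_integrable_0 by auto
  show "symp (\<lambda>u v. square_integrable u \<and> square_integrable v \<and> (AE x in half_line. u x = v x))"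
    by (rule sympI) (auto simp: eq_commute)
  show "transp (\<lambda>u v. square_integrable u \<and> square_integrable v \<and> (AE x in half_line. u x = v x))"
  proof (rule transpI, elim conjE, intro conjI)
    fix u v w :: "real \<Rightarrow> complex"
    assume "AE x in half_line. u x = v x" "AE x in half_line. v x = w x"
    then show "AE x in half_line. u x = w x"
      by eventually_elim simp
  qed
qed

lift_definition cinner_L2 :: "L2 \<Rightarrow> L2 \<Rightarrow> complex" is
  "\<lambda>u v. (\<integral>x. cnj (u x) * v x \<partial>half_line)"
proof -
  fix u u' v v' :: "real \<Rightarrow> complex"
  assume u: "square_integrable u \<and> square_integrable u' \<and> (AE x in half_line. u x = u' x)"
    and v: "square_integrable v \<and> square_integrable v' \<and> (AE x in half_line. v x = v' x)"
  show "(\<integral>x. cnj (u x) * v x \<partial>half_line) = (\<integral>x. cnj (u' x) * v' x \<partial>half_line)"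
  proof (rule integral_cong_AE)
    show "(\<lambda>x. cnj (u x) * v x) \<in> borel_measurable half_line"
      using square_integrable_mult[of u v] u v by auto
    show "(\<lambda>x. cnj (u' x) * v' x) \<in> borel_measurable half_line"
      using square_integrable_mult[of u' v'] u v by auto
    from u v have "AE x in half_line. u x = u' x" "AE x in half_line. v x = v' x"
      by auto
    then show "AE x in half_line. cnj (u x) * v x = cnj (u' x) * v' x"
      by eventually_elim auto
  qed
qed

lift_definition scaleC_L2 :: "complex \<Rightarrow> L2 \<Rightarrow> L2" is "\<lambda>c u x. c * u x"
  by (auto simp: square_integrable_scale elim: AE_mp)

instantiation L2 :: real_inner
begin

lift_definition zero_L2 :: L2 is "\<lambda>x. 0"
  by (simp add: square_integrable_0)

lift_definition plus_L2 :: "L2 \<Rightarrow> L2 \<Rightarrow> L2" is "\<lambda>u v x. u x + v x"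
  by (auto simp: square_integrable_add elim: AE_mp)

definition uminus_L2 :: "L2 \<Rightarrow> L2" where "- U = scaleC_L2 (-1) U"

definition minus_L2 :: "L2 \<Rightarrow> L2 \<Rightarrow> L2" where "U - W = U + - (W :: L2)"

definition scaleR_L2 :: "real \<Rightarrow> L2 \<Rightarrow> L2" where "r *\<^sub>R U = scaleC_L2 (of_real r) U"

definition inner_L2 :: "L2 \<Rightarrow> L2 \<Rightarrow> real" where "U \<bullet> W = Re (cinner_L2 U W)"

definition norm_L2 :: "L2 \<Rightarrow> real" where "norm U = sqrt (U \<bullet> (U :: L2))"

definition sgn_L2 :: "L2 \<Rightarrow> L2" where "sgn U = inverse (norm U) *\<^sub>R (U :: L2)"

definition dist_L2 :: "L2 \<Rightarrow> L2 \<Rightarrow> real" where "dist U W = norm (U - W :: L2)"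

definition uniformity_L2 :: "(L2 \<times> L2) filter" where
  "uniformity_L2 = (INF e\<in>{0 <..}. principal {(x, y). dist x y < e})"

definition open_L2 :: "L2 set \<Rightarrow> bool" where
  "open_L2 S = (\<forall>x\<in>S. \<forall>\<^sub>F (x', y) in uniformity. x' = x \<longrightarrow> y \<in> S)"

instance
proof
  fix a b c :: L2 and r s :: real
  show "a + b + c = a + (b + c)"
    by transfer (auto simp: square_integrable_add add.assoc)
  show "a + b = b + a"
    by transfer (auto simp: square_integrable_add add.commute)
  show "0 + a = a"
    by transfer auto
  show "- a + a = 0"
    unfolding uminus_L2_def
    by transfer (auto simp: square_integrable_0 square_integrable_add
        square_integrable_scale[where c="-1", simplified])
  show "a - b = a + - b"
    by (rule minus_L2_def)
  show "r *\<^sub>R (a + b) = r *\<^sub>R a + r *\<^sub>R b"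
    unfolding scaleR_L2_def
    by transfer (auto simp: square_integrable_scale square_integrable_add distrib_left)
  show "(r + s) *\<^sub>R a = r *\<^sub>R a + s *\<^sub>R a"
    unfolding scaleR_L2_def
    by transfer (auto simp: distrib_right
        intro!: square_integrable_add square_integrable_scale)
  show "r *\<^sub>R s *\<^sub>R a = (r * s) *\<^sub>R a"
    unfolding scaleR_L2_def
    by transfer (auto simp: mult.assoc intro!: square_integrable_scale)
  show "1 *\<^sub>R a = a"
    unfolding scaleR_L2_def by transfer auto
  show "sgn a = inverse (norm a) *\<^sub>R a"
    by (rule sgn_L2_def)
  show "dist a b = norm (a - b)"
    by (rule dist_L2_def)
  show "norm a = sqrt (a \<bullet> a)"
    by (rule norm_L2_def)
  show "(uniformity :: (L2 \<times> L2) filter) = (INF e\<in>{0 <..}. principal {(x, y). dist x y < e})"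
    by (rule uniformity_L2_def)
  show "a \<bullet> b = b \<bullet> a"
    unfolding inner_L2_def
  proof transfer
    fix u v :: "real \<Rightarrow> complex"
    assume "square_integrable u \<and> square_integrable u \<and> (AE x in half_line. u x = u x)"
      and "square_integrable v \<and> square_integrable v \<and> (AE x in half_line. v x = v x)"
    have "(\<integral>x. cnj (u x) * v x \<partial>half_line) = (\<integral>x. cnj (cnj (v x) * u x) \<partial>half_line)"
      by (simp add: mult.commute)
    also have "\<dots> = cnj (\<integral>x. cnj (v x) * u x \<partial>half_line)"
      by (rule Bochner_Integration.integral_cnj)
    finally show "Re (\<integral>x. cnj (u x) * v x \<partial>half_line) = Re (\<integral>x. cnj (v x) * u x \<partial>half_line)"
      by simp
  qed
  show "(a + b) \<bullet> c = a \<bullet> c + b \<bullet> c"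
    unfolding inner_L2_def
    by transfer (simp add: distrib_right square_integrable_mult)
  show "(r *\<^sub>R a) \<bullet> b = r * (a \<bullet> b)"
    unfolding inner_L2_def scaleR_L2_def
    by transfer (simp add: mult.assoc)
  have norm_sq: "cnj z * z = complex_of_real ((cmod z)\<^sup>2)" for z
    by (metis complex_norm_square mult.commute of_real_power)
  show "0 \<le> a \<bullet> a"
    unfolding inner_L2_def
    by transfer (simp add: norm_sq del: of_real_power)
  show "(a \<bullet> a = 0) = (a = 0)"
    unfolding inner_L2_def
  proof transfer
    fix u :: "real \<Rightarrow> complex"
    assume u: "square_integrable u \<and> square_integrable u \<and> (AE x in half_line. u x = u x)"
    then have "((\<integral>x. (cmod (u x))\<^sup>2 \<partial>half_line) = 0) = (AE x in half_line. (cmod (u x))\<^sup>2 = 0)"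
      by (intro integral_nonneg_eq_0_iff_AE) (auto simp: square_integrable_def)
    then show "(Re (\<integral>x. cnj (u x) * u x \<partial>half_line) = 0) =
        (square_integrable u \<and> square_integrable (\<lambda>x. 0) \<and> (AE x in half_line. u x = 0))"
      using u by (simp add: norm_sq square_integrable_0 del: of_real_power)
  qed
qed (rule open_L2_def)

end

text \<open>The class \<^class>\<open>real_inner\<close> supplies norm and topology; linearity of operators, spans and
  dimensions below refer to the complex scalars.\<close>

global_interpretation complex_L2: vector_space scaleC_L2
  defines complex_span = complex_L2.span
proof
  fix c d :: complex and U W :: L2
  show "scaleC_L2 c (U + W) = scaleC_L2 c U + scaleC_L2 c W"
    by transfer (auto simp: square_integrable_scale square_integrable_add distrib_left)
  show "scaleC_L2 (c + d) U = scaleC_L2 c U + scaleC_L2 d U"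
    by transfer (auto simp: distrib_right intro!: square_integrable_add square_integrable_scale)
  show "scaleC_L2 c (scaleC_L2 d U) = scaleC_L2 (c * d) U"
    by transfer (auto simp: mult.assoc intro!: square_integrable_scale)
  show "scaleC_L2 1 U = U"
    by transfer auto
qed


section \<open>Unbounded operators\<close>

text \<open>An operator is represented by its graph, so that extension of operators is inclusion.\<close>

definition linear_operator :: "(L2 \<times> L2) set \<Rightarrow> bool" where
  "linear_operator T \<longleftrightarrow>
     (0, 0) \<in> T \<and>
     (\<forall>U F W G. (U, F) \<in> T \<longrightarrow> (W, G) \<in> T \<longrightarrow> (U + W, F + G) \<in> T) \<and>
     (\<forall>c U F. (U, F) \<in> T \<longrightarrow> (scaleC_L2 c U, scaleC_L2 c F) \<in> T) \<and>
     single_valued T"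

definition adjoint_operator :: "(L2 \<times> L2) set \<Rightarrow> (L2 \<times> L2) set" where
  "adjoint_operator T = {(W, G). \<forall>(U, F) \<in> T. cinner_L2 W F = cinner_L2 G U}"

definition self_adjoint :: "(L2 \<times> L2) set \<Rightarrow> bool" where
  "self_adjoint T \<longleftrightarrow>
     linear_operator T \<and> closure (Domain T) = UNIV \<and> adjoint_operator T = T"

definition resolvent_set :: "(L2 \<times> L2) set \<Rightarrow> complex set" where
  "resolvent_set T = {z.
     (\<forall>G. \<exists>!U. \<exists>F. (U, F) \<in> T \<and> F - scaleC_L2 z U = G) \<and>
     (\<exists>C. \<forall>(U, F) \<in> T. norm U \<le> C * norm (F - scaleC_L2 z U))}"

definition spectrum :: "(L2 \<times> L2) set \<Rightarrow> complex set" where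
  "spectrum T = - resolvent_set T"

definition eigenspace :: "(L2 \<times> L2) set \<Rightarrow> complex \<Rightarrow> L2 set" where
  "eigenspace T z = {U. (U, scaleC_L2 z U) \<in> T}"

definition discrete_spectrum :: "(L2 \<times> L2) set \<Rightarrow> complex set" where
  "discrete_spectrum T = {z. z isolated_in spectrum T \<and> eigenspace T z \<noteq> {0} \<and>
     (\<exists>B. finite B \<and> eigenspace T z \<subseteq> complex_span B)}"

text \<open>This definition is meant for self-adjoint operators, for which the usual definitions of
  the essential spectrum coincide.\<close>

definition essential_spectrum :: "(L2 \<times> L2) set \<Rightarrow> complex set" where
  "essential_spectrum T = spectrum T - discrete_spectrum T"


section \<open>Schroedinger operators on the half-line\<close>

text \<open>Here \<open>u\<close> is locally absolutely continuous on \<open>[0,\<infinity>)\<close>, that is, an indefinite integral of a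
  locally integrable function, which is then its derivative almost everywhere. Values of \<open>u\<close> on
  the negative half-line play no role.\<close>

definition ac_deriv :: "(real \<Rightarrow> complex) \<Rightarrow> (real \<Rightarrow> complex) \<Rightarrow> bool" where
  "ac_deriv u u' \<longleftrightarrow>
     (\<forall>x\<ge>0. u' absolutely_integrable_on {0..x} \<and> u x = u 0 + integral {0..x} u')"

text \<open>\<open>schroedinger V u f\<close> says that \<open>u\<close> and its derivative are locally absolutely continuous and
  \<open>- u'' + V u = f\<close> almost everywhere on the half-line.\<close>

definition schroedinger :: "(real \<Rightarrow> real) \<Rightarrow> (real \<Rightarrow> complex) \<Rightarrow> (real \<Rightarrow> complex) \<Rightarrow> bool" where
  "schroedinger V u f \<longleftrightarrow> (\<exists>u' u''. ac_deriv u u' \<and> ac_deriv u' u'' \<and>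
     (AE x in half_line. - u'' x + of_real (V x) * u x = f x))"

text \<open>The minimal operator is the closure of its restriction to the elements of the maximal domain
  with compact support in the open half-line. As \<open>V\<close> is only locally integrable, test functions
  need not belong to the domain.\<close>

definition preminimal_operator :: "(real \<Rightarrow> real) \<Rightarrow> (L2 \<times> L2) set" where
  "preminimal_operator V = {(abs_L2 u, abs_L2 f) | u f.
     square_integrable u \<and> square_integrable f \<and> schroedinger V u f \<and>
     (\<exists>a b. 0 < a \<and> a \<le> b \<and> (\<forall>x\<ge>0. x \<notin> {a..b} \<longrightarrow> u x = 0))}"

definition minimal_operator :: "(real \<Rightarrow> real) \<Rightarrow> (L2 \<times> L2) set" where
  "minimal_operator V = closure (preminimal_operator V)"

definition self_adjoint_realization :: "(real \<Rightarrow> real) \<Rightarrow> (L2 \<times> L2) set \<Rightarrow> bool" where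
  "self_adjoint_realization V H \<longleftrightarrow> self_adjoint H \<and> minimal_operator V \<subseteq> H"

text \<open>Weyl's alternative: limit circle means that for some \<open>z\<close> (equivalently, for every \<open>z\<close>) all
  solutions of \<open>- u'' + V u = z u\<close> are square-integrable near infinity; limit point means that
  this fails. So limit point asserts a non-square-integrable solution for each complex \<open>z\<close>.\<close>

definition limit_circle_at_infinity :: "(real \<Rightarrow> real) \<Rightarrow> bool" where
  "limit_circle_at_infinity V \<longleftrightarrow> (\<exists>z. \<forall>u. schroedinger V u (\<lambda>x. z * u x) \<longrightarrow>
     (\<exists>c\<ge>0. set_integrable lebesgue {c..} (\<lambda>x. (cmod (u x))\<^sup>2)))"

definition limit_point_at_infinity :: "(real \<Rightarrow> real) \<Rightarrow> bool" where
  "limit_point_at_infinity V \<longleftrightarrow> \<not> limit_circle_at_infinity V"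

end

theory Submission
  imports Defs
begin

text \<open>Let \<open>W x = \<integral>\<^sub>0\<^sup>x V - l\<close>, where \<open>l\<close> is the limit of the integrals, so that \<open>W\<close> is bounded and tends to 0 at
  infinity, and let \<open>E = exp (\<integral>\<^sub>0\<^sup>x W)\<close>. With \<open>u = E v\<close> and \<open>q = E (u' - W u)\<close> the equation \<open>- u'' + V u = f\<close>
  becomes \<open>v' = q / E\<^sup>2\<close>, \<open>q' = - E (f + W\<^sup>2 u)\<close>, in which \<open>V\<close> no longer occurs, and
  \<open>(Re (cnj v q))' = \<bar>q / E\<bar>\<^sup>2 - Re (cnj u f) - W\<^sup>2 \<bar>u\<bar>\<^sup>2\<close>.

  If \<open>u\<close> and \<open>f\<close> are square-integrable, this identity makes \<open>q / E\<close> square-integrable, so two independent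
  square-integrable solutions of \<open>- u'' + V u = z u\<close> would have an integrable constant Wronskian: the
  limit point case holds. For \<open>\<lambda> < 0\<close> it bounds the norm of \<open>u\<close> by the initial values of \<open>v\<close> and \<open>q\<close> and
  the norm of \<open>f - \<lambda> u\<close>. Hence approximate eigenvectors at \<open>\<lambda>\<close> subconverge, which makes \<open>\<lambda>\<close> a regular
  value or an isolated eigenvalue of finite multiplicity. Plane waves cut off to long intervals far out and
  multiplied by \<open>E\<close> show that every \<open>k\<^sup>2\<close> lies in the spectrum.\<close>

section \<open>Indefinite integrals and linear differential equations\<close>

text \<open>The quasi-derivative \<open>u' - W u\<close> replaces \<open>V\<close> by
  \<open>W\<close> because \<open>W' = V\<close>: differentiating it cancels \<open>V u\<close> and
  leaves \<open>- f - W (u' - W u) - W^2 u\<close>. The factor \<open>E\<close> integrates away the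
  middle term. \<open>E\<close> itself may be unbounded or approach 0, since \<open>W\<close> tends
  to 0 but may fail to be integrable. The estimates are therefore stated for \<open>u = E v\<close>
  and \<open>q / E\<close>, and in products such as \<open>cnj v * q\<close> the weights cancel.

  All self-adjoint realizations are treated at once: each lies inside the adjoint of the preminimal
  operator, whose elements are described by the first-order system, and the behaviour at 0 enters
  only through the pair \<open>(v 0, q 0)\<close>. Compactness below 0 is thus compactness of
  bounded sets in a two-dimensional complex space.\<close>

definition ac :: "(real \<Rightarrow> 'a::euclidean_space) \<Rightarrow> (real \<Rightarrow> 'a) \<Rightarrow> bool" where
  "ac f f' \<longleftrightarrow> (\<forall>x\<ge>0. f' absolutely_integrable_on {0..x} \<and> f x = f 0 + integral {0..x} f')"

text \<open>The codomain of \<open>ac\<close> is left general because one calculus serves real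
  weights, complex solutions and pairs of complex functions.\<close>

lemma ac_deriv_eq_ac: "ac_deriv = ac"
  by (intro ext) (simp add: ac_def ac_deriv_def)

lemma ac_eq: "ac f f' \<Longrightarrow> 0 \<le> x \<Longrightarrow> f x = f 0 + integral {0..x} f'"
  unfolding ac_def by blast

lemma ac_absolutely_integrable:
  assumes "ac f f'" "0 \<le> a"
  shows "f' absolutely_integrable_on {a..b}"
proof (cases "a \<le> b")
  case True
  then have "f' absolutely_integrable_on {0..b}"
    using assms by (simp add: ac_def)
  then show ?thesis
    by (rule absolutely_integrable_on_subinterval) (use assms in auto)
qed simp

lemma ac_integrable: "ac f f' \<Longrightarrow> 0 \<le> a \<Longrightarrow> f' integrable_on {a..b}"
  using ac_absolutely_integrable set_lebesgue_integral_eq_integral(1) by blast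

lemma ac_continuous_on: "ac f f' \<Longrightarrow> continuous_on {0..b} f"
proof -
  assume f: "ac f f'"
  have "continuous_on {0..b} (\<lambda>x. f 0 + integral {0..x} f')"
    by (intro continuous_intros indefinite_integral_continuous_1 ac_integrable[OF f]) auto
  then show ?thesis
    by (rule continuous_on_eq) (rule ac_eq[OF f, symmetric], simp)
qed

lemma continuous_on_halfline:
  fixes f :: "real \<Rightarrow> 'a::topological_space"
  assumes "\<And>b. continuous_on {0..b} f"
  shows "continuous_on {0..} f"
proof -
  have "continuous (at x within {0..}) f" if "0 \<le> x" for x
  proof -
    have "continuous (at x within {0..x+1}) f"
      using assms[of "x+1"] that by (auto simp: continuous_on_eq_continuous_within)
    moreover have "at x within {0..} = at x within {0..x+1}"
      by (rule at_within_nhd[of x "{..<x+1}"]) (use that in auto)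
    ultimately show ?thesis by simp
  qed
  then show ?thesis by (auto simp: continuous_on_eq_continuous_within)
qed

lemma ac_continuous_on_halfline: "ac f f' \<Longrightarrow> continuous_on {0..} f"
  by (rule continuous_on_halfline) (rule ac_continuous_on)

lemma ac_diff_integral:
  assumes "ac f f'" "0 \<le> a" "a \<le> b"
  shows "f b - f a = integral {a..b} f'"
proof -
  have "integral {0..a} f' + integral {a..b} f' = integral {0..b} f'"
    by (rule Henstock_Kurzweil_Integration.integral_combine)
      (use assms ac_integrable[OF assms(1)] in auto)
  then show ?thesis
    using ac_eq[OF assms(1), of a] ac_eq[OF assms(1), of b] assms(2,3)
    by (metis add_diff_cancel_left add_diff_cancel_left' order_trans)
qed

lemma ac_cong:
  assumes "ac f f'" "\<And>x. 0 \<le> x \<Longrightarrow> g x = f x" "\<And>x. 0 \<le> x \<Longrightarrow> g' x = f' x"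
  shows "ac g g'"
  unfolding ac_def
proof (intro allI impI conjI)
  fix x :: real assume x: "0 \<le> x"
  have f': "f' absolutely_integrable_on {0..x}"
    using assms(1) x by (simp add: ac_def)
  show "g' absolutely_integrable_on {0..x}"
    by (rule absolutely_integrable_spike[OF f', of "{}"]) (use assms in auto)
  have "integral {0..x} g' = integral {0..x} f'"
    by (rule Henstock_Kurzweil_Integration.integral_cong) (use assms in auto)
  then show "g x = g 0 + integral {0..x} g'"
    using ac_eq[OF assms(1) x] assms(2)[OF x] assms(2)[of 0] by (metis order_refl)
qed

lemma ac_linear:
  assumes "ac f f'" "bounded_linear h"
  shows "ac (\<lambda>x. h (f x)) (\<lambda>x. h (f' x))"
  unfolding ac_def
proof (intro allI impI conjI)
  fix x :: real assume x: "0 \<le> x"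
  have f': "f' absolutely_integrable_on {0..x}"
    using assms(1) x by (simp add: ac_def)
  show "(\<lambda>x. h (f' x)) absolutely_integrable_on {0..x}"
    using absolutely_integrable_linear[OF f' assms(2)] by (simp add: o_def)
  have "integral {0..x} (\<lambda>x. h (f' x)) = h (integral {0..x} f')"
    using integral_linear[OF ac_integrable[OF assms(1)] assms(2), of 0 x] by (simp add: o_def)
  then show "h (f x) = h (f 0) + integral {0..x} (\<lambda>x. h (f' x))"
    using ac_eq[OF assms(1) x] bounded_linear.linear[OF assms(2)] by (metis linear_add)
qed

lemma ac_add:
  assumes "ac f f'" "ac g g'"
  shows "ac (\<lambda>x. f x + g x) (\<lambda>x. f' x + g' x)"
  unfolding ac_def
proof (intro allI impI conjI)
  fix x :: real assume x: "0 \<le> x"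
  show "(\<lambda>x. f' x + g' x) absolutely_integrable_on {0..x}"
    using assms x by (auto simp: ac_def intro: set_integral_add(1))
  have "integral {0..x} (\<lambda>x. f' x + g' x) = integral {0..x} f' + integral {0..x} g'"
    by (intro Henstock_Kurzweil_Integration.integral_add ac_integrable[OF assms(1)] ac_integrable[OF assms(2)]) auto
  then show "f x + g x = f 0 + g 0 + integral {0..x} (\<lambda>x. f' x + g' x)"
    using ac_eq[OF assms(1) x] ac_eq[OF assms(2) x] by (simp add: algebra_simps)
qed

lemma ac_const: "ac (\<lambda>x. c) (\<lambda>x. 0)"
  by (simp add: ac_def)

lemma ac_scaleR: "ac f f' \<Longrightarrow> ac (\<lambda>x. c *\<^sub>R f x) (\<lambda>x. c *\<^sub>R f' x)"
  by (rule ac_linear[OF _ bounded_linear_scaleR_right])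

lemma ac_minus: "ac f f' \<Longrightarrow> ac (\<lambda>x. - f x) (\<lambda>x. - f' x)"
  using ac_scaleR[of f f' "-1"] by simp

lemma ac_diff:
  "ac f f' \<Longrightarrow> ac g g' \<Longrightarrow> ac (\<lambda>x. f x - g x) (\<lambda>x. f' x - g' x)"
  using ac_add[of f f' "\<lambda>x. - g x" "\<lambda>x. - g' x"] ac_minus[of g g'] by simp

lemma ac_integral:
  assumes "\<And>b. f absolutely_integrable_on {0..b}"
  shows "ac (\<lambda>x. c + integral {0..x} f) f"
  using assms by (simp add: ac_def)

lemma ac_has_vector_derivative:
  fixes f :: "real \<Rightarrow> 'a::euclidean_space"
  assumes "\<And>x. 0 \<le> x \<Longrightarrow> (f has_vector_derivative f' x) (at x within {0..})"
    and "continuous_on {0..} f'"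
  shows "ac f f'"
  unfolding ac_def
proof (intro allI impI conjI)
  fix x :: real assume x: "0 \<le> x"
  show "f' absolutely_integrable_on {0..x}"
    by (rule absolutely_integrable_continuous_real, rule continuous_on_subset[OF assms(2)]) auto
  have "(f' has_integral f x - f 0) {0..x}"
    by (rule fundamental_theorem_of_calculus[OF x])
      (use assms(1) in \<open>auto intro: has_vector_derivative_within_subset[of _ _ _ "{0..}"]\<close>)
  then show "f x = f 0 + integral {0..x} f'"
    by (simp add: integral_unique)
qed

lemma ac_integral_continuous:
  fixes f :: "real \<Rightarrow> 'a::euclidean_space"
  assumes "continuous_on {0..} f"
  shows "ac (\<lambda>x. c + integral {0..x} f) f"
  by (rule ac_integral, rule absolutely_integrable_continuous_real,
      rule continuous_on_subset[OF assms]) auto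

lemma ac_imp_has_vector_derivative:
  fixes f :: "real \<Rightarrow> 'a::euclidean_space"
  assumes "ac f f'" "continuous_on {0..} f'" "0 \<le> x"
  shows "(f has_vector_derivative f' x) (at x within {0..})"
proof -
  have c: "continuous_on {0..x+1} f'"
    by (rule continuous_on_subset[OF assms(2)]) auto
  have "((\<lambda>u. f 0 + integral {0..u} f') has_vector_derivative 0 + f' x) (at x within {0..x+1})"
    by (intro derivative_intros integral_has_vector_derivative[OF c]) (use assms in auto)
  then have "(f has_vector_derivative 0 + f' x) (at x within {0..x+1})"
    by (rule has_vector_derivative_transform[OF _ ac_eq[OF assms(1)], rotated 2])
      (use assms(3) in auto)
  then have "(f has_vector_derivative f' x) (at x within {0..x+1})" by simp
  moreover have "at x within {0..} = at x within {0..x+1}"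
    by (rule at_within_nhd[of x "{..<x+1}"]) (use assms in auto)
  ultimately show ?thesis by simp
qed

text \<open>The quadratic bound is halved by each bisection of the interval into pieces of equal \<open>m\<close>-increment.\<close>

lemma constant_if_quadratic_increments:
  fixes D :: "real \<Rightarrow> 'a::real_normed_vector" and m :: "real \<Rightarrow> real"
  assumes "\<And>x y. A \<le> x \<Longrightarrow> x \<le> y \<Longrightarrow> y \<le> B \<Longrightarrow> norm (D y - D x) \<le> (m y - m x)\<^sup>2"
    and m: "continuous_on {A..B} m" and "A \<le> B"
  shows "D B = D A"
proof -
  have *: "norm (D y - D x) \<le> (m y - m x)\<^sup>2 / 2 ^ n"
    if "A \<le> x" "x \<le> y" "y \<le> B" for x y and n :: nat
    using that
  proof (induction n arbitrary: x y)
    case 0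
    then show ?case using assms(1) by simp
  next
    case (Suc n)
    have c: "continuous_on {x..y} m"
      by (rule continuous_on_subset[OF m]) (use Suc.prems in auto)
    \<comment> \<open>\<open>m\<close> is not assumed monotone, so its midpoint value is located by
      one of two versions of the intermediate value theorem.\<close>
    obtain z where z: "x \<le> z" "z \<le> y" "m z = (m x + m y) / 2"
    proof (cases "m x \<le> m y")
      case True
      then show ?thesis
        using IVT'[of m x "(m x + m y) / 2" y] c Suc.prems that by auto
    next
      case False
      then show ?thesis
        using IVT2'[of m y "(m x + m y) / 2" x] c Suc.prems that by auto
    qed
    have "norm (D y - D x) \<le> norm (D y - D z) + norm (D z - D x)"
      using norm_triangle_ineq[of "D y - D z" "D z - D x"] by simp
    also have "\<dots> \<le> (m y - m z)\<^sup>2 / 2 ^ n + (m z - m x)\<^sup>2 / 2 ^ n"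
      using Suc.IH[of x z] Suc.IH[of z y] Suc.prems z(1,2) by (intro add_mono) auto
    also have "\<dots> = (m y - m x)\<^sup>2 / 2 ^ Suc n"
      unfolding z(3) by (simp add: field_simps power2_eq_square)
    finally show ?case .
  qed
  have "(\<lambda>n. (m B - m A)\<^sup>2 * (1 / 2) ^ n) \<longlonglongrightarrow> (m B - m A)\<^sup>2 * 0"
    by (intro tendsto_intros LIMSEQ_power_zero) auto
  then have "norm (D B - D A) \<le> (m B - m A)\<^sup>2 * 0"
    by (rule Lim_bounded2) (use * assms(3) in \<open>auto simp: power_one_over field_simps\<close>)
  then show ?thesis by simp
qed

lemma absolutely_integrable_bilinear_continuous:
  fixes h :: "'a::euclidean_space \<Rightarrow> 'b::euclidean_space \<Rightarrow> 'c::euclidean_space"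
  assumes "bounded_bilinear h" "continuous_on {a..b} f" "g absolutely_integrable_on {a..b}"
  shows "(\<lambda>x::real. h (f x) (g x)) absolutely_integrable_on {a..b}"
proof (rule absolutely_integrable_bounded_measurable_product[where h = h and f = f and g = g])
  show "bilinear h" using assms(1) by (simp add: bilinear_conv_bounded_bilinear)
  show "f \<in> borel_measurable (lebesgue_on {a..b})"
    by (rule continuous_imp_measurable_on_sets_lebesgue[OF assms(2)]) auto
  show "bounded (f ` {a..b})"
    using assms(2) by (auto intro!: compact_imp_bounded compact_continuous_image)
qed (use assms in auto)

text \<open>This avoids almost-everywhere differentiation. Freezing one factor on a short interval
  leaves an error of at most a constant times the variation of \<open>f\<close> times that of
  \<open>g\<close>, so the defect in the product formula has quadratic increments and is
  constant.\<close>

lemma ac_bilinear: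
  fixes h :: "'a::euclidean_space \<Rightarrow> 'b::euclidean_space \<Rightarrow> 'c::euclidean_space"
  assumes h: "bounded_bilinear h" and f: "ac f f'" and g: "ac g g'"
  shows "ac (\<lambda>x. h (f x) (g x)) (\<lambda>x. h (f' x) (g x) + h (f x) (g' x))"
proof -
  interpret h: bounded_bilinear h by fact
  obtain K where K: "K > 0" "\<And>a b. norm (h a b) \<le> norm a * norm b * K"
    using h.pos_bounded by blast
  have ai1: "(\<lambda>x. h (f' x) (g x)) absolutely_integrable_on {a..b}" if "0 \<le> a" for a b
    using absolutely_integrable_bilinear_continuous[OF h.flip, of a b g f']
      ac_absolutely_integrable[OF f that] continuous_on_subset[OF ac_continuous_on_halfline[OF g]] that
    by auto
  have ai2: "(\<lambda>x. h (f x) (g' x)) absolutely_integrable_on {a..b}" if "0 \<le> a" for a b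
    using absolutely_integrable_bilinear_continuous[OF h, of a b f g']
      ac_absolutely_integrable[OF g that] continuous_on_subset[OF ac_continuous_on_halfline[OF f]] that
    by auto
  let ?d = "\<lambda>x. h (f' x) (g x) + h (f x) (g' x)"
  have ai: "?d absolutely_integrable_on {a..b}" if "0 \<le> a" for a b
    using ai1 ai2 that by (intro set_integral_add(1)) auto
  note I1 = set_lebesgue_integral_eq_integral(1)[OF ai1]
  note I2 = set_lebesgue_integral_eq_integral(1)[OF ai2]
  note I = set_lebesgue_integral_eq_integral(1)[OF ai]
  define F where "F = (\<lambda>x. integral {0..x} (\<lambda>t. norm (f' t)))"
  define G where "G = (\<lambda>x. integral {0..x} (\<lambda>t. norm (g' t)))"
  have nf: "(\<lambda>t. norm (f' t)) integrable_on {a..b}" if "0 \<le> a" for a b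
    using ac_absolutely_integrable[OF f that] absolutely_integrable_on_def by blast
  have ng: "(\<lambda>t. norm (g' t)) integrable_on {a..b}" if "0 \<le> a" for a b
    using ac_absolutely_integrable[OF g that] absolutely_integrable_on_def by blast
  have F: "integral {a..b} (\<lambda>t. norm (f' t)) = F b - F a" if "0 \<le> a" "a \<le> b" for a b
    unfolding F_def
    using Henstock_Kurzweil_Integration.integral_combine[of 0 a b "\<lambda>t. norm (f' t)"] nf that by auto
  have G: "integral {a..b} (\<lambda>t. norm (g' t)) = G b - G a" if "0 \<le> a" "a \<le> b" for a b
    unfolding G_def
    using Henstock_Kurzweil_Integration.integral_combine[of 0 a b "\<lambda>t. norm (g' t)"] ng that by auto
  have fd: "norm (f b - f a) \<le> F b - F a" if "0 \<le> a" "a \<le> b" for a b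
    using integral_norm_bound_integral[of f' "{a..b}" "\<lambda>t. norm (f' t)"] that
      ac_integrable[OF f] nf ac_diff_integral[OF f] F by auto
  have gd: "norm (g b - g a) \<le> G b - G a" if "0 \<le> a" "a \<le> b" for a b
    using integral_norm_bound_integral[of g' "{a..b}" "\<lambda>t. norm (g' t)"] that
      ac_integrable[OF g] ng ac_diff_integral[OF g] G by auto
  have Fm: "F a \<le> F b" if "0 \<le> a" "a \<le> b" for a b
    using norm_ge_zero[of "f b - f a"] fd[OF that] by linarith
  have Gm: "G a \<le> G b" if "0 \<le> a" "a \<le> b" for a b
    using norm_ge_zero[of "g b - g a"] gd[OF that] by linarith
  \<comment> \<open>\<open>D\<close> is the defect of the product formula. The factor
    \<open>K + 1\<close> in \<open>m\<close> absorbs the constant of \<open>h\<close> into the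
    square, since \<open>2 * K \<le> (K + 1)\<^sup>2\<close>.\<close>
  define D where "D = (\<lambda>x. integral {0..x} ?d - h (f x) (g x))"
  define m where "m = (\<lambda>x. (K + 1) * (F x + G x))"
  have quad: "norm (D y - D x) \<le> (m y - m x)\<^sup>2" if xy: "0 \<le> x" "x \<le> y" for x y
  proof -
    have 1: "integral {0..y} ?d - integral {0..x} ?d = integral {x..y} ?d"
      using Henstock_Kurzweil_Integration.integral_combine[of 0 x y ?d] I xy by (auto simp: algebra_simps)
    have 2: "integral {x..y} ?d
        = integral {x..y} (\<lambda>t. h (f' t) (g t)) + integral {x..y} (\<lambda>t. h (f t) (g' t))"
      using I1 I2 xy by (intro Henstock_Kurzweil_Integration.integral_add) auto
    \<comment> \<open>Freezing \<open>g\<close> at the right end and \<open>f\<close> at the left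
      end makes the discrete product rule exact, without a second-order remainder.\<close>
    have 3: "h (f y) (g y) - h (f x) (g x) = h (f y - f x) (g y) + h (f x) (g y - g x)"
      by (simp add: h.diff_left h.diff_right)
    have hi1: "((\<lambda>t. h (f' t) (g y)) has_integral h (f y - f x) (g y)) {x..y}"
      using has_integral_linear[OF integrable_integral[OF ac_integrable[OF f xy(1)]]
          h.bounded_linear_left[of "g y"], of y] ac_diff_integral[OF f xy] xy by (simp add: o_def)
    have hi2: "((\<lambda>t. h (f x) (g' t)) has_integral h (f x) (g y - g x)) {x..y}"
      using has_integral_linear[OF integrable_integral[OF ac_integrable[OF g xy(1)]]
          h.bounded_linear_right[of "f x"], of y] ac_diff_integral[OF g xy] xy by (simp add: o_def)
    have 4: "((\<lambda>t. h (f' t) (g t) - h (f' t) (g y)) has_integral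
        (integral {x..y} (\<lambda>t. h (f' t) (g t)) - h (f y - f x) (g y))) {x..y}"
      by (intro has_integral_diff hi1 integrable_integral I1 xy)
    have 5: "((\<lambda>t. h (f t) (g' t) - h (f x) (g' t)) has_integral
        (integral {x..y} (\<lambda>t. h (f t) (g' t)) - h (f x) (g y - g x))) {x..y}"
      by (intro has_integral_diff hi2 integrable_integral I2 xy)
    have 6: "norm (integral {x..y} (\<lambda>t. h (f' t) (g t)) - h (f y - f x) (g y))
        \<le> integral {x..y} (\<lambda>t. norm (f' t) * ((G y - G x) * K))"
    proof -
      have "norm (h (f' t) (g t) - h (f' t) (g y)) \<le> norm (f' t) * ((G y - G x) * K)"
        if t: "t \<in> {x..y}" for t
      proof -
        have "norm (g t - g y) \<le> G y - G t"
          using gd[of t y] t xy by (simp add: norm_minus_commute)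
        also have "\<dots> \<le> G y - G x" using Gm[of x t] t xy by simp
        finally have "norm (g t - g y) \<le> G y - G x" .
        then have "norm (f' t) * norm (g t - g y) * K \<le> norm (f' t) * (G y - G x) * K"
          using K by (intro mult_right_mono mult_left_mono) auto
        then show ?thesis
          using K(2)[of "f' t" "g t - g y"] by (simp add: h.diff_right mult.assoc)
      qed
      then show ?thesis
        unfolding integral_unique[OF 4, symmetric]
        by (intro integral_norm_bound_integral has_integral_integrable[OF 4] integrable_on_mult_left nf xy)
          auto
    qed
    have 7: "norm (integral {x..y} (\<lambda>t. h (f t) (g' t)) - h (f x) (g y - g x))
        \<le> integral {x..y} (\<lambda>t. norm (g' t) * ((F y - F x) * K))"
    proof -
      have "norm (h (f t) (g' t) - h (f x) (g' t)) \<le> norm (g' t) * ((F y - F x) * K)"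
        if t: "t \<in> {x..y}" for t
      proof -
        have "norm (f t - f x) \<le> F t - F x"
          using fd[of x t] t xy by simp
        also have "\<dots> \<le> F y - F x" using Fm[of t y] t xy by simp
        finally have "norm (f t - f x) \<le> F y - F x" .
        then have "norm (f t - f x) * norm (g' t) * K \<le> (F y - F x) * norm (g' t) * K"
          using K by (intro mult_right_mono) auto
        then show ?thesis
          using K(2)[of "f t - f x" "g' t"] by (simp add: h.diff_left mult_ac)
      qed
      then show ?thesis
        unfolding integral_unique[OF 5, symmetric]
        by (intro integral_norm_bound_integral has_integral_integrable[OF 5] integrable_on_mult_left ng xy)
          auto
    qed
    have Deq: "D y - D x = (integral {x..y} (\<lambda>t. h (f' t) (g t)) - h (f y - f x) (g y))
        + (integral {x..y} (\<lambda>t. h (f t) (g' t)) - h (f x) (g y - g x))"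
      unfolding D_def using 1 2 3 by (simp add: algebra_simps)
    have "norm (D y - D x) \<le> (F y - F x) * ((G y - G x) * K) + (G y - G x) * ((F y - F x) * K)"
      using 6 7 norm_triangle_ineq[of "integral {x..y} (\<lambda>t. h (f' t) (g t)) - h (f y - f x) (g y)"
          "integral {x..y} (\<lambda>t. h (f t) (g' t)) - h (f x) (g y - g x)"]
      unfolding Deq Henstock_Kurzweil_Integration.integral_mult_left F[OF xy] G[OF xy] by linarith
    also have "\<dots> = 2 * K * ((F y - F x) * (G y - G x))" by (simp add: algebra_simps)
    also have "\<dots> \<le> (K + 1)\<^sup>2 * ((F y - F x) + (G y - G x))\<^sup>2"
    proof (rule mult_mono)
      show "2 * K \<le> (K + 1)\<^sup>2" using K by (simp add: power2_sum)
      have "0 \<le> (F y - F x) * (G y - G x)" using Fm[OF xy] Gm[OF xy] by simp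
      then show "(F y - F x) * (G y - G x) \<le> ((F y - F x) + (G y - G x))\<^sup>2"
        unfolding power2_sum using zero_le_power2[of "F y - F x"] zero_le_power2[of "G y - G x"] by linarith
      show "0 \<le> (F y - F x) * (G y - G x)" using Fm[OF xy] Gm[OF xy] by simp
    qed simp
    also have "\<dots> = (m y - m x)\<^sup>2" by (simp add: m_def power_mult_distrib[symmetric] algebra_simps)
    finally show ?thesis .
  qed
  have "D x = D 0" if "0 \<le> x" for x
  proof (rule constant_if_quadratic_increments[of 0 x D m])
    show "continuous_on {0..x} m"
      unfolding m_def F_def G_def
      by (intro continuous_intros indefinite_integral_continuous_1 nf ng) auto
  qed (use quad that in auto)
  then have "h (f x) (g x) = h (f 0) (g 0) + integral {0..x} ?d" if "0 \<le> x" for x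
    using that by (simp add: D_def algebra_simps)
  with ai show ?thesis unfolding ac_def by blast
qed


section \<open>Gronwall's inequality and Picard iteration\<close>

lemma gronwall:
  fixes \<phi> :: "real \<Rightarrow> real"
  assumes cont: "continuous_on {0..b} \<phi>" and "0 \<le> K"
    and le: "\<And>x. 0 \<le> x \<Longrightarrow> x \<le> b \<Longrightarrow> \<phi> x \<le> a + K * integral {0..x} \<phi>"
    and x: "0 \<le> x" "x \<le> b"
  shows "\<phi> x \<le> a * exp (K * x)"
proof -
  \<comment> \<open>The majorant is differentiable with
    \<open>\<Phi>' = K * \<phi> \<le> K * \<Phi>\<close>, so multiplying it by
    \<open>exp (- K * x)\<close> gives a nonincreasing function.\<close>
  define \<Phi> where "\<Phi> = (\<lambda>x. a + K * integral {0..x} \<phi>)"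
  have c\<Phi>: "continuous_on {0..x} \<Phi>"
    unfolding \<Phi>_def
    by (intro continuous_intros indefinite_integral_continuous_1 integrable_continuous_interval
        continuous_on_subset[OF cont]) (use x in auto)
  have "\<Phi> x * exp (- K * x) \<le> \<Phi> 0 * exp (- K * 0)"
  proof (rule DERIV_nonpos_imp_decreasing_open[of 0 x])
    fix t assume t: "0 < t" "t < x"
    have "((\<lambda>u. integral {0..u} \<phi>) has_vector_derivative \<phi> t) (at t within {0..b})"
      by (rule integral_has_vector_derivative[OF cont]) (use t x in auto)
    then have "((\<lambda>u. integral {0..u} \<phi>) has_real_derivative \<phi> t) (at t)"
      using t x by (simp add: has_real_derivative_iff_has_vector_derivative at_within_Icc_at)
    then have "((\<lambda>u. \<Phi> u * exp (- K * u)) has_real_derivative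
        (K * \<phi> t) * exp (- K * t) + \<Phi> t * (exp (- K * t) * (- K))) (at t)"
      unfolding \<Phi>_def by (auto intro!: derivative_eq_intros)
    moreover have "K * \<phi> t * exp (- K * t) + \<Phi> t * (exp (- K * t) * (- K)) = K * exp (- K * t) * (\<phi> t - \<Phi> t)"
      by (simp add: algebra_simps)
    moreover have "\<dots> \<le> 0"
      using le[of t] t x \<open>0 \<le> K\<close> by (intro mult_nonneg_nonpos) (auto simp: \<Phi>_def)
    ultimately show "\<exists>y. ((\<lambda>u. \<Phi> u * exp (- K * u)) has_real_derivative y) (at t) \<and> y \<le> 0"
      by metis
  qed (use x in \<open>auto intro!: continuous_intros c\<Phi>\<close>)
  then have "\<Phi> x \<le> a * exp (K * x)"
    by (simp add: \<Phi>_def exp_minus field_simps)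
  then show ?thesis
    using le[OF x] by (simp add: \<Phi>_def)
qed

text \<open>Picard iteration is a contraction for the supremum norm weighted by \<open>exp (- 2 \<integral> k)\<close>.\<close>

lemma linear_ode_solution:
  fixes A :: "real \<Rightarrow> 'a \<Rightarrow> 'a::euclidean_space" and k :: "real \<Rightarrow> real"
  assumes A_diff: "\<And>t y z. 0 \<le> t \<Longrightarrow> A t (y - z) = A t y - A t z"
    and A_bound: "\<And>t y. 0 \<le> t \<Longrightarrow> norm (A t y) \<le> k t * norm y"
    and A_cont: "\<And>y. continuous_on {0..} y \<Longrightarrow> continuous_on {0..} (\<lambda>t. A t (y t))"
    and k_cont: "continuous_on {0..} k" and k_nonneg: "\<And>t. 0 \<le> t \<Longrightarrow> 0 \<le> k t"
  shows "\<exists>Y. Y 0 = y0 \<and> ac Y (\<lambda>t. A t (Y t))"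
proof -
  define \<kappa> where "\<kappa> = (\<lambda>x. 0 + integral {0..x} k)"
  have ac_\<kappa>: "ac \<kappa> k"
    unfolding \<kappa>_def by (rule ac_integral_continuous[OF k_cont])
  have \<kappa>_deriv: "(\<kappa> has_vector_derivative k x) (at x within {0..})" if "0 \<le> x" for x
    by (rule ac_imp_has_vector_derivative[OF ac_\<kappa> k_cont that])
  have \<kappa>_cont: "continuous_on {0..} \<kappa>"
    by (rule ac_continuous_on_halfline[OF ac_\<kappa>])
  have \<kappa>_nonneg: "0 \<le> \<kappa> x" for x
  proof -
    have "k integrable_on {0..x}"
      by (rule integrable_continuous_interval, rule continuous_on_subset[OF k_cont]) auto
    then have "0 \<le> integral {0..x} k"
      by (rule Henstock_Kurzweil_Integration.integral_nonneg) (use k_nonneg in auto)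
    then show ?thesis by (simp add: \<kappa>_def)
  qed
  have \<kappa>0: "\<kappa> 0 = 0" by (simp add: \<kappa>_def)
  \<comment> \<open>This is where the 2 in the weight pays off: the integral is less than half of
    the weight at \<open>x\<close>, so multiplication by \<open>exp (- 2 * \<kappa> x)\<close>
    leaves a contraction factor of at most 1/2.\<close>
  have wint: "((\<lambda>t. k t * exp (2 * \<kappa> t)) has_integral (exp (2 * \<kappa> x) - 1) / 2) {0..x}"
    if x: "0 \<le> x" for x
  proof -
    have "((\<lambda>t. exp (2 * \<kappa> t) / 2) has_vector_derivative k t * exp (2 * \<kappa> t)) (at t within {0..x})"
      if "t \<in> {0..x}" for t
    proof -
      have "(\<kappa> has_real_derivative k t) (at t within {0..x})"
        unfolding has_real_derivative_iff_has_vector_derivative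
        by (rule has_vector_derivative_within_subset[OF \<kappa>_deriv]) (use that in auto)
      then show ?thesis
        unfolding has_real_derivative_iff_has_vector_derivative[symmetric]
        by (auto intro!: derivative_eq_intros)
    qed
    from fundamental_theorem_of_calculus[OF x this] show ?thesis
      by (simp add: \<kappa>0 diff_divide_distrib)
  qed
  define I where "I = (\<lambda>(z::real \<Rightarrow> 'a) x. integral {0..x} (\<lambda>t. A t (exp (2 * \<kappa> t) *\<^sub>R z t)))"
  have cont_integrand: "continuous_on {0..} (\<lambda>t. A t (exp (2 * \<kappa> t) *\<^sub>R z t))"
    if "continuous_on UNIV z" for z
    by (intro A_cont continuous_intros \<kappa>_cont continuous_on_subset[OF that]) auto
  have integrable: "(\<lambda>t. A t (exp (2 * \<kappa> t) *\<^sub>R z t)) integrable_on {0..x}"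
    if "continuous_on UNIV z" for z x
    by (intro integrable_continuous_interval continuous_on_subset[OF cont_integrand[OF that]]) auto
  have I_diff: "norm (I y x - I z x) \<le> d * ((exp (2 * \<kappa> x) - 1) / 2)"
    if "continuous_on UNIV y" "continuous_on UNIV z" "0 \<le> x" "\<And>t. norm (y t - z t) \<le> d" for y z x d
  proof -
    have "I y x - I z x = integral {0..x} (\<lambda>t. A t (exp (2 * \<kappa> t) *\<^sub>R y t) - A t (exp (2 * \<kappa> t) *\<^sub>R z t))"
      unfolding I_def using integrable that by (intro Henstock_Kurzweil_Integration.integral_diff[symmetric]) auto
    also have "norm \<dots> \<le> integral {0..x} (\<lambda>t. d * (k t * exp (2 * \<kappa> t)))"
    proof (rule integral_norm_bound_integral)
      show "(\<lambda>t. A t (exp (2 * \<kappa> t) *\<^sub>R y t) - A t (exp (2 * \<kappa> t) *\<^sub>R z t)) integrable_on {0..x}"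
        by (intro integrable_diff integrable that)
      show "(\<lambda>t. d * (k t * exp (2 * \<kappa> t))) integrable_on {0..x}"
        using wint[OF \<open>0 \<le> x\<close>] by (intro integrable_on_mult_right) auto
      fix t assume t: "t \<in> {0..x}"
      have "norm (A t (exp (2 * \<kappa> t) *\<^sub>R y t) - A t (exp (2 * \<kappa> t) *\<^sub>R z t))
          = norm (A t (exp (2 * \<kappa> t) *\<^sub>R (y t - z t)))"
        using t by (simp add: A_diff[symmetric] scaleR_diff_right)
      also have "\<dots> \<le> k t * (exp (2 * \<kappa> t) * norm (y t - z t))"
        using A_bound[of t "exp (2 * \<kappa> t) *\<^sub>R (y t - z t)"] t by simp
      also have "\<dots> \<le> k t * (exp (2 * \<kappa> t) * d)"
        using k_nonneg[of t] t that(4) by (intro mult_left_mono) auto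
      finally show "norm (A t (exp (2 * \<kappa> t) *\<^sub>R y t) - A t (exp (2 * \<kappa> t) *\<^sub>R z t)) \<le> d * (k t * exp (2 * \<kappa> t))"
        by (simp add: mult_ac)
    qed
    also have "\<dots> = d * ((exp (2 * \<kappa> x) - 1) / 2)"
      using integral_unique[OF wint[OF \<open>0 \<le> x\<close>]] by simp
    finally show ?thesis .
  qed
  \<comment> \<open>The unknown here is the solution divided by \<open>exp (2 * \<kappa>)\<close>.
    Replacing \<open>x\<close> by \<open>max 0 x\<close> makes it a function on the whole line, so
    that the complete space of bounded continuous functions is available.\<close>
  define T where "T = (\<lambda>(z::real \<Rightarrow> 'a) x. exp (- 2 * \<kappa> (max 0 x)) *\<^sub>R (y0 + I z (max 0 x)))"
  have T_diff: "norm (T y x - T z x) \<le> d / 2"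
    if "continuous_on UNIV y" "continuous_on UNIV z" "\<And>t. norm (y t - z t) \<le> d" for y z x d
  proof -
    have d: "0 \<le> d" using that(3)[of 0] norm_ge_zero order_trans by blast
    have "norm (T y x - T z x) = exp (- 2 * \<kappa> (max 0 x)) * norm (I y (max 0 x) - I z (max 0 x))"
      by (simp add: T_def scaleR_diff_right[symmetric])
    also have "\<dots> \<le> exp (- 2 * \<kappa> (max 0 x)) * (d * ((exp (2 * \<kappa> (max 0 x)) - 1) / 2))"
      by (intro mult_left_mono I_diff that) auto
    also have "\<dots> = d / 2 * (1 - exp (- 2 * \<kappa> (max 0 x)))"
      by (simp add: exp_minus field_simps)
    also have "\<dots> \<le> d / 2 * 1"
      using d by (intro mult_left_mono) auto
    finally show ?thesis by simp
  qed
  have T_cont: "continuous_on UNIV (T z)" if z: "continuous_on UNIV z" for z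
  proof -
    have "continuous_on {0..} (\<lambda>x. 0 + integral {0..x} (\<lambda>t. A t (exp (2 * \<kappa> t) *\<^sub>R z t)))"
      by (rule ac_continuous_on_halfline[OF ac_integral_continuous[OF cont_integrand[OF z]]])
    then have 1: "continuous_on {0..} (I z)" by (simp add: I_def)
    have "continuous_on UNIV (\<lambda>x. I z (max 0 x))"
      by (rule continuous_on_compose2[OF 1]) (auto intro!: continuous_intros)
    moreover have "continuous_on UNIV (\<lambda>x. \<kappa> (max 0 x))"
      by (rule continuous_on_compose2[OF \<kappa>_cont]) (auto intro!: continuous_intros)
    ultimately show ?thesis
      unfolding T_def by (intro continuous_intros)
  qed
  have T0: "norm (T (\<lambda>t. 0) x) \<le> norm y0" for x
  proof -
    have "A t 0 = 0" if "0 \<le> t" for t using A_diff[OF that, of 0 0] by simp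
    then have "I (\<lambda>t. 0) (max 0 x) = 0"
      unfolding I_def
      by (subst Henstock_Kurzweil_Integration.integral_cong[of _ _ "\<lambda>_. 0"]) auto
    then show ?thesis
      using \<kappa>_nonneg[of "max 0 x"] mult_right_mono[of "exp (- 2 * \<kappa> (max 0 x))" 1 "norm y0"]
      by (simp add: T_def)
  qed
  \<comment> \<open>Boundedness of the image follows from the contraction estimate by comparison
    with the image of 0.\<close>
  have T_bcont: "T (apply_bcontfun z) \<in> bcontfun" for z :: "real \<Rightarrow>\<^sub>C 'a"
  proof -
    obtain B where B: "\<And>t. norm (apply_bcontfun z t) \<le> B"
      using bounded_apply_bcontfun[of z] by (auto simp: bounded_iff)
    have "norm (T z x) \<le> B / 2 + norm y0" for x
    proof -
      have "norm (T z x - T (\<lambda>t. 0) x) \<le> B / 2"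
        by (rule T_diff) (use B in auto)
      then show ?thesis
        using T0[of x] norm_triangle_sub[of "T z x" "T (\<lambda>t. 0) x"] by linarith
    qed
    then show ?thesis
      unfolding bcontfun_def using T_cont[of z] by (auto simp: bounded_iff)
  qed
  define S where "S z = Bcontfun (T (apply_bcontfun z))" for z :: "real \<Rightarrow>\<^sub>C 'a"
  have S: "apply_bcontfun (S z) = T z" for z
    unfolding S_def by (rule Bcontfun_inverse[OF T_bcont])
  have "\<exists>!z. S z = z"
  proof (rule banach_fix_type[where c = "1/2"])
    show "\<forall>y z. dist (S y) (S z) \<le> 1/2 * dist y z"
    proof (intro allI dist_bound)
      fix y z :: "real \<Rightarrow>\<^sub>C 'a" and x
      show "dist (S y x) (S z x) \<le> 1/2 * dist y z"
        using T_diff[of y z "dist y z" x] dist_bounded[of y _ z] by (simp add: S dist_norm)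
    qed
  qed auto
  then obtain z where z: "S z = z" by blast
  define Y where "Y x = exp (2 * \<kappa> x) *\<^sub>R apply_bcontfun z x" for x
  have Y: "Y x = y0 + integral {0..x} (\<lambda>t. A t (Y t))" if "0 \<le> x" for x
  proof -
    have "apply_bcontfun z x = T z x" using S[of z] z by simp
    then show ?thesis
      using that by (simp add: Y_def T_def I_def exp_minus max_def)
  qed
  have Y0: "Y 0 = y0" using Y[of 0] by simp
  have "ac (\<lambda>x. y0 + integral {0..x} (\<lambda>t. A t (Y t))) (\<lambda>t. A t (Y t))"
    by (rule ac_integral_continuous)
      (use cont_integrand[of z] in \<open>simp add: Y_def\<close>)
  then have "ac Y (\<lambda>t. A t (Y t))"
    by (rule ac_cong) (rule Y, auto)
  with Y0 show ?thesis by blast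
qed

section \<open>Self-adjoint operators in the Hilbert space\<close>

lemma L2_cases:
  obtains u where "square_integrable u" "U = abs_L2 u"
proof
  show "square_integrable (rep_L2 U)"
    using Quotient_rep_reflp[OF Quotient_L2, of U] by simp
  show "U = abs_L2 (rep_L2 U)"
    using Quotient_abs_rep[OF Quotient_L2, of U] by simp
qed

lemma abs_L2_eq_iff:
  assumes "square_integrable u" "square_integrable v"
  shows "abs_L2 u = abs_L2 v \<longleftrightarrow> (AE x in half_line. u x = v x)"
  using Quotient_rel[OF Quotient_L2, of u v] assms by auto

lemma scaleC_abs_L2: "square_integrable u \<Longrightarrow> scaleC_L2 c (abs_L2 u) = abs_L2 (\<lambda>x. c * u x)"
  by (rule scaleC_L2.abs_eq) auto

lemma plus_abs_L2:
  "square_integrable u \<Longrightarrow> square_integrable v \<Longrightarrow> abs_L2 u + abs_L2 v = abs_L2 (\<lambda>x. u x + v x)"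
  by (rule plus_L2.abs_eq) auto

lemma minus_abs_L2:
  assumes "square_integrable u" "square_integrable v"
  shows "abs_L2 u - abs_L2 v = abs_L2 (\<lambda>x. u x - v x)"
  unfolding minus_L2_def uminus_L2_def scaleC_abs_L2[OF assms(2)]
    plus_abs_L2[OF assms(1) square_integrable_scale[OF assms(2)]] by simp

lemma square_integrable_diff:
  assumes "square_integrable u" "square_integrable v"
  shows "square_integrable (\<lambda>x. u x - v x)"
  using square_integrable_add[OF assms(1) square_integrable_scale[OF assms(2), of "-1"]] by simp

lemma cinner_abs_L2:
  "square_integrable u \<Longrightarrow> square_integrable v \<Longrightarrow>
    cinner_L2 (abs_L2 u) (abs_L2 v) = (\<integral>x. cnj (u x) * v x \<partial>half_line)"
  by (rule cinner_L2.abs_eq) auto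

lemma norm_abs_L2:
  assumes "square_integrable u"
  shows "(norm (abs_L2 u))\<^sup>2 = (\<integral>x. (cmod (u x))\<^sup>2 \<partial>half_line)"
proof -
  have "cnj z * z = complex_of_real ((cmod z)\<^sup>2)" for z
    by (metis complex_norm_square mult.commute of_real_power)
  then show ?thesis
    using assms unfolding power2_norm_eq_inner inner_L2_def
    by (simp add: cinner_abs_L2 del: of_real_power)
qed

lemma cinner_scaleC_left: "cinner_L2 (scaleC_L2 c U) W = cnj c * cinner_L2 U W"
  by transfer (simp add: mult.assoc)

lemma cinner_scaleC_right: "cinner_L2 U (scaleC_L2 c W) = c * cinner_L2 U W"
proof transfer
  fix c u w
  have "(\<integral>x. cnj (u x) * (c * w x) \<partial>half_line) = (\<integral>x. c * (cnj (u x) * w x) \<partial>half_line)"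
    by (simp add: mult_ac)
  then show "(\<integral>x. cnj (u x) * (c * w x) \<partial>half_line) = c * (\<integral>x. cnj (u x) * w x \<partial>half_line)"
    by simp
qed

lemma cinner_add_right: "cinner_L2 W (U + V) = cinner_L2 W U + cinner_L2 W V"
  by transfer (simp add: distrib_left square_integrable_mult)

lemma cinner_commute: "cinner_L2 U W = cnj (cinner_L2 W U)"
proof transfer
  fix u w :: "real \<Rightarrow> complex"
  have "(\<integral>x. cnj (u x) * w x \<partial>half_line) = (\<integral>x. cnj (cnj (w x) * u x) \<partial>half_line)"
    by (simp add: mult.commute)
  also have "\<dots> = cnj (\<integral>x. cnj (w x) * u x \<partial>half_line)"
    by (rule Bochner_Integration.integral_cnj)
  finally show "(\<integral>x. cnj (u x) * w x \<partial>half_line) = cnj (\<integral>x. cnj (w x) * u x \<partial>half_line)" .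
qed

lemma cinner_diff_right: "cinner_L2 W (U - V) = cinner_L2 W U - cinner_L2 W V"
  unfolding minus_L2_def uminus_L2_def cinner_add_right cinner_scaleC_right by simp

lemma Re_cinner: "Re (cinner_L2 U W) = inner U W"
  by (simp add: inner_L2_def)

text \<open>Together with \<open>Re_cinner\<close> this reduces continuity of the complex inner
  product to that of the real one.\<close>

lemma Im_cinner: "Im (cinner_L2 U W) = inner (scaleC_L2 \<i> U) W"
  by (simp add: inner_L2_def cinner_scaleC_left)

lemma cinner_self: "cinner_L2 U U = complex_of_real ((norm U)\<^sup>2)"
proof (rule complex_eqI)
  show "Re (cinner_L2 U U) = Re (complex_of_real ((norm U)\<^sup>2))"
    by (simp add: Re_cinner power2_norm_eq_inner)
  have "Im (cinner_L2 U U) = - Im (cinner_L2 U U)"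
    by (subst cinner_commute) simp
  then show "Im (cinner_L2 U U) = Im (complex_of_real ((norm U)\<^sup>2))" by simp
qed

lemma norm_scaleC: "norm (scaleC_L2 c U) = cmod c * norm U"
proof -
  have "complex_of_real ((norm (scaleC_L2 c U))\<^sup>2) = cnj c * c * cinner_L2 U U"
    by (simp only: cinner_self[symmetric] cinner_scaleC_left cinner_scaleC_right) simp
  also have "\<dots> = complex_of_real ((cmod c)\<^sup>2 * (norm U)\<^sup>2)"
    by (simp only: cinner_self of_real_mult complex_norm_square[of c] mult_ac)
  finally have "(norm (scaleC_L2 c U))\<^sup>2 = (cmod c * norm U)\<^sup>2"
    by (metis of_real_eq_iff power_mult_distrib)
  then show ?thesis by (simp add: power2_eq_iff_nonneg)
qed

lemma cmod_cinner_le: "cmod (cinner_L2 U W) \<le> norm U * norm W"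
proof (cases "cinner_L2 U W = 0")
  case False
  let ?c = "cinner_L2 U W"
  \<comment> \<open>Multiplying \<open>U\<close> by \<open>?c\<close> turns the complex inner
    product into a nonnegative real one, for which the real Cauchy-Schwarz inequality
    suffices.\<close>
  have "cinner_L2 (scaleC_L2 ?c U) W = complex_of_real ((cmod ?c)\<^sup>2)"
    by (simp only: cinner_scaleC_left complex_norm_square mult.commute)
  then have "(cmod ?c)\<^sup>2 = inner (scaleC_L2 ?c U) W"
    by (metis Re_cinner Re_complex_of_real)
  also have "\<dots> \<le> cmod ?c * norm U * norm W"
    using norm_cauchy_schwarz[of "scaleC_L2 ?c U" W] by (simp add: norm_scaleC)
  finally show ?thesis
    using False by (simp add: power2_eq_square)
qed simp

lemma scaleR_eq_scaleC: "r *\<^sub>R U = scaleC_L2 (complex_of_real r) U" for U :: L2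
  by (rule scaleR_L2_def)

lemma bounded_linear_scaleC: "bounded_linear (scaleC_L2 c)"
proof (rule bounded_linear_intro[where K = "cmod c"])
  show "scaleC_L2 c (r *\<^sub>R U) = r *\<^sub>R scaleC_L2 c U" for r U
    by (simp add: scaleR_eq_scaleC mult.commute)
qed (simp_all add: complex_L2.scale_right_distrib norm_scaleC mult.commute)

lemma tendsto_cinner_left:
  assumes "(X \<longlongrightarrow> U) F"
  shows "((\<lambda>n. cinner_L2 (X n) W) \<longlongrightarrow> cinner_L2 U W) F"
proof -
  have "((\<lambda>n. Complex (inner (X n) W) (inner (scaleC_L2 \<i> (X n)) W)) \<longlongrightarrow>
      Complex (inner U W) (inner (scaleC_L2 \<i> U) W)) F"
    by (intro tendsto_intros assms bounded_linear.tendsto[OF bounded_linear_scaleC])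
  moreover have "Complex (inner V W) (inner (scaleC_L2 \<i> V) W) = cinner_L2 V W" for V
    by (rule complex_eqI) (simp_all only: complex.sel Re_cinner Im_cinner)
  ultimately show ?thesis by simp
qed

lemma nn_integral_norm_L2:
  assumes "square_integrable u"
  shows "(\<integral>\<^sup>+x. ennreal ((cmod (u x))\<^sup>2) \<partial>half_line) = ennreal ((norm (abs_L2 u))\<^sup>2)"
  unfolding norm_abs_L2[OF assms]
  using assms by (intro nn_integral_eq_integral) (auto simp: square_integrable_def)

section \<open>Completeness and orthogonal complements\<close>

lemma convergent_if_summable_diff:
  fixes a :: "nat \<Rightarrow> 'a::real_normed_vector"
  assumes "summable (\<lambda>n. a (Suc n) - a n)"
  shows "convergent a"
proof -
  have "(\<lambda>n. a 0 + (\<Sum>i<n. a (Suc i) - a i)) \<longlonglongrightarrow> a 0 + (\<Sum>n. a (Suc n) - a n)"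
    by (intro tendsto_intros summable_LIMSEQ assms)
  then show ?thesis
    by (auto simp: sum_lessThan_telescope convergent_def)
qed

text \<open>Riesz-Fischer: a subsequence with geometrically small increments converges almost
  everywhere, and Fatou's lemma shows that the pointwise limit is also its limit in norm.\<close>

instance L2 :: complete_space
proof
  fix X :: "nat \<Rightarrow> L2" assume X: "Cauchy X"
  have "\<forall>n. \<exists>N. \<forall>i\<ge>N. \<forall>j\<ge>N. norm (X i - X j) < (1/2) ^ n"
    using X unfolding Cauchy_def dist_norm by simp
  then obtain N where N: "\<And>n i j. N n \<le> i \<Longrightarrow> N n \<le> j \<Longrightarrow> norm (X i - X j) < (1/2) ^ n"
    by metis
  \<comment> \<open>Summing the \<open>N i\<close> makes \<open>r n\<close> at least each
    \<open>N i\<close> with \<open>i \<le> n\<close>, and the summand \<open>n\<close> makes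
    \<open>r\<close> strictly increasing.\<close>
  define r where "r n = (\<Sum>i\<le>n. N i) + n" for n
  have r_mono: "strict_mono r" by (rule strict_monoI_Suc) (simp add: r_def)
  have rN: "N m \<le> r n" if "m \<le> n" for m n
    using member_le_sum[of m "{..n}" N] that by (simp add: r_def)
  have "\<exists>u. square_integrable u \<and> X (r n) = abs_L2 u" for n
    by (metis L2_cases)
  then obtain u where u: "\<And>n. square_integrable (u n)" "\<And>n. X (r n) = abs_L2 (u n)"
    by metis
  have um [measurable]: "u n \<in> borel_measurable half_line" for n
    using u(1) by (simp add: square_integrable_def)
  have diff: "(\<integral>\<^sup>+x. ennreal ((cmod (u i x - u m x))\<^sup>2) \<partial>half_line) \<le> ennreal ((1/4) ^ m)" if "m \<le> i" for m i
  proof -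
    have "(\<integral>\<^sup>+x. ennreal ((cmod (u i x - u m x))\<^sup>2) \<partial>half_line) = ennreal ((norm (X (r i) - X (r m)))\<^sup>2)"
      unfolding u(2) minus_abs_L2[OF u(1) u(1)]
      by (rule nn_integral_norm_L2) (intro square_integrable_diff u)
    also have "(norm (X (r i) - X (r m)))\<^sup>2 \<le> ((1/2) ^ m)\<^sup>2"
      using N[of m "r i" "r m"] rN[of m i] rN[of m m] that by (intro power_mono) auto
    also have "((1/2) ^ m)\<^sup>2 = ((1/4) ^ m :: real)"
      by (simp add: power2_eq_square power_mult_distrib[symmetric])
    finally show ?thesis by (simp add: ennreal_leI)
  qed
  \<comment> \<open>The integral of the squared increment is at most \<open>(1/4) ^ n\<close>, so
    the weight \<open>2 ^ n\<close> keeps the series integrable while still forcing geometric decay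
    of the increments at almost every point.\<close>
  let ?d = "\<lambda>n x. 2 ^ n * (cmod (u (Suc n) x - u n x))\<^sup>2"
  have "(\<integral>\<^sup>+x. (\<Sum>n. ennreal (?d n x)) \<partial>half_line) = (\<Sum>n. \<integral>\<^sup>+x. ennreal (?d n x) \<partial>half_line)"
    by (rule nn_integral_suminf) measurable
  also have "\<dots> \<le> (\<Sum>n. ennreal ((1/2) ^ n))"
  proof (rule suminf_le)
    fix n
    have "(\<integral>\<^sup>+x. ennreal (?d n x) \<partial>half_line) = ennreal (2 ^ n) * (\<integral>\<^sup>+x. ennreal ((cmod (u (Suc n) x - u n x))\<^sup>2) \<partial>half_line)"
      by (simp add: ennreal_mult nn_integral_cmult)
    also have "\<dots> \<le> ennreal (2 ^ n) * ennreal ((1/4) ^ n)"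
      by (intro mult_left_mono diff) auto
    also have "\<dots> = ennreal ((1/2) ^ n)"
      by (simp add: ennreal_mult[symmetric] power_mult_distrib[symmetric])
    finally show "(\<integral>\<^sup>+x. ennreal (?d n x) \<partial>half_line) \<le> ennreal ((1/2) ^ n)" .
  qed auto
  also have "\<dots> = ennreal (\<Sum>n. (1/2) ^ n)"
    by (rule suminf_ennreal2) (auto intro: summable_geometric)
  finally have "(\<integral>\<^sup>+x. (\<Sum>n. ennreal (?d n x)) \<partial>half_line) \<noteq> \<infinity>"
    by (auto simp: top_unique)
  then have "AE x in half_line. (\<Sum>n. ennreal (?d n x)) \<noteq> \<infinity>"
    by (intro nn_integral_PInf_AE) measurable
  then have conv: "AE x in half_line. convergent (\<lambda>n. u n x)"
  proof eventually_elim
    fix x assume "(\<Sum>n. ennreal (?d n x)) \<noteq> \<infinity>"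
    then have "summable (\<lambda>n. ?d n x)"
      by (intro summable_suminf_not_top) auto
    then have "(\<lambda>n. ?d n x) \<longlonglongrightarrow> 0"
      by (rule summable_LIMSEQ_zero)
    then have "Bseq (\<lambda>n. ?d n x)"
      by (intro convergent_imp_Bseq convergentI)
    then obtain B where B': "\<And>n. norm (?d n x) \<le> B"
      unfolding Bseq_def by blast
    have B: "?d n x \<le> B" for n
      using B'[of n] unfolding real_norm_def by (rule abs_le_D1)
    have le: "norm (u (Suc n) x - u n x) \<le> sqrt B * sqrt (1/2) ^ n" for n
    proof -
      have "(cmod (u (Suc n) x - u n x))\<^sup>2 \<le> B * (1/2) ^ n"
        using B[of n] by (simp add: field_simps)
      then have "cmod (u (Suc n) x - u n x) \<le> sqrt (B * (1/2) ^ n)"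
        by (rule real_le_rsqrt)
      then show ?thesis by (simp add: real_sqrt_mult real_sqrt_power)
    qed
    have "summable (\<lambda>n. sqrt B * sqrt (1/2) ^ n)"
      by (intro summable_mult summable_geometric) (simp add: real_sqrt_divide)
    then have "summable (\<lambda>n. u (Suc n) x - u n x)"
      by (rule summable_comparison_test') (use le in auto)
    then show "convergent (\<lambda>n. u n x)"
      by (rule convergent_if_summable_diff)
  qed
  define v where "v x = lim (\<lambda>n. u n x)" for x
  have vm [measurable]: "v \<in> borel_measurable half_line"
    unfolding v_def by (rule borel_measurable_lim_metric) measurable
  have lim: "AE x in half_line. (\<lambda>n. u n x) \<longlonglongrightarrow> v x"
    using conv by eventually_elim (simp add: v_def convergent_LIMSEQ_iff)
  have fatou: "(\<integral>\<^sup>+x. ennreal ((cmod (v x - u m x))\<^sup>2) \<partial>half_line) \<le> ennreal ((1/4) ^ m)" for m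
  proof -
    have "(\<integral>\<^sup>+x. ennreal ((cmod (v x - u m x))\<^sup>2) \<partial>half_line)
        = (\<integral>\<^sup>+x. liminf (\<lambda>i. ennreal ((cmod (u i x - u m x))\<^sup>2)) \<partial>half_line)"
    proof (rule nn_integral_cong_AE)
      show "AE x in half_line. ennreal ((cmod (v x - u m x))\<^sup>2) = liminf (\<lambda>i. ennreal ((cmod (u i x - u m x))\<^sup>2))"
        using lim
      proof eventually_elim
        fix x assume "(\<lambda>n. u n x) \<longlonglongrightarrow> v x"
        then have "(\<lambda>i. ennreal ((cmod (u i x - u m x))\<^sup>2)) \<longlonglongrightarrow> ennreal ((cmod (v x - u m x))\<^sup>2)"
          by (intro tendsto_intros) auto
        then show "ennreal ((cmod (v x - u m x))\<^sup>2) = liminf (\<lambda>i. ennreal ((cmod (u i x - u m x))\<^sup>2))"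
          by (rule lim_imp_Liminf[OF trivial_limit_sequentially, symmetric])
      qed
    qed
    also have "\<dots> \<le> liminf (\<lambda>i. \<integral>\<^sup>+x. ennreal ((cmod (u i x - u m x))\<^sup>2) \<partial>half_line)"
      by (rule nn_integral_liminf) measurable
    also have "\<dots> \<le> ennreal ((1/4) ^ m)"
      by (rule Liminf_le) (auto intro!: eventually_sequentiallyI[of m] diff)
    finally show ?thesis .
  qed
  have sq: "square_integrable (\<lambda>x. v x - u m x)" for m
    unfolding square_integrable_def
  proof
    show "integrable half_line (\<lambda>x. (cmod (v x - u m x))\<^sup>2)"
      by (rule integrableI_bounded) (use fatou[of m] in \<open>auto simp: top_unique less_top[symmetric]\<close>)
  qed measurable
  have v: "square_integrable v"
    using square_integrable_add[OF sq[of 0] u(1)[of 0]] by simp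
  have "norm (abs_L2 v - X (r m)) \<le> (1/2) ^ m" for m
  proof -
    have "ennreal ((norm (abs_L2 v - X (r m)))\<^sup>2) \<le> ennreal ((1/4) ^ m)"
      unfolding u(2) minus_abs_L2[OF v u(1)] using fatou[of m] by (simp add: nn_integral_norm_L2[OF sq])
    then have "(norm (abs_L2 v - X (r m)))\<^sup>2 \<le> ((1/2) ^ m)\<^sup>2"
      by (simp add: power2_eq_square power_mult_distrib[symmetric] ennreal_le_iff)
    then show ?thesis by (rule power2_le_imp_le) simp
  qed
  then have "(\<lambda>m. dist (X (r m)) (abs_L2 v)) \<longlonglongrightarrow> 0"
    by (intro tendsto_sandwich[OF _ _ tendsto_const LIMSEQ_power_zero[of "1/2::real"]])
      (auto simp: dist_norm norm_minus_commute)
  then have "(X \<circ> r) \<longlonglongrightarrow> abs_L2 v"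
    by (subst tendsto_dist_iff) (simp add: o_def)
  then show "convergent X"
    using Cauchy_converges_subseq[OF X r_mono] by (auto simp: convergent_def)
qed

text \<open>The vector is the remainder of a point outside \<open>S\<close> after subtracting its
  nearest point in \<open>S\<close>, which exists by completeness. Orthogonality is with respect to
  the real inner product.\<close>

lemma nonzero_orthogonal_to_closed_subspace:
  fixes S :: "'a::{real_inner,complete_space} set"
  assumes S: "subspace S" "closed S" "S \<noteq> UNIV"
  obtains g where "g \<noteq> 0" "\<And>s. s \<in> S \<Longrightarrow> inner g s = 0"
proof -
  obtain a where a: "a \<notin> S" using S(3) by auto
  have ne: "S \<noteq> {}" using subspace_0[OF S(1)] by auto
  define d where "d = infdist a S"
  have d: "0 \<le> d" by (simp add: d_def infdist_nonneg)
  have dle: "d \<le> norm (a - s)" if "s \<in> S" for s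
    using infdist_le[OF that, of a] by (simp add: d_def dist_norm)
  have "\<exists>s\<in>S. norm (a - s) < d + 1 / real (Suc n)" for n
  proof -
    have "d < d + 1 / real (Suc n)" by simp
    then show ?thesis
      unfolding d_def infdist_notempty[OF ne]
      by (subst (asm) cINF_less_iff) (use ne in \<open>auto simp: dist_norm intro: bdd_belowI2[where m = 0]\<close>)
  qed
  then obtain s where s: "\<And>n. s n \<in> S" "\<And>n. norm (a - s n) < d + 1 / real (Suc n)"
    by metis
  \<comment> \<open>Parallelogram law: the midpoint of \<open>s i\<close> and \<open>s j\<close>
    lies in \<open>S\<close>, hence at distance at least \<open>d\<close> from \<open>a\<close>,
    which forces two near-minimizers to be close.\<close>
  have par: "(norm (s i - s j))\<^sup>2 \<le> (8 * d + 4) * (1 / real (Suc n))" if "n \<le> i" "n \<le> j" for i j n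
  proof -
    let ?e = "1 / real (Suc n)"
    have e: "0 \<le> ?e" "?e \<le> 1" by auto
    have le: "norm (a - s i) \<le> d + ?e" if "n \<le> i" for i
    proof -
      have "1 / real (Suc i) \<le> ?e" using that by (intro divide_left_mono) auto
      then show ?thesis using s(2)[of i] by linarith
    qed
    have "(norm (a - s i))\<^sup>2 \<le> (d + ?e)\<^sup>2" "(norm (a - s j))\<^sup>2 \<le> (d + ?e)\<^sup>2"
      using le that by (auto intro!: power_mono)
    moreover have "d\<^sup>2 \<le> (norm (a - (1/2) *\<^sub>R (s i + s j)))\<^sup>2"
      using d by (intro power_mono dle subspace_mul subspace_add S s) auto
    moreover have "(norm (s i - s j))\<^sup>2 = 2 * (norm (a - s i))\<^sup>2 + 2 * (norm (a - s j))\<^sup>2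
        - 4 * (norm (a - (1/2) *\<^sub>R (s i + s j)))\<^sup>2"
      unfolding power2_norm_eq_inner
      by (simp add: inner_diff_left inner_diff_right inner_add_left inner_add_right inner_commute algebra_simps)
    ultimately have "(norm (s i - s j))\<^sup>2 \<le> 4 * (d + ?e)\<^sup>2 - 4 * d\<^sup>2" by linarith
    also have "\<dots> = ?e * (8 * d) + 4 * (?e * ?e)" by (simp add: power2_sum power2_eq_square algebra_simps)
    also have "\<dots> \<le> ?e * (8 * d) + 4 * (?e * 1)"
      using e by (intro add_mono mult_left_mono) auto
    finally show ?thesis by (simp add: algebra_simps)
  qed
  have "Cauchy s"
    unfolding Cauchy_def dist_norm
  proof (intro allI impI)
    fix e :: real assume e: "0 < e"
    have "(\<lambda>n. (8 * d + 4) * (1 / real (Suc n))) \<longlonglongrightarrow> (8 * d + 4) * 0"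
      by (intro tendsto_intros LIMSEQ_Suc[OF lim_1_over_n])
    then have "\<forall>\<^sub>F n in sequentially. (8 * d + 4) * (1 / real (Suc n)) < e\<^sup>2"
      by (rule order_tendstoD) (use e in auto)
    then obtain n where "(8 * d + 4) * (1 / real (Suc n)) < e\<^sup>2"
      by (auto simp: eventually_sequentially)
    then have "norm (s i - s j) < e" if "n \<le> i" "n \<le> j" for i j
      using par[OF that] e by (intro power2_less_imp_less[of _ e]) auto
    then show "\<exists>M. \<forall>m\<ge>M. \<forall>n\<ge>M. norm (s m - s n) < e" by blast
  qed
  then obtain s0 where s0: "s \<longlonglongrightarrow> s0"
    using Cauchy_convergent_iff convergent_def by blast
  have s0S: "s0 \<in> S" using closed_sequentially[OF S(2)] s(1) s0 by blast
  have lim: "(\<lambda>n. norm (a - s n)) \<longlonglongrightarrow> norm (a - s0)" by (intro tendsto_intros s0)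
  have "(\<lambda>n. d + 1 / real (Suc n)) \<longlonglongrightarrow> d + 0"
    by (intro tendsto_intros LIMSEQ_Suc[OF lim_1_over_n])
  from LIMSEQ_le[OF lim this] have min: "norm (a - s0) \<le> d"
    using s(2) less_imp_le by auto
  define g where "g = a - s0"
  have g0: "g \<noteq> 0" using a s0S by (auto simp: g_def)
  have "inner g t = 0" if t: "t \<in> S" for t
  proof (cases "t = 0")
    case False
    \<comment> \<open>This coefficient minimizes the distance from \<open>g\<close> to the line
      through \<open>t\<close>; a nonzero \<open>inner g t\<close> would improve on the minimal
      distance.\<close>
    define c where "c = inner g t / (norm t)\<^sup>2"
    have "norm g \<le> norm (a - (s0 + c *\<^sub>R t))"
      using dle[OF subspace_add[OF S(1) s0S subspace_mul[OF S(1) t]], of c] min by (simp add: g_def)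
    then have "(norm g)\<^sup>2 \<le> (norm (g - c *\<^sub>R t))\<^sup>2"
      by (intro power_mono) (auto simp: g_def algebra_simps)
    also have "\<dots> = (norm g)\<^sup>2 - 2 * c * inner g t + c\<^sup>2 * (norm t)\<^sup>2"
      unfolding power2_norm_eq_inner
      by (simp add: inner_diff_left inner_diff_right inner_commute power2_eq_square algebra_simps)
    also have "\<dots> = (norm g)\<^sup>2 - (inner g t)\<^sup>2 / (norm t)\<^sup>2"
      using False by (simp add: c_def field_simps power2_eq_square)
    finally show ?thesis using False by (simp add: divide_le_0_iff)
  qed simp
  then show ?thesis using that g0 by blast
qed


section \<open>Resolvent and spectrum of self-adjoint operators\<close>

lemma self_adjointD:
  assumes "self_adjoint T"
  shows "(U, F) \<in> T \<Longrightarrow> (W, G) \<in> T \<Longrightarrow> (U + W, F + G) \<in> T"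
    and "(U, F) \<in> T \<Longrightarrow> (scaleC_L2 c U, scaleC_L2 c F) \<in> T"
    and "(0, 0) \<in> T"
    and "(U, F) \<in> T \<longleftrightarrow> (\<forall>(A, B)\<in>T. cinner_L2 U B = cinner_L2 F A)"
    and "(U, F) \<in> T \<Longrightarrow> (U, G) \<in> T \<Longrightarrow> F = G"
proof -
  have "T = adjoint_operator T" using assms by (simp add: self_adjoint_def)
  then show "(U, F) \<in> T \<longleftrightarrow> (\<forall>(A, B)\<in>T. cinner_L2 U B = cinner_L2 F A)"
    unfolding adjoint_operator_def by blast
qed (use assms in \<open>auto simp: self_adjoint_def linear_operator_def single_valued_def\<close>)

lemma self_adjoint_diff:
  assumes "self_adjoint T" "(U, F) \<in> T" "(W, G) \<in> T"
  shows "(U - W, F - G) \<in> T"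
  unfolding minus_L2_def uminus_L2_def by (intro self_adjointD[OF assms(1)] assms)

text \<open>An adjoint is closed, because the relation that defines membership passes to limits in
  both components.\<close>

lemma self_adjoint_closed:
  assumes T: "self_adjoint T" and "\<And>n. (X n, Y n) \<in> T" "X \<longlonglongrightarrow> U" "Y \<longlonglongrightarrow> F"
  shows "(U, F) \<in> T"
  unfolding self_adjointD(4)[OF T]
proof safe
  fix A B assume AB: "(A, B) \<in> T"
  have "(\<lambda>n. cinner_L2 (X n) B) = (\<lambda>n. cinner_L2 (Y n) A)"
    using assms(2) AB self_adjointD(4)[OF T] by fast
  then show "cinner_L2 U B = cinner_L2 F A"
    using tendsto_cinner_left[OF assms(3), of B] tendsto_cinner_left[OF assms(4), of A]
      LIMSEQ_unique by metis
qed

lemma self_adjoint_eigenvalue_real: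
  assumes T: "self_adjoint T" and "(U, scaleC_L2 z U) \<in> T" "U \<noteq> 0"
  shows "cnj z = z"
proof -
  have "cinner_L2 U (scaleC_L2 z U) = cinner_L2 (scaleC_L2 z U) U"
    using assms(2) self_adjointD(4)[OF T] by blast
  then show ?thesis
    using assms(3) by (simp add: cinner_scaleC_left cinner_scaleC_right cinner_self)
qed

text \<open>The lower bound makes \<open>T - z\<close> injective with closed range. A nonzero vector
  orthogonal to the range would be an eigenvector of \<open>T\<close> for \<open>cnj z\<close>;
  eigenvalues are real, so it would violate the bound at \<open>z\<close> itself.\<close>

lemma resolvent_set_if_bounded_below:
  assumes T: "self_adjoint T" and c: "0 < c"
    and le: "\<And>U F. (U, F) \<in> T \<Longrightarrow> c * norm U \<le> norm (F - scaleC_L2 z U)"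
  shows "z \<in> resolvent_set T"
proof -
  define R where "R = {F - scaleC_L2 z U | U F. (U, F) \<in> T}"
  have R_scaleC: "scaleC_L2 d r \<in> R" if r: "r \<in> R" for r d
  proof -
    obtain U F where UF: "(U, F) \<in> T" "r = F - scaleC_L2 z U" using r by (auto simp: R_def)
    have "scaleC_L2 d r = scaleC_L2 d F - scaleC_L2 z (scaleC_L2 d U)"
      by (simp add: UF(2) complex_L2.scale_right_diff_distrib mult.commute)
    then show ?thesis
      unfolding R_def using self_adjointD(2)[OF T UF(1), of d] by blast
  qed
  have "subspace R"
  proof (rule subspaceI)
    have "0 - scaleC_L2 z 0 \<in> R" unfolding R_def using self_adjointD(3)[OF T] by blast
    then show "0 \<in> R" by simp
    show "r + s \<in> R" if rs: "r \<in> R" "s \<in> R" for r s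
    proof -
      obtain U F W G where UF: "(U, F) \<in> T" "r = F - scaleC_L2 z U" "(W, G) \<in> T" "s = G - scaleC_L2 z W"
        using rs by (auto simp: R_def)
      have "r + s = (F + G) - scaleC_L2 z (U + W)"
        by (simp add: UF complex_L2.scale_right_distrib)
      then show ?thesis
        unfolding R_def using self_adjointD(1)[OF T UF(1,3)] by blast
    qed
    show "t *\<^sub>R r \<in> R" if "r \<in> R" for t r
      using R_scaleC[OF that] by (simp add: scaleR_eq_scaleC)
  qed
  moreover have "closed R"
    unfolding closed_sequential_limits
  proof safe
    fix r l assume r: "\<forall>n. r n \<in> R" "r \<longlonglongrightarrow> l"
    have "\<forall>n. \<exists>U F. (U, F) \<in> T \<and> r n = F - scaleC_L2 z U"
      using r(1) unfolding R_def by blast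
    then obtain U F where UF: "\<And>n. (U n, F n) \<in> T" "\<And>n. r n = F n - scaleC_L2 z (U n)"
      by metis
    have dist_le: "dist (U i) (U j) \<le> dist (r i) (r j) / c" for i j
    proof -
      have "c * norm (U i - U j) \<le> norm (F i - F j - scaleC_L2 z (U i - U j))"
        by (rule le[OF self_adjoint_diff[OF T UF(1) UF(1)]])
      also have "F i - F j - scaleC_L2 z (U i - U j) = r i - r j"
        by (simp add: UF(2) complex_L2.scale_right_diff_distrib algebra_simps)
      finally show ?thesis using c by (simp add: dist_norm field_simps)
    qed
    have "Cauchy U"
      unfolding Cauchy_def
    proof (intro allI impI)
      fix e :: real assume "0 < e"
      then have "0 < c * e" using c by simp
      then obtain M where "\<forall>m\<ge>M. \<forall>n\<ge>M. dist (r m) (r n) < c * e"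
        using LIMSEQ_imp_Cauchy[OF r(2)] unfolding Cauchy_def by blast
      then have "\<forall>m\<ge>M. \<forall>n\<ge>M. dist (r m) (r n) / c < e"
        using c by (simp add: field_simps)
      then show "\<exists>M. \<forall>m\<ge>M. \<forall>n\<ge>M. dist (U m) (U n) < e"
        using dist_le le_less_trans by blast
    qed
    then obtain U0 where U0: "U \<longlonglongrightarrow> U0"
      using Cauchy_convergent_iff convergent_def by blast
    have "(\<lambda>n. r n + scaleC_L2 z (U n)) \<longlonglongrightarrow> l + scaleC_L2 z U0"
      by (intro tendsto_add r(2) bounded_linear.tendsto[OF bounded_linear_scaleC U0])
    then have "F \<longlonglongrightarrow> l + scaleC_L2 z U0" by (simp add: UF(2))
    then have "(U0, l + scaleC_L2 z U0) \<in> T"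
      by (rule self_adjoint_closed[OF T UF(1) U0])
    then show "l \<in> R" unfolding R_def by force
  qed
  moreover have "g = 0" if g: "\<And>r. r \<in> R \<Longrightarrow> inner g r = 0" for g
  proof (rule ccontr)
    assume g0: "g \<noteq> 0"
    \<comment> \<open>Real orthogonality becomes complex orthogonality because \<open>R\<close> is
      stable under multiplication by \<open>\<i>\<close>.\<close>
    have "cinner_L2 g r = 0" if r: "r \<in> R" for r
    proof (rule complex_eqI)
      show "Re (cinner_L2 g r) = Re 0" by (simp add: Re_cinner g r)
      have "Im (cinner_L2 g r) = - Re (cinner_L2 g (scaleC_L2 \<i> r))"
        by (simp add: cinner_scaleC_right)
      then show "Im (cinner_L2 g r) = Im 0" by (simp add: Re_cinner g R_scaleC[OF r])
    qed
    then have "cinner_L2 g (B - scaleC_L2 z A) = 0" if "(A, B) \<in> T" for A B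
      using that unfolding R_def by blast
    then have "cinner_L2 g B = cinner_L2 (scaleC_L2 (cnj z) g) A" if "(A, B) \<in> T" for A B
      using that by (simp add: cinner_diff_right cinner_scaleC_right cinner_scaleC_left)
    then have "(g, scaleC_L2 (cnj z) g) \<in> T"
      by (subst self_adjointD(4)[OF T]) blast
    moreover from this have "cnj z = z"
      by (metis self_adjoint_eigenvalue_real[OF T _ g0] complex_cnj_cnj)
    ultimately show False
      using le[of g "scaleC_L2 z g"] c g0 by (simp add: mult_le_0_iff)
  qed
  ultimately have R: "R = UNIV"
    using nonzero_orthogonal_to_closed_subspace by metis
  have inj: "U = W" if "(U, F) \<in> T" "(W, G) \<in> T" "F - scaleC_L2 z U = G - scaleC_L2 z W" for U F W G
  proof -
    have "c * norm (U - W) \<le> norm (F - G - scaleC_L2 z (U - W))"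
      by (rule le[OF self_adjoint_diff[OF T that(1,2)]])
    also have "F - G - scaleC_L2 z (U - W) = 0"
      using that(3) by (simp add: complex_L2.scale_right_diff_distrib algebra_simps)
    finally show ?thesis using c by (simp add: mult_le_0_iff)
  qed
  have "\<exists>!U. \<exists>F. (U, F) \<in> T \<and> F - scaleC_L2 z U = G" for G
  proof -
    have "G \<in> R" using R by simp
    then show ?thesis unfolding R_def using inj by blast
  qed
  moreover have "\<forall>(U, F)\<in>T. norm U \<le> 1 / c * norm (F - scaleC_L2 z U)"
    using le c by (auto simp: field_simps)
  ultimately show ?thesis unfolding resolvent_set_def by blast
qed

text \<open>By symmetry \<open>cinner_L2 U F\<close> is real, so the imaginary part of
  \<open>cinner_L2 U (F - scaleC_L2 z U)\<close> is \<open>- Im z\<close> times the squared norm of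
  \<open>U\<close>, and Cauchy-Schwarz gives the lower bound with constant
  \<open>\<bar>Im z\<bar>\<close>.\<close>

lemma nonreal_in_resolvent_set:
  assumes T: "self_adjoint T" and z: "Im z \<noteq> 0"
  shows "z \<in> resolvent_set T"
proof (rule resolvent_set_if_bounded_below[OF T])
  show "0 < \<bar>Im z\<bar>" using z by simp
  fix U F assume UF: "(U, F) \<in> T"
  have "cinner_L2 U F = cinner_L2 F U" using UF self_adjointD(4)[OF T] by blast
  then have "cinner_L2 U F = cnj (cinner_L2 U F)" using cinner_commute[of U F] by simp
  then have "Im (cinner_L2 U F) = Im (cnj (cinner_L2 U F))" by (rule arg_cong)
  then have "Im (cinner_L2 U F) = 0" by simp
  then have "\<bar>Im z\<bar> * (norm U)\<^sup>2 = \<bar>Im (cinner_L2 U (F - scaleC_L2 z U))\<bar>"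
    by (simp add: cinner_diff_right cinner_scaleC_right cinner_self abs_mult del: of_real_power)
  also have "\<dots> \<le> norm U * norm (F - scaleC_L2 z U)"
    using abs_Im_le_cmod cmod_cinner_le order_trans by blast
  finally show "\<bar>Im z\<bar> * norm U \<le> norm (F - scaleC_L2 z U)"
    by (cases "U = 0") (auto simp: power2_eq_square)
qed

text \<open>The contrapositive of \<open>resolvent_set_if_bounded_below\<close>, normalized.\<close>

lemma spectrum_approximate_eigenvector:
  assumes T: "self_adjoint T" and z: "z \<in> spectrum T" and e: "0 < e"
  obtains U F where "(U, F) \<in> T" "norm U = 1" "norm (F - scaleC_L2 z U) < e"
proof -
  have "z \<notin> resolvent_set T" using z by (simp add: spectrum_def)
  then obtain U F where UF: "(U, F) \<in> T" "norm (F - scaleC_L2 z U) < e * norm U"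
    using resolvent_set_if_bounded_below[OF T e] by (meson not_le)
  then have n: "0 < norm U" by (metis mult_zero_right norm_ge_zero not_less zero_less_norm_iff norm_zero)
  let ?c = "complex_of_real (1 / norm U)"
  show ?thesis
  proof
    show "(scaleC_L2 ?c U, scaleC_L2 ?c F) \<in> T" by (rule self_adjointD(2)[OF T UF(1)])
    show "norm (scaleC_L2 ?c U) = 1" using n unfolding norm_scaleC norm_of_real by simp
    have eq: "scaleC_L2 ?c F - scaleC_L2 z (scaleC_L2 ?c U) = scaleC_L2 ?c (F - scaleC_L2 z U)"
      by (simp add: complex_L2.scale_right_diff_distrib mult.commute)
    show "norm (scaleC_L2 ?c F - scaleC_L2 z (scaleC_L2 ?c U)) < e"
      unfolding eq norm_scaleC norm_of_real using n UF(2) by (simp add: field_simps)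
  qed
qed

text \<open>Approximate eigenvectors for nearby spectral points are almost orthogonal to every
  eigenvector, so their accumulation at an eigenvector is impossible.\<close>

lemma discrete_spectrum_if_singular_sequences_converge:
  assumes T: "self_adjoint T" and z: "z \<in> spectrum T"
    and compact: "\<And>X Y. (\<And>n. (X n, Y n) \<in> T) \<Longrightarrow> (\<And>n. norm (X n) = 1) \<Longrightarrow>
      (\<lambda>n. Y n - scaleC_L2 z (X n)) \<longlonglongrightarrow> 0 \<Longrightarrow> \<exists>r. strict_mono (r :: nat \<Rightarrow> nat) \<and> convergent (X \<circ> r)"
    and fin: "\<exists>B. finite B \<and> eigenspace T z \<subseteq> complex_span B"
  shows "z \<in> discrete_spectrum T"
proof -
  \<comment> \<open>Closedness of \<open>T\<close> turns the limit of a singular sequence into a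
    normalized eigenvector.\<close>
  have limit: "\<exists>r U. strict_mono (r :: nat \<Rightarrow> nat) \<and> (X \<circ> r) \<longlonglongrightarrow> U \<and> norm U = 1 \<and> (U, scaleC_L2 z U) \<in> T"
    if XY: "\<And>n. (X n, Y n) \<in> T" "\<And>n. norm (X n) = 1" "(\<lambda>n. Y n - scaleC_L2 z (X n)) \<longlonglongrightarrow> 0" for X Y
  proof -
    obtain r U where r: "strict_mono (r :: nat \<Rightarrow> nat)" "(X \<circ> r) \<longlonglongrightarrow> U"
      using compact[OF XY] by (auto simp: convergent_def)
    have "(\<lambda>n. (Y (r n) - scaleC_L2 z (X (r n))) + scaleC_L2 z (X (r n))) \<longlonglongrightarrow> 0 + scaleC_L2 z U"
      using LIMSEQ_subseq_LIMSEQ[OF XY(3) r(1)] bounded_linear.tendsto[OF bounded_linear_scaleC r(2)]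
      by (intro tendsto_add) (auto simp: o_def)
    then have "(U, scaleC_L2 z U) \<in> T"
      using self_adjoint_closed[OF T, of "X \<circ> r" "Y \<circ> r"] XY(1) r(2) by (simp add: o_def)
    moreover have "norm U = 1"
      using LIMSEQ_unique[OF tendsto_norm[OF r(2)], of 1] XY(2) by (simp add: o_def)
    ultimately show ?thesis using r by blast
  qed
  have "eigenspace T z \<noteq> {0}"
  proof -
    have "\<exists>U F. (U, F) \<in> T \<and> norm U = 1 \<and> norm (F - scaleC_L2 z U) < 1 / real (Suc n)" for n
      using spectrum_approximate_eigenvector[OF T z, of "1 / real (Suc n)"] by (metis of_nat_0_less_iff zero_less_Suc zero_less_divide_1_iff)
    then obtain X Y where XY: "\<And>n. (X n, Y n) \<in> T" "\<And>n. norm (X n) = 1"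
        "\<And>n. norm (Y n - scaleC_L2 z (X n)) < 1 / real (Suc n)"
      by metis
    have "(\<lambda>n. Y n - scaleC_L2 z (X n)) \<longlonglongrightarrow> 0"
      by (rule Lim_null_comparison[OF _ LIMSEQ_Suc[OF lim_1_over_n]])
        (use XY(3) less_imp_le in \<open>auto intro!: always_eventually\<close>)
    from limit[OF XY(1,2) this] obtain U where "norm U = 1" "(U, scaleC_L2 z U) \<in> T" by blast
    then have "U \<in> eigenspace T z" "U \<noteq> 0" by (auto simp: eigenspace_def)
    then show ?thesis by blast
  qed
  moreover have "z isolated_in spectrum T"
  proof (rule ccontr)
    assume not_iso: "\<not> z isolated_in spectrum T"
    have "\<exists>w. w \<in> spectrum T \<and> w \<noteq> z \<and> dist w z < 1 / real (Suc n)" for n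
    proof (rule ccontr)
      assume "\<nexists>w. w \<in> spectrum T \<and> w \<noteq> z \<and> dist w z < 1 / real (Suc n)"
      then have "ball z (1 / real (Suc n)) \<inter> spectrum T = {z}"
        using z by (auto simp: dist_commute)
      then show False using not_iso z open_ball unfolding isolated_in_def by blast
    qed
    then obtain w where w: "\<And>n. w n \<in> spectrum T" "\<And>n. w n \<noteq> z" "\<And>n. dist (w n) z < 1 / real (Suc n)"
      by metis
    \<comment> \<open>The tolerance is proportional to \<open>dist (w n) z\<close> because the
      estimate of the inner product with the limiting eigenvector divides by this distance and must
      still tend to 0.\<close>
    have "\<exists>U F. (U, F) \<in> T \<and> norm U = 1 \<and> norm (F - scaleC_L2 (w n) U) < dist (w n) z / real (Suc n)" for n
      using spectrum_approximate_eigenvector[OF T w(1)[of n], of "dist (w n) z / real (Suc n)"] w(2)[of n]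
      by (metis dist_pos_lt divide_pos_pos of_nat_0_less_iff zero_less_Suc)
    then obtain X Y where XY: "\<And>n. (X n, Y n) \<in> T" "\<And>n. norm (X n) = 1"
        "\<And>n. norm (Y n - scaleC_L2 (w n) (X n)) < dist (w n) z / real (Suc n)"
      by metis
    have le: "norm (Y n - scaleC_L2 z (X n)) \<le> 2 * (1 / real (Suc n))" for n
    proof -
      have eq: "Y n - scaleC_L2 z (X n) = (Y n - scaleC_L2 (w n) (X n)) + scaleC_L2 (w n - z) (X n)"
        by (simp add: complex_L2.scale_left_diff_distrib)
      have "norm (Y n - scaleC_L2 z (X n)) \<le> norm (Y n - scaleC_L2 (w n) (X n)) + norm (scaleC_L2 (w n - z) (X n))"
        unfolding eq by (rule norm_triangle_ineq)
      also have "\<dots> \<le> dist (w n) z / real (Suc n) + dist (w n) z"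
        using XY(3)[of n] XY(2)[of n] by (simp add: norm_scaleC dist_norm)
      finally have "norm (Y n - scaleC_L2 z (X n)) \<le> dist (w n) z / real (Suc n) + dist (w n) z" .
      moreover have "dist (w n) z / real (Suc n) \<le> dist (w n) z"
        by (simp add: divide_le_eq mult_le_cancel_left1)
      ultimately show ?thesis using w(3)[of n] by linarith
    qed
    have "(\<lambda>n. 2 * (1 / real (Suc n))) \<longlonglongrightarrow> 2 * 0"
      by (intro tendsto_intros LIMSEQ_Suc[OF lim_1_over_n])
    then have "(\<lambda>n. 2 * (1 / real (Suc n))) \<longlonglongrightarrow> 0" by simp
    then have "(\<lambda>n. Y n - scaleC_L2 z (X n)) \<longlonglongrightarrow> 0"
      by (rule Lim_null_comparison[rotated]) (intro always_eventually allI le)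
    from limit[OF XY(1,2) this] obtain r U where rU: "strict_mono (r :: nat \<Rightarrow> nat)"
      "(X \<circ> r) \<longlonglongrightarrow> U" "norm U = 1" "(U, scaleC_L2 z U) \<in> T" by blast
    have zr: "cnj z = z" by (rule self_adjoint_eigenvalue_real[OF T rU(4)]) (use rU(3) in auto)
    \<comment> \<open>Moving the operator onto the eigenvector gives
      \<open>(z - w n) * cinner_L2 U (X n)\<close> on one side and a small remainder on the other.
      In the limit \<open>U\<close> would be orthogonal to itself.\<close>
    have small: "cmod (cinner_L2 (X n) U) \<le> 1 / real (Suc n)" for n
    proof -
      have "cinner_L2 U (Y n) = cinner_L2 (scaleC_L2 z U) (X n)"
        using rU(4) XY(1)[of n] self_adjointD(4)[OF T] by blast
      then have "cinner_L2 U (Y n - scaleC_L2 (w n) (X n)) = (z - w n) * cinner_L2 U (X n)"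
        by (simp add: cinner_diff_right cinner_scaleC_right cinner_scaleC_left zr left_diff_distrib)
      then have "dist (w n) z * cmod (cinner_L2 U (X n)) \<le> dist (w n) z / real (Suc n)"
        using cmod_cinner_le[of U "Y n - scaleC_L2 (w n) (X n)"] XY(3)[of n] rU(3)
        by (simp add: norm_mult dist_norm norm_minus_commute)
      then have "dist (w n) z * cmod (cinner_L2 U (X n)) \<le> dist (w n) z * (1 / real (Suc n))"
        by simp
      then have "cmod (cinner_L2 U (X n)) \<le> 1 / real (Suc n)"
        by (rule mult_left_le_imp_le) (use w(2)[of n] in simp)
      then show ?thesis using cinner_commute[of "X n" U] by simp
    qed
    have "(\<lambda>n. cinner_L2 (X n) U) \<longlonglongrightarrow> 0"
      by (rule Lim_null_comparison[OF _ LIMSEQ_Suc[OF lim_1_over_n]])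
        (use small in \<open>auto intro!: always_eventually\<close>)
    from LIMSEQ_subseq_LIMSEQ[OF this rU(1)] tendsto_cinner_left[OF rU(2), of U]
    have "cinner_L2 U U = 0" using LIMSEQ_unique by (auto simp: o_def)
    then show False using rU(3) by (simp add: cinner_self)
  qed
  ultimately show ?thesis
    using fin by (simp add: discrete_spectrum_def)
qed

text \<open>Elimination with the two traces as coordinates shows that at most two vectors span
  \<open>E\<close>. \<open>tr\<close> is a relation because traces will be read off from
  representing functions, which are only asserted to exist.\<close>

lemma finite_span_if_two_traces:
  fixes tr :: "L2 \<Rightarrow> complex \<Rightarrow> complex \<Rightarrow> bool"
  assumes ex: "\<And>U. U \<in> E \<Longrightarrow> \<exists>a b. tr U a b"
    and diff: "\<And>U W c a b a' b'. U \<in> E \<Longrightarrow> W \<in> E \<Longrightarrow> tr U a b \<Longrightarrow> tr W a' b' \<Longrightarrow>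
      U - scaleC_L2 c W \<in> E \<and> tr (U - scaleC_L2 c W) (a - c * a') (b - c * b')"
    and inj: "\<And>U. U \<in> E \<Longrightarrow> tr U 0 0 \<Longrightarrow> U = 0"
  shows "\<exists>B. finite B \<and> E \<subseteq> complex_span B"
proof -
  \<comment> \<open>First the elements with vanishing first trace, on which the second trace is the
    only coordinate left.\<close>
  have step: "\<exists>B. finite B \<and> (\<forall>U\<in>E. \<forall>b. tr U 0 b \<longrightarrow> U \<in> complex_span B)"
  proof (cases "\<exists>W b'. W \<in> E \<and> tr W 0 b' \<and> b' \<noteq> 0")
    case True
    then obtain W b' where W: "W \<in> E" "tr W 0 b'" "b' \<noteq> 0" by blast
    have "U \<in> complex_span {W}" if U: "U \<in> E" "tr U 0 b" for U b
    proof -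
      have "U - scaleC_L2 (b / b') W = 0"
        using diff[OF U(1) W(1) U(2) W(2), of "b / b'"] W(3) by (intro inj) auto
      then have "U = scaleC_L2 (b / b') W" by simp
      then show ?thesis
        by (metis complex_L2.span_base complex_L2.span_scale insertI1)
    qed
    then show ?thesis by (intro exI[of _ "{W}"]) auto
  next
    case False
    then have "\<forall>U\<in>E. \<forall>b. tr U 0 b \<longrightarrow> U = 0" using inj by blast
    then show ?thesis by (intro exI[of _ "{}"]) auto
  qed
  then obtain B where B: "finite B" "\<And>U b. U \<in> E \<Longrightarrow> tr U 0 b \<Longrightarrow> U \<in> complex_span B" by blast
  show ?thesis
  proof (cases "\<exists>W a' b'. W \<in> E \<and> tr W a' b' \<and> a' \<noteq> 0")
    case True
    then obtain W a' b' where W: "W \<in> E" "tr W a' b'" "a' \<noteq> 0" by blast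
    have "U \<in> complex_span (insert W B)" if U: "U \<in> E" for U
    proof -
      obtain a b where ab: "tr U a b" using ex[OF U] by blast
      have "U - scaleC_L2 (a / a') W \<in> complex_span B"
        using diff[OF U W(1) ab W(2), of "a / a'"] W(3) by (intro B(2)) auto
      then show ?thesis by (auto simp: complex_L2.span_insert)
    qed
    then show ?thesis using B(1) by (intro exI[of _ "insert W B"]) auto
  next
    case False
    then have "E \<subseteq> complex_span B" using ex B(2) by blast
    then show ?thesis using B(1) by blast
  qed
qed

section \<open>Square-integrable functions on the half-line\<close>

text \<open>The measure lives on the open half-line, whereas the integrals of the calculus above are
  taken over intervals that start at 0; the endpoint is negligible.\<close>

lemma absolutely_integrable_half_line:
  fixes g :: "real \<Rightarrow> 'a::euclidean_space"
  shows "g absolutely_integrable_on {0..} \<longleftrightarrow> integrable half_line g"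
proof -
  have "g absolutely_integrable_on {0..} \<longleftrightarrow> g absolutely_integrable_on {0<..}"
    by (rule absolutely_integrable_spike_set_eq) (auto intro: negligible_subset[of "{0}"])
  also have "\<dots> \<longleftrightarrow> integrable half_line g"
    by (simp add: set_integrable_def integrable_restrict_space)
  finally show ?thesis .
qed

lemma half_line_imp_absolutely_integrable:
  fixes g :: "real \<Rightarrow> 'a::euclidean_space"
  assumes "integrable half_line g" "0 \<le> a"
  shows "g absolutely_integrable_on {a..b}"
  using assms absolutely_integrable_half_line[of g]
  by (intro absolutely_integrable_on_subinterval[where S = "{0..}"]) auto

lemma integral_half_line:
  fixes g :: "real \<Rightarrow> 'a::euclidean_space"
  assumes "integrable half_line g"
  shows "(\<integral>x. g x \<partial>half_line) = integral {0..} g"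
proof -
  have "(\<integral>x. g x \<partial>half_line) = integral {0<..} g"
    by (rule lebesgue_integral_eq_integral[OF assms]) simp
  also have "\<dots> = integral {0..} g"
    by (rule integral_spike_set) (auto intro: negligible_subset[of "{0}"])
  finally show ?thesis .
qed

lemma integral_half_line_compact_support:
  fixes g :: "real \<Rightarrow> 'a::euclidean_space"
  assumes "integrable half_line g" "\<And>x. b < x \<Longrightarrow> g x = 0"
  shows "(\<integral>x. g x \<partial>half_line) = integral {0..b} g"
  unfolding integral_half_line[OF assms(1)]
  by (rule integral_spike_set) (use assms(2) in \<open>auto intro: negligible_subset[of "{}"]\<close>)

lemma tendsto_integral_half_line:
  fixes g :: "real \<Rightarrow> 'a::euclidean_space"
  assumes "integrable half_line g"
  shows "((\<lambda>b. integral {0..b} g) \<longlongrightarrow> (\<integral>x. g x \<partial>half_line)) at_top"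
proof -
  have g: "g absolutely_integrable_on {0..}"
    using assms absolutely_integrable_half_line by blast
  have "((\<lambda>b. LINT x:{0..b}|lebesgue. g x) \<longlongrightarrow> (LINT x:{0..}|lebesgue. g x)) at_top"
    by (rule tendsto_set_lebesgue_integral_at_top[OF _ g]) simp
  moreover have "(LINT x:{0..b}|lebesgue. g x) = integral {0..b} g" for b
    by (rule set_lebesgue_integral_eq_integral(2)[OF half_line_imp_absolutely_integrable[OF assms]]) simp
  moreover have "(LINT x:{0..}|lebesgue. g x) = (\<integral>x. g x \<partial>half_line)"
    using set_lebesgue_integral_eq_integral(2)[OF g] integral_half_line[OF assms] by simp
  ultimately show ?thesis by simp
qed

lemma square_integrable_local:
  assumes "square_integrable u" "0 \<le> a"
  shows "(\<lambda>x. (cmod (u x))\<^sup>2) absolutely_integrable_on {a..b}"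
  using assms half_line_imp_absolutely_integrable by (auto simp: square_integrable_def)

lemma square_integral_le_norm:
  assumes "square_integrable u" "0 \<le> a"
  shows "integral {a..b} (\<lambda>x. (cmod (u x))\<^sup>2) \<le> (norm (abs_L2 u))\<^sup>2"
proof -
  have i: "integrable half_line (\<lambda>x. (cmod (u x))\<^sup>2)" using assms by (simp add: square_integrable_def)
  have "integral {a..b} (\<lambda>x. (cmod (u x))\<^sup>2) \<le> integral {0..} (\<lambda>x. (cmod (u x))\<^sup>2)"
    using half_line_imp_absolutely_integrable[OF i assms(2)] absolutely_integrable_half_line[of "\<lambda>x. (cmod (u x))\<^sup>2"] i assms
    by (intro integral_subset_le) (auto intro: set_lebesgue_integral_eq_integral(1))
  then show ?thesis
    by (simp add: norm_abs_L2 assms integral_half_line[OF i])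
qed

lemma norm_abs_L2_le:
  assumes "square_integrable u"
    and "\<And>b. 0 \<le> b \<Longrightarrow> integral {0..b} (\<lambda>x. (cmod (u x))\<^sup>2) \<le> B"
  shows "(norm (abs_L2 u))\<^sup>2 \<le> B"
  unfolding norm_abs_L2[OF assms(1)]
proof (rule tendsto_upperbound[OF tendsto_integral_half_line])
  show "integrable half_line (\<lambda>x. (cmod (u x))\<^sup>2)" using assms by (simp add: square_integrable_def)
  show "\<forall>\<^sub>F b in at_top. integral {0..b} (\<lambda>x. (cmod (u x))\<^sup>2) \<le> B"
    using assms(2) by (auto intro!: eventually_at_top_linorderI[of 0])
qed simp

text \<open>On a bounded interval \<open>1 + (cmod (u x))\<^sup>2\<close> is an integrable majorant.
  The left endpoint is removed and then restored because measurability is known on the open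
  half-line only.\<close>

lemma square_integrable_abs_integrable:
  assumes u: "square_integrable u" "0 \<le> a"
  shows "u absolutely_integrable_on {a..b}"
proof -
  have "u absolutely_integrable_on {a<..b}"
  proof (rule measurable_bounded_by_integrable_imp_absolutely_integrable)
    show "u \<in> borel_measurable (lebesgue_on {a<..b})"
      by (rule measurable_restrict_mono[of _ _ "{0<..}"]) (use u in \<open>auto simp: square_integrable_def\<close>)
    have "(\<lambda>x. (cmod (u x))\<^sup>2) integrable_on {a..b}"
      using square_integrable_local[OF u] set_lebesgue_integral_eq_integral(1) by blast
    then have "(\<lambda>x. 1 + (cmod (u x))\<^sup>2) integrable_on {a..b}"
      by (intro integrable_add) auto
    then show "(\<lambda>x. 1 + (cmod (u x))\<^sup>2) integrable_on {a<..b}"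
      by (rule integrable_spike_set) (auto intro: negligible_subset[of "{a}"])
    show "norm (u x) \<le> 1 + (cmod (u x))\<^sup>2" for x
      using sum_squares_bound[of 1 "cmod (u x)"] zero_le_power2[of "cmod (u x)"] norm_ge_zero[of "u x"]
      unfolding power_one mult_1_right by linarith
  qed simp
  moreover have "u absolutely_integrable_on {a<..b} \<longleftrightarrow> u absolutely_integrable_on {a..b}"
    by (rule absolutely_integrable_spike_set_eq) (auto intro: negligible_subset[of "{a}"])
  ultimately show ?thesis by blast
qed

text \<open>Cauchy-Schwarz against the constant 1, obtained from the nonnegative integral of
  \<open>(cmod (u x) - c)\<^sup>2\<close> with \<open>c\<close> the mean of
  \<open>cmod (u x)\<close>.\<close>

lemma integral_cmod_le_norm:
  assumes u: "square_integrable u" "0 \<le> a" "a \<le> b"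
  shows "integral {a..b} (\<lambda>x. cmod (u x)) \<le> sqrt (b - a) * norm (abs_L2 u)"
proof (cases "a = b")
  case False
  then have L: "0 < b - a" using u by simp
  define c where "c = integral {a..b} (\<lambda>x. cmod (u x)) / (b - a)"
  have i1: "(\<lambda>x. cmod (u x)) integrable_on {a..b}"
    using square_integrable_abs_integrable[OF u(1,2)] absolutely_integrable_on_def by blast
  have i2: "(\<lambda>x. (cmod (u x))\<^sup>2) integrable_on {a..b}"
    using square_integrable_local[OF u(1,2)] set_lebesgue_integral_eq_integral(1) by blast
  have "((\<lambda>x. (cmod (u x))\<^sup>2 - 2 * c * cmod (u x) + c\<^sup>2) has_integral
      integral {a..b} (\<lambda>x. (cmod (u x))\<^sup>2) - 2 * c * integral {a..b} (\<lambda>x. cmod (u x)) + (b - a) * c\<^sup>2) {a..b}"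
    using has_integral_add[OF has_integral_diff[OF integrable_integral[OF i2]
        has_integral_mult_right[OF integrable_integral[OF i1], of "2 * c"]] has_integral_const_real[of "c\<^sup>2" a b]] u
    by simp
  moreover have "(cmod (u x))\<^sup>2 - 2 * c * cmod (u x) + c\<^sup>2 = (cmod (u x) - c)\<^sup>2" for x
    by (simp add: power2_diff)
  ultimately have "((\<lambda>x. (cmod (u x) - c)\<^sup>2) has_integral
      integral {a..b} (\<lambda>x. (cmod (u x))\<^sup>2) - 2 * c * integral {a..b} (\<lambda>x. cmod (u x)) + (b - a) * c\<^sup>2) {a..b}"
    by simp
  then have "0 \<le> integral {a..b} (\<lambda>x. (cmod (u x))\<^sup>2) - 2 * c * integral {a..b} (\<lambda>x. cmod (u x)) + (b - a) * c\<^sup>2"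
    by (rule has_integral_nonneg) auto
  also have "\<dots> = integral {a..b} (\<lambda>x. (cmod (u x))\<^sup>2) - (integral {a..b} (\<lambda>x. cmod (u x)))\<^sup>2 / (b - a)"
  proof -
    have "I - 2 * (J / K) * J + K * (J / K)\<^sup>2 = I - J\<^sup>2 / K" if "0 < K" for I J K :: real
      using that by (simp add: field_simps power2_eq_square)
    then show ?thesis using L unfolding c_def by blast
  qed
  finally have "(integral {a..b} (\<lambda>x. cmod (u x)))\<^sup>2 \<le> (b - a) * integral {a..b} (\<lambda>x. (cmod (u x))\<^sup>2)"
    using L by (simp add: field_simps)
  also have "\<dots> \<le> (b - a) * (norm (abs_L2 u))\<^sup>2"
    using L by (intro mult_left_mono square_integral_le_norm u) auto
  also have "\<dots> = (sqrt (b - a) * norm (abs_L2 u))\<^sup>2"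
    using L by (simp add: power_mult_distrib)
  finally show ?thesis
    by (rule power2_le_imp_le) (use L in simp)
qed simp

section \<open>Null sets and the second-order du Bois-Reymond lemma\<close>

lemma AE_half_line_negligible:
  assumes "AE x in half_line. P x"
  shows "negligible {x. 0 < x \<and> \<not> P x}"
proof -
  have "AE x in lebesgue. x \<in> {0<..} \<longrightarrow> P x"
    using assms by (subst (asm) AE_restrict_space_iff) auto
  then obtain N where N: "{x. \<not> (x \<in> {0<..} \<longrightarrow> P x)} \<subseteq> N" "N \<in> null_sets lebesgue"
    by (auto elim!: AE_E simp: null_setsI)
  then have "negligible N" by (simp add: negligible_iff_null_sets)
  then show ?thesis by (rule negligible_subset) (use N in auto)
qed

lemma ac_AE_cong:
  assumes f: "ac f f'" and AE: "AE x in half_line. g' x = f' x"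
  shows "ac f g'"
proof -
  \<comment> \<open>\<open>half_line\<close> says nothing about the point 0, so it joins the
    exceptional set.\<close>
  define N where "N = insert 0 {x. 0 < x \<and> g' x \<noteq> f' x}"
  have N: "negligible N" unfolding N_def using AE_half_line_negligible[OF AE] by simp
  have eq: "g' x = f' x" if "x \<in> {0..b} - N" for x b
    using that by (cases "x = 0") (auto simp: N_def)
  show ?thesis
    unfolding ac_def
  proof (intro allI impI conjI)
    fix x :: real assume x: "0 \<le> x"
    have "f' absolutely_integrable_on {0..x}" using f x by (simp add: ac_def)
    then show "g' absolutely_integrable_on {0..x}"
      by (rule absolutely_integrable_spike[OF _ N]) (rule eq)
    have "integral {0..x} g' = integral {0..x} f'"
      by (rule integral_spike[OF N]) (use eq in auto)
    then show "f x = f 0 + integral {0..x} g'" using ac_eq[OF f x] by simp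
  qed
qed

lemma AE_half_line_witness:
  assumes AE: "AE x in half_line. P x" and "0 \<le> a" "a < b"
  obtains x where "a < x" "x < b" "P x"
proof (rule ccontr)
  assume "\<not> thesis"
  then have "{a<..<b} \<subseteq> {x. 0 < x \<and> \<not> P x}" using that \<open>0 \<le> a\<close> by force
  then have "negligible {a<..<b}" using AE_half_line_negligible[OF AE] negligible_subset by blast
  then show False using \<open>a < b\<close> open_not_negligible[of "{a<..<b}"] by auto
qed

text \<open>The test function is the conjugate of \<open>h\<close> minus its orthogonal projection to the affine functions.\<close>

lemma affine_if_orthogonal_to_second_derivatives_on_interval:
  fixes h :: "real \<Rightarrow> complex"
  assumes hm: "h \<in> borel_measurable half_line"
    and h2: "\<And>b. (\<lambda>x. (cmod (h x))\<^sup>2) integrable_on {0..b}"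
    and orth: "\<And>k a b. 0 < a \<Longrightarrow> a < b \<Longrightarrow> square_integrable k \<Longrightarrow> (\<And>x. x \<notin> {a<..<b} \<Longrightarrow> k x = 0) \<Longrightarrow>
      integral {0..b} k = 0 \<Longrightarrow> integral {0..b} (\<lambda>x. x *\<^sub>R k x) = 0 \<Longrightarrow>
      integral {0..b} (\<lambda>x. h x * k x) = 0"
    and ab: "0 < a" "a < b"
  obtains \<alpha> \<beta> where "AE x in half_line. x \<in> {a<..<b} \<longrightarrow> h x = \<alpha> + x *\<^sub>R \<beta>"
proof -
  define L where "L = b - a"
  \<comment> \<open>Centring at the midpoint makes \<open>1\<close> and \<open>x - m\<close>
    orthogonal on \<open>[a, b]\<close>, so the two projection coefficients decouple.\<close>
  define m where "m = (a + b) / 2"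
  have L: "0 < L" using ab by (simp add: L_def)
  have h_ai: "h absolutely_integrable_on {a..b}"
  proof (rule measurable_bounded_by_integrable_imp_absolutely_integrable)
    show "h \<in> borel_measurable (lebesgue_on {a..b})"
      by (rule measurable_restrict_mono[OF hm]) (use ab in auto)
    have "(\<lambda>x. (cmod (h x))\<^sup>2) integrable_on {a..b}"
      by (rule integrable_on_subinterval[OF h2[of b]]) (use ab in auto)
    then show "(\<lambda>x. 1 + (cmod (h x))\<^sup>2) integrable_on {a..b}"
      by (intro integrable_add) auto
    show "norm (h x) \<le> 1 + (cmod (h x))\<^sup>2" for x
      using sum_squares_bound[of 1 "cmod (h x)"] zero_le_power2[of "cmod (h x)"] norm_ge_zero[of "h x"]
      unfolding power_one mult_1_right by linarith
  qed simp
  have h_i: "h integrable_on {a..b}" using h_ai set_lebesgue_integral_eq_integral(1) by blast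
  have hx_i: "(\<lambda>x. (x - m) *\<^sub>R h x) integrable_on {a..b}"
    by (rule set_lebesgue_integral_eq_integral(1),
        rule absolutely_integrable_bilinear_continuous[OF bounded_bilinear_scaleR _ h_ai])
      (intro continuous_intros)
  define \<alpha> where "\<alpha> = (1 / L) *\<^sub>R integral {a..b} h"
  \<comment> \<open>\<open>L ^ 3 / 12\<close> is the integral of \<open>(x - m)\<^sup>2\<close>, so
    this is the projection coefficient along \<open>x - m\<close>.\<close>
  define \<beta> where "\<beta> = (12 / L ^ 3) *\<^sub>R integral {a..b} (\<lambda>x. (x - m) *\<^sub>R h x)"
  define r where "r x = h x - \<alpha> - (x - m) *\<^sub>R \<beta>" for x
  have p1: "((\<lambda>x. x - m) has_integral 0) {a..b}"
  proof -
    have "((\<lambda>x. x - m) has_integral ((b - m)\<^sup>2 / 2 - (a - m)\<^sup>2 / 2)) {a..b}"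
      by (rule fundamental_theorem_of_calculus)
        (use ab in \<open>auto intro!: derivative_eq_intros simp: has_real_derivative_iff_has_vector_derivative[symmetric]\<close>)
    moreover have "(b - m)\<^sup>2 / 2 - (a - m)\<^sup>2 / 2 = 0" by (simp add: m_def power2_eq_square field_simps)
    ultimately show ?thesis by simp
  qed
  have p2: "((\<lambda>x. (x - m)\<^sup>2) has_integral L ^ 3 / 12) {a..b}"
  proof -
    have "((\<lambda>x. (x - m)\<^sup>2) has_integral ((b - m) ^ 3 / 3 - (a - m) ^ 3 / 3)) {a..b}"
      by (rule fundamental_theorem_of_calculus)
        (use ab in \<open>auto intro!: derivative_eq_intros simp: has_real_derivative_iff_has_vector_derivative[symmetric]\<close>)
    moreover have "(b - m) ^ 3 / 3 - (a - m) ^ 3 / 3 = L ^ 3 / 12"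
      by (simp add: m_def L_def power3_eq_cube field_simps)
    ultimately show ?thesis by simp
  qed
  have p0: "((\<lambda>x. \<alpha>) has_integral L *\<^sub>R \<alpha>) {a..b}"
    using has_integral_const_real[of \<alpha> a b] ab by (simp add: L_def)
  have r0: "(r has_integral 0) {a..b}"
  proof -
    have "(r has_integral (integral {a..b} h - L *\<^sub>R \<alpha> - 0 *\<^sub>R \<beta>)) {a..b}"
      unfolding r_def by (intro has_integral_diff has_integral_scaleR_left p0 p1 integrable_integral h_i)
    then show ?thesis using L by (simp add: \<alpha>_def)
  qed
  have r1: "((\<lambda>x. (x - m) *\<^sub>R r x) has_integral 0) {a..b}"
  proof -
    have "((\<lambda>x. (x - m) *\<^sub>R h x - (x - m) *\<^sub>R \<alpha> - (x - m)\<^sup>2 *\<^sub>R \<beta>) has_integral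
        (integral {a..b} (\<lambda>x. (x - m) *\<^sub>R h x) - 0 *\<^sub>R \<alpha> - (L ^ 3 / 12) *\<^sub>R \<beta>)) {a..b}"
      by (intro has_integral_diff has_integral_scaleR_left p1 p2 integrable_integral hx_i)
    moreover have "(\<lambda>x. (x - m) *\<^sub>R h x - (x - m) *\<^sub>R \<alpha> - (x - m)\<^sup>2 *\<^sub>R \<beta>) = (\<lambda>x. (x - m) *\<^sub>R r x)"
      by (simp add: r_def scaleR_diff_right power2_eq_square)
    ultimately show ?thesis using L by (simp add: \<beta>_def)
  qed
  define k where "k x = (if x \<in> {a<..<b} then cnj (r x) else 0)" for x
  have restrict: "((\<lambda>x. if x \<in> {a<..<b} then f x else 0) has_integral i) {0..b}"
    if "(f has_integral i) {a..b}" for f :: "real \<Rightarrow> complex" and i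
    using has_integral_restrict_open_subinterval[of f i a b 0 b] that ab by simp
  have kr: "(\<lambda>x. x *\<^sub>R k x) = (\<lambda>x. if x \<in> {a<..<b} then x *\<^sub>R cnj (r x) else 0)"
    by (auto simp: k_def)
  have cr0: "((\<lambda>x. cnj (r x)) has_integral 0) {a..b}"
    using has_integral_linear[OF r0 bounded_linear_cnj] by (simp add: o_def)
  have "((\<lambda>x. (x - m) *\<^sub>R cnj (r x) + m *\<^sub>R cnj (r x)) has_integral 0 + m *\<^sub>R 0) {a..b}"
    using has_integral_linear[OF r1 bounded_linear_cnj] cr0
    by (intro has_integral_add has_integral_cmul) (simp_all add: o_def)
  then have cr1: "((\<lambda>x. x *\<^sub>R cnj (r x)) has_integral 0) {a..b}"
    by (simp add: scaleR_diff_left)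
  have rm: "(\<lambda>x. indicator {a<..<b} x *\<^sub>R r x) \<in> borel_measurable half_line"
  proof -
    have "(\<lambda>x. x :: real) \<in> borel_measurable half_line"
      by (rule continuous_imp_measurable_on_sets_lebesgue) (auto intro: continuous_intros)
    then show ?thesis
      unfolding r_def by (intro borel_measurable_scaleR borel_measurable_diff hm borel_measurable_indicator)
        (use ab in \<open>auto simp: sets_restrict_space_iff\<close>)
  qed
  have sq_ai: "(\<lambda>x. (cmod (r x))\<^sup>2) integrable_on {a..b}"
  proof -
    have "(\<lambda>x. (cmod (r x))\<^sup>2) absolutely_integrable_on {a..b}"
    proof (rule measurable_bounded_by_integrable_imp_absolutely_integrable)
      have "h \<in> borel_measurable (lebesgue_on {a..b})"
        by (rule measurable_restrict_mono[OF hm]) (use ab in auto)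
      moreover have "(\<lambda>x. \<alpha> + (x - m) *\<^sub>R \<beta>) \<in> borel_measurable (lebesgue_on {a..b})"
        by (rule continuous_imp_measurable_on_sets_lebesgue) (auto intro!: continuous_intros)
      ultimately show "(\<lambda>x. (cmod (r x))\<^sup>2) \<in> borel_measurable (lebesgue_on {a..b})"
        unfolding r_def diff_diff_eq by measurable
      have "(\<lambda>x. (cmod (h x))\<^sup>2) integrable_on {a..b}"
        by (rule integrable_on_subinterval[OF h2[of b]]) (use ab in auto)
      then show "(\<lambda>x. 2 * (cmod (h x))\<^sup>2 + 2 * (cmod (\<alpha> + (x - m) *\<^sub>R \<beta>))\<^sup>2) integrable_on {a..b}"
        by (intro integrable_add integrable_on_mult_right)
          (assumption | intro integrable_continuous_interval continuous_intros)+
      show "norm ((cmod (r x))\<^sup>2) \<le> 2 * (cmod (h x))\<^sup>2 + 2 * (cmod (\<alpha> + (x - m) *\<^sub>R \<beta>))\<^sup>2" for x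
      proof -
        have "(cmod (r x))\<^sup>2 \<le> (cmod (h x) + cmod (\<alpha> + (x - m) *\<^sub>R \<beta>))\<^sup>2"
          unfolding r_def diff_diff_eq by (intro power_mono norm_triangle_ineq4) auto
        then show ?thesis
          using sum_squares_bound[of "cmod (h x)" "cmod (\<alpha> + (x - m) *\<^sub>R \<beta>)"] by (simp add: power2_sum)
      qed
    qed simp
    then show ?thesis using set_lebesgue_integral_eq_integral(1) by blast
  qed
  have k2: "square_integrable k"
    unfolding square_integrable_def
  proof
    have "(\<lambda>x. cnj (indicator {a<..<b} x *\<^sub>R r x)) \<in> borel_measurable half_line"
      by (intro measurable_compose[OF rm] borel_measurable_continuous_onI continuous_intros)
    moreover have "(\<lambda>x. cnj (indicator {a<..<b} x *\<^sub>R r x)) = k"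
      by (auto simp: k_def indicator_def)
    ultimately show "k \<in> borel_measurable half_line" by simp
    have "(\<lambda>x. if x \<in> {a..b} then (cmod (r x))\<^sup>2 else 0) absolutely_integrable_on {0..}"
    proof -
      have "(\<lambda>x. (cmod (r x))\<^sup>2) absolutely_integrable_on {a..b}"
        using sq_ai by (subst absolutely_integrable_on_iff_nonneg) auto
      moreover have "(\<lambda>x. indicat_real {a..b} x *\<^sub>R (cmod (r x))\<^sup>2)
          = (\<lambda>x. indicat_real {0..} x *\<^sub>R (if x \<in> {a..b} then (cmod (r x))\<^sup>2 else 0))"
        using ab by (auto simp: indicator_def fun_eq_iff)
      ultimately show ?thesis unfolding set_integrable_def by simp
    qed
    then have "(\<lambda>x. (cmod (k x))\<^sup>2) absolutely_integrable_on {0..}"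
      by (rule absolutely_integrable_spike[where S = "{a, b}"]) (auto simp: k_def)
    then show "integrable half_line (\<lambda>x. (cmod (k x))\<^sup>2)"
      using absolutely_integrable_half_line by blast
  qed
  have hk: "integral {0..b} (\<lambda>x. h x * k x) = 0"
  proof (rule orth[OF ab k2])
    show "integral {0..b} k = 0"
      unfolding k_def by (rule integral_unique[OF restrict[OF cr0]])
    show "integral {0..b} (\<lambda>x. x *\<^sub>R k x) = 0"
      unfolding kr by (rule integral_unique[OF restrict[OF cr1]])
  qed (auto simp: k_def)
  \<comment> \<open>Since \<open>cnj (r x)\<close> has vanishing moments, the affine part of
    \<open>h\<close> drops out and only the squared norm of \<open>r\<close> remains.\<close>
  have z: "((\<lambda>x. h x * cnj (r x)) has_integral integral {a..b} (\<lambda>x. complex_of_real ((cmod (r x))\<^sup>2))) {a..b}"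
  proof -
    have 1: "((\<lambda>x. \<alpha> * cnj (r x)) has_integral \<alpha> * 0) {a..b}"
      by (rule has_integral_mult_right[OF cr0])
    have 2: "((\<lambda>x. \<beta> * cnj ((x - m) *\<^sub>R r x)) has_integral \<beta> * cnj 0) {a..b}"
      using has_integral_linear[OF r1 bounded_linear_cnj] by (intro has_integral_mult_right) (simp add: o_def)
    have 3: "((\<lambda>x. complex_of_real ((cmod (r x))\<^sup>2)) has_integral integral {a..b} (\<lambda>x. complex_of_real ((cmod (r x))\<^sup>2))) {a..b}"
      using integrable_linear[OF sq_ai bounded_linear_of_real[where 'a = complex]] by (intro integrable_integral) (simp add: o_def)
    have "h x * cnj (r x) = complex_of_real ((cmod (r x))\<^sup>2) + \<alpha> * cnj (r x) + \<beta> * cnj ((x - m) *\<^sub>R r x)" for x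
    proof -
      have hx: "h x = r x + \<alpha> + (x - m) *\<^sub>R \<beta>" by (simp add: r_def)
      show ?thesis unfolding complex_norm_square hx by (simp add: scaleR_conv_of_real algebra_simps)
    qed
    then show ?thesis
      using has_integral_add[OF has_integral_add[OF 3 1] 2] by simp
  qed
  have "((\<lambda>x. h x * k x) has_integral integral {a..b} (\<lambda>x. complex_of_real ((cmod (r x))\<^sup>2))) {0..b}"
    by (rule has_integral_eq[OF _ restrict[OF z]]) (simp add: k_def)
  then have "integral {a..b} (\<lambda>x. complex_of_real ((cmod (r x))\<^sup>2)) = 0"
    using hk integral_unique by metis
  then have "complex_of_real (integral {a..b} (\<lambda>x. (cmod (r x))\<^sup>2)) = 0"
    using integral_linear[OF sq_ai bounded_linear_of_real[where 'a = complex]] by (simp add: o_def)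
  then have I0: "integral {a..b} (\<lambda>x. (cmod (r x))\<^sup>2) = 0" by simp
  have r_ai: "(\<lambda>x. (cmod (r x))\<^sup>2) absolutely_integrable_on {a..b}"
    using sq_ai by (subst absolutely_integrable_on_iff_nonneg) auto
  have "(LINT x:{a..b}|lebesgue. (cmod (r x))\<^sup>2) = 0"
    unfolding set_lebesgue_integral_eq_integral(2)[OF r_ai] by (rule I0)
  then have "AE x in lebesgue. indicat_real {a..b} x *\<^sub>R (cmod (r x))\<^sup>2 = 0"
    using r_ai unfolding set_lebesgue_integral_def set_integrable_def
    by (subst (asm) integral_nonneg_eq_0_iff_AE) auto
  then have "AE x in lebesgue. x \<in> {0<..} \<longrightarrow> indicat_real {a..b} x *\<^sub>R (cmod (r x))\<^sup>2 = 0"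
    by eventually_elim simp
  then have "AE x in half_line. indicat_real {a..b} x *\<^sub>R (cmod (r x))\<^sup>2 = 0"
    by (subst AE_restrict_space_iff) auto
  then have "AE x in half_line. x \<in> {a<..<b} \<longrightarrow> h x = (\<alpha> - m *\<^sub>R \<beta>) + x *\<^sub>R \<beta>"
    by eventually_elim (auto simp: r_def scaleR_diff_left algebra_simps indicator_def)
  then show ?thesis by (rule that)
qed

text \<open>The two moment conditions characterize the second derivatives of functions supported in
  \<open>[a, b]\<close>, so this is the du Bois-Reymond lemma of order two. The local affine
  functions fit together because each coincides with the first one at two points.\<close>

lemma affine_if_orthogonal_to_second_derivatives:
  fixes h :: "real \<Rightarrow> complex"
  assumes hm: "h \<in> borel_measurable half_line"
    and h2: "\<And>b. (\<lambda>x. (cmod (h x))\<^sup>2) integrable_on {0..b}"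
    and orth: "\<And>k a b. 0 < a \<Longrightarrow> a < b \<Longrightarrow> square_integrable k \<Longrightarrow> (\<And>x. x \<notin> {a<..<b} \<Longrightarrow> k x = 0) \<Longrightarrow>
      integral {0..b} k = 0 \<Longrightarrow> integral {0..b} (\<lambda>x. x *\<^sub>R k x) = 0 \<Longrightarrow>
      integral {0..b} (\<lambda>x. h x * k x) = 0"
  obtains \<alpha> \<beta> where "AE x in half_line. h x = \<alpha> + x *\<^sub>R \<beta>"
proof -
  \<comment> \<open>The shift by 2 makes every interval contain \<open>(1/2, 2)\<close>, on which
    the pieces are compared.\<close>
  have "\<exists>\<alpha> \<beta>. AE x in half_line. x \<in> {1 / real (n + 2)<..<real (n + 2)} \<longrightarrow> h x = \<alpha> + x *\<^sub>R \<beta>" for n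
  proof -
    have "1 / real (n + 2) < real (n + 2)" by (rule less_trans[of _ 1]) auto
    then show ?thesis
      by (rule affine_if_orthogonal_to_second_derivatives_on_interval[OF hm h2 orth, rotated -2])
        (blast | simp)+
  qed
  then obtain \<alpha> \<beta> where AE: "\<And>n. AE x in half_line. x \<in> {1 / real (n + 2)<..<real (n + 2)} \<longrightarrow> h x = \<alpha> n + x *\<^sub>R \<beta> n"
    by metis
  have const: "\<alpha> n = \<alpha> 0 \<and> \<beta> n = \<beta> 0" for n
  proof -
    have "AE x in half_line. x \<in> {1/2<..<2} \<longrightarrow> \<alpha> n + x *\<^sub>R \<beta> n = \<alpha> 0 + x *\<^sub>R \<beta> 0"
      using AE[of n] AE[of 0]
    proof eventually_elim
      case (elim x)
      have le: "1 / real (n + 2) \<le> 1 / 2" by (intro divide_left_mono) auto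
      show ?case
      proof
        assume x: "x \<in> {1/2<..<2}"
        have "x \<in> {1 / real (n + 2)<..<real (n + 2)}"
          using x le unfolding greaterThanLessThan_iff by linarith
        moreover have "x \<in> {1 / real (0 + 2)<..<real (0 + 2)}" using x by simp
        ultimately show "\<alpha> n + x *\<^sub>R \<beta> n = \<alpha> 0 + x *\<^sub>R \<beta> 0" using elim by metis
      qed
    qed
    then have *: "\<exists>x. c < x \<and> x < d \<and> \<alpha> n + x *\<^sub>R \<beta> n = \<alpha> 0 + x *\<^sub>R \<beta> 0"
      if "1/2 \<le> c" "c < d" "d \<le> 2" for c d
      using that by (elim AE_half_line_witness[where a = c and b = d]) auto
    \<comment> \<open>One point of agreement on either side of 1 determines both
      coefficients.\<close>
    obtain x where x: "x < 1" "\<alpha> n + x *\<^sub>R \<beta> n = \<alpha> 0 + x *\<^sub>R \<beta> 0"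
      using *[of "1/2" 1] by auto
    obtain y where y: "1 < y" "\<alpha> n + y *\<^sub>R \<beta> n = \<alpha> 0 + y *\<^sub>R \<beta> 0"
      using *[of 1 2] by auto
    have "(y - x) *\<^sub>R (\<beta> n - \<beta> 0) = (\<alpha> n + y *\<^sub>R \<beta> n) - (\<alpha> n + x *\<^sub>R \<beta> n) - ((\<alpha> 0 + y *\<^sub>R \<beta> 0) - (\<alpha> 0 + x *\<^sub>R \<beta> 0))"
      by (simp add: algebra_simps)
    also have "\<dots> = 0" unfolding x(2) y(2) by simp
    finally have "\<beta> n = \<beta> 0" using x(1) y(1) by simp
    then show ?thesis using x(2) by simp
  qed
  have "AE x in half_line. \<forall>n. x \<in> {1 / real (n + 2)<..<real (n + 2)} \<longrightarrow> h x = \<alpha> 0 + x *\<^sub>R \<beta> 0"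
  proof (subst AE_all_countable, intro allI)
    fix n show "AE x in half_line. x \<in> {1 / real (n + 2)<..<real (n + 2)} \<longrightarrow> h x = \<alpha> 0 + x *\<^sub>R \<beta> 0"
      using AE[of n] const[of n] by metis
  qed
  moreover have "AE x in half_line. x \<in> space half_line" by (rule AE_space)
  ultimately have "AE x in half_line. h x = \<alpha> 0 + x *\<^sub>R \<beta> 0"
  proof eventually_elim
    case (elim x)
    then have x: "0 < x" by simp
    obtain n where n: "max x (1 / x) < real n" using reals_Archimedean2 by blast
    then have "1 / real (n + 2) < x" "x < real (n + 2)"
      using x by (auto simp: field_simps)
    then show ?case using elim by auto
  qed
  then show ?thesis by (rule that)
qed

section \<open>Exponentials, local bounds and positive parts\<close>

lemma ac_exp:
  assumes f: "ac f f'" "continuous_on {0..} f'"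
  shows "ac (\<lambda>x. exp (f x :: real)) (\<lambda>x. f' x * exp (f x))"
proof (rule ac_has_vector_derivative)
  fix x :: real assume "0 \<le> x"
  then have "(f has_real_derivative f' x) (at x within {0..})"
    unfolding has_real_derivative_iff_has_vector_derivative
    by (rule ac_imp_has_vector_derivative[OF f])
  then show "((\<lambda>x. exp (f x)) has_vector_derivative f' x * exp (f x)) (at x within {0..})"
    unfolding has_real_derivative_iff_has_vector_derivative[symmetric]
    by (auto intro!: derivative_eq_intros)
qed (intro continuous_intros f ac_continuous_on_halfline[OF f(1)])

lemma ac_0_iff_const:
  assumes "ac f (\<lambda>x. 0)" "0 \<le> x"
  shows "f x = f 0"
  using ac_eq[OF assms] by simp

lemma continuous_on_halfline_bounded:
  fixes f :: "real \<Rightarrow> real"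
  assumes "continuous_on {0..} f"
  obtains B where "0 < B" "\<And>x. 0 \<le> x \<Longrightarrow> x \<le> b \<Longrightarrow> \<bar>f x\<bar> \<le> B"
proof -
  have "compact (f ` {0..b})"
    by (intro compact_continuous_image continuous_on_subset[OF assms]) auto
  then have "bounded (f ` {0..b})" by (rule compact_imp_bounded)
  then obtain B where "0 < B" "\<And>y. y \<in> f ` {0..b} \<Longrightarrow> norm y \<le> B"
    unfolding bounded_pos by blast
  then show ?thesis by (intro that) auto
qed

lemma borel_measurable_half_line_continuous:
  fixes f :: "real \<Rightarrow> 'a::topological_space"
  assumes "continuous_on {0..} f"
  shows "f \<in> borel_measurable half_line"
  by (rule continuous_imp_measurable_on_sets_lebesgue[OF continuous_on_subset[OF assms]]) auto

text \<open>Bounded support lets a constant enter the majorant: the functions built from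
  \<open>E\<close>, \<open>W\<close> and a test function are dominated by a multiple of a
  square-integrable function plus a constant.\<close>

lemma square_integrable_bounded_support:
  fixes g :: "real \<Rightarrow> complex"
  assumes g: "g \<in> borel_measurable half_line" and h: "square_integrable h"
    and le: "\<And>x. 0 \<le> x \<Longrightarrow> x \<le> b \<Longrightarrow> cmod (g x) \<le> C * cmod (h x) + D" and zero: "\<And>x. b < x \<Longrightarrow> g x = 0"
  shows "square_integrable g"
  unfolding square_integrable_def
proof
  show "integrable half_line (\<lambda>x. (cmod (g x))\<^sup>2)"
  proof (rule Bochner_Integration.integrable_bound)
    have "integrable half_line (indicator {0<..b} :: real \<Rightarrow> real)"
      using emeasure_bounded_finite[OF bounded_subset[of "{0<..b}" "{0<..b} \<inter> {0<..}"]]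
      by (subst integrable_indicator_iff)
        (auto simp: sets_restrict_space_iff emeasure_restrict_space less_top[symmetric])
    then show "integrable half_line (\<lambda>x. 2 * C\<^sup>2 * (cmod (h x))\<^sup>2 + 2 * D\<^sup>2 * indicator {0<..b} x)"
      using h by (intro Bochner_Integration.integrable_add integrable_mult_right) (auto simp: square_integrable_def)
    show "AE x in half_line. norm ((cmod (g x))\<^sup>2) \<le> norm (2 * C\<^sup>2 * (cmod (h x))\<^sup>2 + 2 * D\<^sup>2 * indicator {0<..b} x)"
    proof (rule AE_I2)
      fix x assume "x \<in> space half_line"
      then have x: "0 < x" by simp
      show "norm ((cmod (g x))\<^sup>2) \<le> norm (2 * C\<^sup>2 * (cmod (h x))\<^sup>2 + 2 * D\<^sup>2 * indicator {0<..b} x)"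
      proof (cases "x \<le> b")
        case True
        have "(cmod (g x))\<^sup>2 \<le> (C * cmod (h x) + D)\<^sup>2"
          using le[of x] x True by (intro power_mono) auto
        also have "\<dots> \<le> 2 * C\<^sup>2 * (cmod (h x))\<^sup>2 + 2 * D\<^sup>2"
          using sum_squares_bound[of "C * cmod (h x)" D] by (simp add: power2_sum power_mult_distrib)
        finally show ?thesis using x True by simp
      qed (simp add: zero)
    qed
  qed (use g in measurable)
qed (rule g)

lemma square_integrable_if_near_infinity:
  assumes u: "continuous_on {0..} u" and "0 \<le> c"
    and int: "set_integrable lebesgue {c..} (\<lambda>x. (cmod (u x))\<^sup>2)"
  shows "square_integrable u"
proof -
  have "(\<lambda>x. (cmod (u x))\<^sup>2) absolutely_integrable_on {0..c}"
    by (rule absolutely_integrable_continuous_real)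
      (intro continuous_intros continuous_on_subset[OF u], auto)
  then have "(\<lambda>x. (cmod (u x))\<^sup>2) absolutely_integrable_on ({0..c} \<union> {c..})"
    using int by (intro set_integrable_Un) auto
  moreover have "{0..c} \<union> {c..} = {0..}" using \<open>0 \<le> c\<close> by auto
  ultimately show ?thesis
    using absolutely_integrable_half_line borel_measurable_half_line_continuous[OF u]
    by (auto simp: square_integrable_def)
qed

text \<open>Needed for the cut-offs in the Weyl sequences: the cube of the positive part of a smooth
  function has a continuous second derivative across the zeros.\<close>

lemma has_real_derivative_positive_part_power2:
  "((\<lambda>t. (max 0 t)\<^sup>2) has_real_derivative 2 * max 0 t) (at t)"
proof (cases t "0 :: real" rule: linorder_cases)
  case less
  have "((\<lambda>t. 0) has_real_derivative 0) (at t)" by simp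
  then have "((\<lambda>t. (max 0 t)\<^sup>2) has_real_derivative 0) (at t)"
    by (rule has_field_derivative_transform_within_open[where S = "{..<0}"]) (use less in auto)
  then show ?thesis using less by simp
next
  case greater
  have "((\<lambda>t. t\<^sup>2) has_real_derivative 2 * t) (at t)" by (auto intro!: derivative_eq_intros)
  then have "((\<lambda>t. (max 0 t)\<^sup>2) has_real_derivative 2 * t) (at t)"
    by (rule has_field_derivative_transform_within_open[where S = "{0<..}"]) (use greater in auto)
  then show ?thesis using greater by simp
next
  case equal
  have "((\<lambda>h. ((max 0 (0 + h))\<^sup>2 - (max 0 0)\<^sup>2) / h) \<longlongrightarrow> 0) (at (0 :: real))"
  proof (rule Lim_null_comparison)
    show "\<forall>\<^sub>F h in at (0 :: real). norm (((max 0 (0 + h))\<^sup>2 - (max 0 0)\<^sup>2) / h) \<le> \<bar>h\<bar>"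
      by (rule always_eventually) (auto simp: max_def power2_eq_square)
    show "((\<lambda>h :: real. \<bar>h\<bar>) \<longlongrightarrow> 0) (at 0)" by (intro tendsto_rabs_zero tendsto_ident_at)
  qed
  then show ?thesis using equal by (simp add: DERIV_def)
qed

lemma has_real_derivative_positive_part_power3:
  "((\<lambda>t. (max 0 t) ^ 3) has_real_derivative 3 * (max 0 t)\<^sup>2) (at t)"
proof -
  have "((\<lambda>t. t * (max 0 t)\<^sup>2) has_real_derivative 1 * (max 0 t)\<^sup>2 + (2 * max 0 t) * t) (at t)"
    by (rule DERIV_mult'[OF _ has_real_derivative_positive_part_power2, THEN DERIV_cong])
      (auto intro: derivative_eq_intros)
  moreover have "(\<lambda>t. t * (max 0 t)\<^sup>2) = (\<lambda>t :: real. (max 0 t) ^ 3)"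
    by (auto simp: max_def power2_eq_square power3_eq_cube)
  moreover have "1 * (max 0 t)\<^sup>2 + (2 * max 0 t) * t = 3 * (max 0 t)\<^sup>2"
    by (auto simp: max_def power2_eq_square)
  ultimately show ?thesis by (simp only:)
qed

section \<open>Schroedinger equation as a first-order system\<close>

locale half_line_potential =
  fixes V :: "real \<Rightarrow> real" and l :: real
  assumes V_integrable: "\<And>b. V absolutely_integrable_on {0..b}"
    and V_limit: "((\<lambda>x. integral {0..x} V) \<longlongrightarrow> l) at_top"
begin

definition W :: "real \<Rightarrow> real" where
  "W x = - l + integral {0..x} V"

text \<open>The integrating factor with \<open>E' = W E\<close> and value 1 at 0. The summand
  \<open>0\<close> keeps the shape \<open>c + integral\<close> of
  \<open>ac_integral_continuous\<close>.\<close>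

definition E :: "real \<Rightarrow> real" where
  "E x = exp (0 + integral {0..x} W)"

lemma ac_W: "ac W V"
  using ac_integral[OF V_integrable, of "- l"] by (rule ac_cong) (auto simp: W_def)

lemma W_cont: "continuous_on {0..} W"
  by (rule ac_continuous_on_halfline[OF ac_W])

lemma W_tendsto: "(W \<longlongrightarrow> 0) at_top"
  unfolding W_def using tendsto_add[OF tendsto_const[of "- l"] V_limit] by simp

lemma W_eventually_le:
  assumes "0 < e"
  obtains R where "0 \<le> R" "\<And>x. R \<le> x \<Longrightarrow> \<bar>W x\<bar> \<le> e"
proof -
  have "\<forall>\<^sub>F x in at_top. dist (W x) 0 < e" using W_tendsto assms by (rule tendstoD)
  then obtain R where R: "\<And>x. R \<le> x \<Longrightarrow> \<bar>W x\<bar> < e"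
    by (auto simp: eventually_at_top_linorder)
  show ?thesis
    by (rule that[of "max 0 R"]) (use R less_imp_le in auto)
qed

lemma W_bounded:
  obtains M where "0 < M" "\<And>x. 0 \<le> x \<Longrightarrow> \<bar>W x\<bar> \<le> M"
proof -
  obtain R where R: "\<And>x. R \<le> x \<Longrightarrow> \<bar>W x\<bar> \<le> 1" using W_eventually_le[of 1] by auto
  obtain B where B: "0 < B" "\<And>x. 0 \<le> x \<Longrightarrow> x \<le> R \<Longrightarrow> \<bar>W x\<bar> \<le> B"
    using continuous_on_halfline_bounded[OF W_cont, of R] by blast
  have "\<bar>W x\<bar> \<le> B + 1" if "0 \<le> x" for x
    using R[of x] B(2)[OF that] B(1) by (cases "R \<le> x") auto
  then show ?thesis using B(1) by (intro that[of "B + 1"]) auto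
qed

lemma ac_E: "ac E (\<lambda>x. W x * E x)"
  unfolding E_def by (rule ac_exp[OF ac_integral_continuous[OF W_cont] W_cont])

lemma ac_inverse_E: "ac (\<lambda>x. inverse (E x)) (\<lambda>x. - W x * inverse (E x))"
proof -
  have "ac (\<lambda>x. exp (- (0 + integral {0..x} W))) (\<lambda>x. - W x * exp (- (0 + integral {0..x} W)))"
    by (rule ac_exp[OF ac_minus[OF ac_integral_continuous[OF W_cont]]]) (intro continuous_intros W_cont)
  then show ?thesis by (simp add: E_def exp_minus)
qed

lemma E_pos [simp]: "0 < E x" and E_nonzero [simp]: "E x \<noteq> 0" and E_0 [simp]: "E 0 = 1"
  by (auto simp: E_def)

lemma E_cont: "continuous_on {0..} E"
  by (rule ac_continuous_on_halfline[OF ac_E])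

lemma inverse_E_cont: "continuous_on {0..} (\<lambda>x. inverse (E x))"
  by (rule ac_continuous_on_halfline[OF ac_inverse_E])

text \<open>In terms of \<open>u = E v\<close> and \<open>q = E (u' - W u)\<close> the equation \<open>- u'' + V u = f\<close> becomes a
  first-order system whose coefficients involve \<open>W\<close> but not \<open>V\<close>.\<close>

definition qsys :: "(real \<Rightarrow> complex) \<Rightarrow> (real \<Rightarrow> complex) \<Rightarrow> (real \<Rightarrow> complex) \<Rightarrow> bool" where
  "qsys v q f \<longleftrightarrow> ac v (\<lambda>x. (inverse (E x))\<^sup>2 *\<^sub>R q x) \<and>
     ac q (\<lambda>x. - (E x *\<^sub>R (f x + (W x)\<^sup>2 *\<^sub>R E x *\<^sub>R v x)))"

text \<open>This links classes with functions: \<open>U\<close> and \<open>F\<close> are classes,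
  whereas \<open>v\<close> and \<open>q\<close> are continuous functions on the half-line whose
  values at 0 serve as the two traces of \<open>U\<close>.\<close>

definition represents :: "L2 \<Rightarrow> L2 \<Rightarrow> (real \<Rightarrow> complex) \<Rightarrow> (real \<Rightarrow> complex) \<Rightarrow> (real \<Rightarrow> complex) \<Rightarrow> bool" where
  "represents U F v q f \<longleftrightarrow> qsys v q f \<and> square_integrable (\<lambda>x. E x *\<^sub>R v x) \<and> square_integrable f \<and>
     U = abs_L2 (\<lambda>x. E x *\<^sub>R v x) \<and> F = abs_L2 f"

lemma qsys_ac_u:
  assumes "qsys v q f"
  shows "ac (\<lambda>x. E x *\<^sub>R v x) (\<lambda>x. W x *\<^sub>R E x *\<^sub>R v x + inverse (E x) *\<^sub>R q x)"
proof -
  have "ac v (\<lambda>x. (inverse (E x))\<^sup>2 *\<^sub>R q x)" using assms by (simp add: qsys_def)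
  from ac_bilinear[OF bounded_bilinear_scaleR ac_E this] show ?thesis
    by (rule ac_cong) (simp_all add: power2_eq_square)
qed

text \<open>The potential comes back here: in \<open>u' = W u + q / E\<close> the factor
  \<open>W\<close> has derivative \<open>V\<close>, and all remaining terms with \<open>W\<close>
  cancel against those from \<open>q'\<close>.\<close>

lemma qsys_schroedinger:
  assumes "qsys v q f"
  shows "schroedinger V (\<lambda>x. E x *\<^sub>R v x) f"
proof -
  define u where "u = (\<lambda>x. E x *\<^sub>R v x)"
  define u' where "u' = (\<lambda>x. W x *\<^sub>R u x + inverse (E x) *\<^sub>R q x)"
  define q' where "q' = (\<lambda>x. - (E x *\<^sub>R (f x + (W x)\<^sup>2 *\<^sub>R u x)))"
  have u: "ac u u'" unfolding u_def u'_def using qsys_ac_u[OF assms] by simp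
  have q: "ac q q'" using assms by (simp add: qsys_def q'_def u_def)
  have u': "ac u' (\<lambda>x. (V x *\<^sub>R u x + W x *\<^sub>R u' x) + ((- W x * inverse (E x)) *\<^sub>R q x + inverse (E x) *\<^sub>R q' x))"
    (is "ac u' ?u2")
    unfolding u'_def[THEN fun_cong, abs_def]
    by (rule ac_add[OF ac_bilinear[OF bounded_bilinear_scaleR ac_W u] ac_bilinear[OF bounded_bilinear_scaleR ac_inverse_E q],
          unfolded u'_def])
  have "- ?u2 x + of_real (V x) * u x = f x" for x
    by (simp add: u'_def q'_def scaleR_conv_of_real power2_eq_square field_simps)
  then show ?thesis
    unfolding schroedinger_def ac_deriv_eq_ac u_def[symmetric] using u u' by blast
qed

text \<open>The coefficients of the system are real. Conjugation enters because the adjoint relation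
  tests \<open>cnj u\<close> rather than \<open>u\<close>.\<close>

lemma qsys_cnj:
  assumes "qsys v q f"
  shows "qsys (\<lambda>x. cnj (v x)) (\<lambda>x. cnj (q x)) (\<lambda>x. cnj (f x))"
  unfolding qsys_def
proof
  show "ac (\<lambda>x. cnj (v x)) (\<lambda>x. (inverse (E x))\<^sup>2 *\<^sub>R cnj (q x))"
    by (rule ac_cong[OF ac_linear[OF _ bounded_linear_cnj, of v]]) (use assms in \<open>auto simp: qsys_def\<close>)
  show "ac (\<lambda>x. cnj (q x)) (\<lambda>x. - (E x *\<^sub>R (cnj (f x) + (W x)\<^sup>2 *\<^sub>R E x *\<^sub>R cnj (v x))))"
    by (rule ac_cong[OF ac_linear[OF _ bounded_linear_cnj, of q]]) (use assms in \<open>auto simp: qsys_def\<close>)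
qed

lemma qsys_diff:
  assumes "qsys v q f" "qsys v' q' f'"
  shows "qsys (\<lambda>x. v x - v' x) (\<lambda>x. q x - q' x) (\<lambda>x. f x - f' x)"
proof -
  have "ac (\<lambda>x. v x - v' x) (\<lambda>x. (inverse (E x))\<^sup>2 *\<^sub>R q x - (inverse (E x))\<^sup>2 *\<^sub>R q' x)"
    using assms by (intro ac_diff) (auto simp: qsys_def)
  moreover have "ac (\<lambda>x. q x - q' x) (\<lambda>x. - (E x *\<^sub>R (f x + (W x)\<^sup>2 *\<^sub>R E x *\<^sub>R v x))
      - - (E x *\<^sub>R (f' x + (W x)\<^sup>2 *\<^sub>R E x *\<^sub>R v' x)))"
    using assms by (intro ac_diff) (auto simp: qsys_def)
  ultimately show ?thesis
    unfolding qsys_def by (auto elim!: ac_cong simp: scaleR_diff_right algebra_simps)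
qed

lemma qsys_mult:
  assumes "qsys v q f"
  shows "qsys (\<lambda>x. c * v x) (\<lambda>x. c * q x) (\<lambda>x. c * f x)"
proof -
  have "ac (\<lambda>x. c * v x) (\<lambda>x. c * ((inverse (E x))\<^sup>2 *\<^sub>R q x))"
    using assms by (intro ac_linear[OF _ bounded_linear_mult_right]) (auto simp: qsys_def)
  moreover have "ac (\<lambda>x. c * q x) (\<lambda>x. c * (- (E x *\<^sub>R (f x + (W x)\<^sup>2 *\<^sub>R E x *\<^sub>R v x))))"
    using assms by (intro ac_linear[OF _ bounded_linear_mult_right]) (auto simp: qsys_def)
  ultimately show ?thesis
    unfolding qsys_def by (auto elim!: ac_cong simp: algebra_simps)
qed

lemma represents_diff:
  assumes "represents U F v q f" "represents U' F' v' q' f'"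
  shows "represents (U - U') (F - F') (\<lambda>x. v x - v' x) (\<lambda>x. q x - q' x) (\<lambda>x. f x - f' x)"
proof -
  have "(\<lambda>x. E x *\<^sub>R (v x - v' x)) = (\<lambda>x. E x *\<^sub>R v x - E x *\<^sub>R v' x)"
    by (simp add: scaleR_diff_right)
  then show ?thesis
    using assms unfolding represents_def
    by (auto simp: qsys_diff minus_abs_L2 square_integrable_diff)
qed

lemma represents_scaleC:
  assumes "represents U F v q f"
  shows "represents (scaleC_L2 c U) (scaleC_L2 c F) (\<lambda>x. c * v x) (\<lambda>x. c * q x) (\<lambda>x. c * f x)"
proof -
  have "(\<lambda>x. E x *\<^sub>R (c * v x)) = (\<lambda>x. c * (E x *\<^sub>R v x))"
    by simp
  then show ?thesis
    using assms unfolding represents_def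
    by (auto simp: qsys_mult scaleC_abs_L2 square_integrable_scale simp del: mult_scaleR_right)
qed

text \<open>This is how enough elements of the domain arise although \<open>V\<close> is merely
  locally integrable: after multiplication by \<open>E\<close> the singular term \<open>V u\<close>
  cancels, and the right-hand side is as regular as \<open>v''\<close>.\<close>

lemma qsys_test_function:
  assumes v: "ac v v'" "ac v' v''"
  shows "qsys v (\<lambda>x. (E x)\<^sup>2 *\<^sub>R v' x)
    (\<lambda>x. - (E x *\<^sub>R (v'' x + (2 * W x) *\<^sub>R v' x + (W x)\<^sup>2 *\<^sub>R v x)))"
proof -
  have 1: "ac (\<lambda>x. (E x)\<^sup>2 *\<^sub>R v' x) (\<lambda>x. (W x * E x * E x + E x * (W x * E x)) *\<^sub>R v' x + (E x * E x) *\<^sub>R v'' x)"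
    using ac_bilinear[OF bounded_bilinear_scaleR ac_bilinear[OF bounded_bilinear_mult ac_E ac_E] v(2)]
    by (simp add: power2_eq_square)
  have 2: "ac (\<lambda>x. (E x)\<^sup>2 *\<^sub>R v' x) (\<lambda>x. - (E x *\<^sub>R (- (E x *\<^sub>R (v'' x + (2 * W x) *\<^sub>R v' x + (W x)\<^sup>2 *\<^sub>R v x))
      + (W x)\<^sup>2 *\<^sub>R E x *\<^sub>R v x)))"
    by (rule ac_cong[OF 1]) (simp_all add: scaleR_conv_of_real power2_eq_square algebra_simps)
  have 3: "ac v (\<lambda>x. (inverse (E x))\<^sup>2 *\<^sub>R (E x)\<^sup>2 *\<^sub>R v' x)"
    by (rule ac_cong[OF v(1)]) (simp_all add: power_inverse)
  show ?thesis unfolding qsys_def using 2 3 by blast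
qed

lemma test_function_in_preminimal:
  assumes v: "ac v v'" "ac v' v''" and v'': "square_integrable v''"
    and supp: "0 < a" "a \<le> b" "\<And>x. 0 \<le> x \<Longrightarrow> x \<notin> {a..b} \<Longrightarrow> v x = 0 \<and> v' x = 0 \<and> v'' x = 0"
  defines "f \<equiv> \<lambda>x. - (E x *\<^sub>R (v'' x + (2 * W x) *\<^sub>R v' x + (W x)\<^sup>2 *\<^sub>R v x))"
  shows "square_integrable (\<lambda>x. E x *\<^sub>R v x)" "square_integrable f"
    "(abs_L2 (\<lambda>x. E x *\<^sub>R v x), abs_L2 f) \<in> preminimal_operator V"
proof -
  note cont = E_cont W_cont ac_continuous_on_halfline[OF v(1)] ac_continuous_on_halfline[OF v(2)]
  have zero: "v x = 0" "v' x = 0" "v'' x = 0" if "b < x" for x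
    using supp(3)[of x] supp(1,2) that by auto
  show u2: "square_integrable (\<lambda>x. E x *\<^sub>R v x)"
  proof -
    have c: "continuous_on {0..} (\<lambda>x. E x *\<^sub>R v x)" by (intro continuous_intros cont)
    obtain D where D: "\<And>x. 0 \<le> x \<Longrightarrow> x \<le> b \<Longrightarrow> \<bar>cmod (E x *\<^sub>R v x)\<bar> \<le> D"
      using continuous_on_halfline_bounded[OF continuous_on_norm[OF c], of b] by blast
    show ?thesis
    proof (rule square_integrable_bounded_support[OF borel_measurable_half_line_continuous[OF c] square_integrable_0, of b 0 D])
      show "cmod (E x *\<^sub>R v x) \<le> 0 * cmod 0 + D" if "0 \<le> x" "x \<le> b" for x
        using D[OF that] by linarith
    qed (simp add: zero)
  qed
  show f2: "square_integrable f"
  proof -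
    have c: "continuous_on {0..} (\<lambda>x. E x *\<^sub>R ((2 * W x) *\<^sub>R v' x + (W x)\<^sup>2 *\<^sub>R v x))"
      by (intro continuous_intros cont)
    obtain D where D: "\<And>x. 0 \<le> x \<Longrightarrow> x \<le> b \<Longrightarrow> \<bar>cmod (E x *\<^sub>R ((2 * W x) *\<^sub>R v' x + (W x)\<^sup>2 *\<^sub>R v x))\<bar> \<le> D"
      using continuous_on_halfline_bounded[OF continuous_on_norm[OF c], of b] by blast
    obtain C where C: "\<And>x. 0 \<le> x \<Longrightarrow> x \<le> b \<Longrightarrow> \<bar>E x\<bar> \<le> C"
      using continuous_on_halfline_bounded[OF E_cont, of b] by blast
    have f_eq: "f = (\<lambda>x. - (E x *\<^sub>R v'' x) - E x *\<^sub>R ((2 * W x) *\<^sub>R v' x + (W x)\<^sup>2 *\<^sub>R v x))"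
      by (simp add: f_def algebra_simps)
    show ?thesis
    proof (rule square_integrable_bounded_support[OF _ v'', of f b C D])
      have "(\<lambda>x. E x) \<in> borel_measurable half_line" by (rule borel_measurable_half_line_continuous[OF E_cont])
      moreover have "v'' \<in> borel_measurable half_line" using v'' by (simp add: square_integrable_def)
      ultimately show "f \<in> borel_measurable half_line"
        unfolding f_eq using borel_measurable_half_line_continuous[OF c] by measurable
      show "cmod (f x) \<le> C * cmod (v'' x) + D" if x: "0 \<le> x" "x \<le> b" for x
      proof -
        have "cmod (f x) \<le> cmod (E x *\<^sub>R v'' x) + cmod (E x *\<^sub>R ((2 * W x) *\<^sub>R v' x + (W x)\<^sup>2 *\<^sub>R v x))"
          unfolding f_eq by (rule norm_triangle_ineq4[of "- (E x *\<^sub>R v'' x)", unfolded norm_minus_cancel])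
        also have "\<dots> \<le> C * cmod (v'' x) + D"
          using C[OF x] D[OF x] by (intro add_mono) (auto intro!: mult_right_mono)
        finally show ?thesis .
      qed
    qed (simp add: f_def zero)
  qed
  have s: "schroedinger V (\<lambda>x. E x *\<^sub>R v x) f"
    unfolding f_def by (rule qsys_schroedinger[OF qsys_test_function[OF v]])
  show "(abs_L2 (\<lambda>x. E x *\<^sub>R v x), abs_L2 f) \<in> preminimal_operator V"
    unfolding preminimal_operator_def mem_Collect_eq
  proof (intro exI conjI)
    show "\<forall>x\<ge>0. x \<notin> {a..b} \<longrightarrow> E x *\<^sub>R v x = 0" using supp(3) by simp
  qed (rule refl u2 f2 s supp(1) supp(2))+
qed

section \<open>Adjoint of the preminimal operator\<close>

text \<open>With \<open>w = E cnj u\<close>, testing the adjoint relation against \<open>E v\<close> and integrating by parts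
  turns it into an orthogonality of \<open>w - 2 \<integral> W w + \<integral>\<integral> (W\<^sup>2 w + E cnj f)\<close> to all \<open>v''\<close>.\<close>

lemma adjoint_preminimal_represents:
  assumes adj: "(U, F) \<in> adjoint_operator (preminimal_operator V)"
  shows "\<exists>v q f. represents U F v q f"
proof -
  obtain u where u: "square_integrable u" "U = abs_L2 u" by (rule L2_cases)
  obtain f where f: "square_integrable f" "F = abs_L2 f" by (rule L2_cases)
  define uc where "uc x = cnj (u x)" for x
  define fc where "fc x = cnj (f x)" for x
  have sq_cnj: "square_integrable (\<lambda>x. cnj (g x))" if "square_integrable g" for g
    unfolding square_integrable_def
  proof
    show "(\<lambda>x. cnj (g x)) \<in> borel_measurable half_line"
      using that by (intro measurable_compose[of g half_line borel cnj] borel_measurable_continuous_onI)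
        (auto simp: square_integrable_def intro!: continuous_intros)
  qed (use that in \<open>simp add: square_integrable_def\<close>)
  have uc: "square_integrable uc" and fc: "square_integrable fc"
    unfolding uc_def fc_def using sq_cnj u f by auto
  \<comment> \<open>In terms of the system, \<open>\<omega>\<close> will turn out to be
    \<open>E\<^sup>2\<close> times the conjugate of the wanted first component, almost
    everywhere.\<close>
  define \<omega> where "\<omega> x = E x *\<^sub>R uc x" for x
  define \<phi> where "\<phi> x = E x *\<^sub>R fc x" for x
  have ai_u: "uc absolutely_integrable_on {0..b}" and ai_f: "fc absolutely_integrable_on {0..b}" for b
    using square_integrable_abs_integrable uc fc by auto
  have ai_scale: "(\<lambda>x. c x *\<^sub>R g x) absolutely_integrable_on {0..b}"
    if "continuous_on {0..} c" "g absolutely_integrable_on {0..b}" for c and g :: "real \<Rightarrow> complex" and b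
    by (rule absolutely_integrable_bilinear_continuous[OF bounded_bilinear_scaleR continuous_on_subset[OF that(1)] that(2)])
      auto
  have ai_\<omega>: "\<omega> absolutely_integrable_on {0..b}" and ai_\<phi>: "\<phi> absolutely_integrable_on {0..b}" for b
    unfolding \<omega>_def \<phi>_def by (intro ai_scale E_cont ai_u ai_f)+
  have \<omega>_meas: "\<omega> \<in> borel_measurable half_line"
  proof -
    have "E \<in> borel_measurable half_line" by (rule borel_measurable_half_line_continuous[OF E_cont])
    moreover have "uc \<in> borel_measurable half_line" using uc by (simp add: square_integrable_def)
    ultimately show ?thesis unfolding \<omega>_def by measurable
  qed
  define A1 where "A1 = (\<lambda>x. 0 + integral {0..x} (\<lambda>t. (2 * W t) *\<^sub>R \<omega> t))"
  define B' where "B' = (\<lambda>t. (W t)\<^sup>2 *\<^sub>R \<omega> t + \<phi> t)"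
  define B where "B = (\<lambda>x. 0 + integral {0..x} B')"
  define A2 where "A2 = (\<lambda>x. 0 + integral {0..x} B)"
  have ac_A1: "ac A1 (\<lambda>t. (2 * W t) *\<^sub>R \<omega> t)"
    unfolding A1_def by (rule ac_integral) (intro ai_scale ai_\<omega> continuous_intros W_cont)
  have ac_B: "ac B B'"
    unfolding B_def B'_def
    by (rule ac_integral, rule set_integral_add(1)) (intro ai_scale ai_\<omega> ai_\<phi> continuous_intros W_cont)+
  have ac_A2: "ac A2 B"
    unfolding A2_def by (rule ac_integral_continuous[OF ac_continuous_on_halfline[OF ac_B]])
  note A_cont = ac_continuous_on_halfline[OF ac_A1] ac_continuous_on_halfline[OF ac_A2]
  have zero: "A1 0 = 0" "B 0 = 0" "A2 0 = 0" by (simp_all add: A1_def B_def A2_def)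
  define h where "h x = \<omega> x - A1 x + A2 x" for x
  obtain \<alpha> \<beta> where h: "AE x in half_line. h x = \<alpha> + x *\<^sub>R \<beta>"
  proof (rule affine_if_orthogonal_to_second_derivatives[of h])
    show hm: "h \<in> borel_measurable half_line"
      unfolding h_def
      by (intro borel_measurable_add borel_measurable_diff \<omega>_meas borel_measurable_half_line_continuous A_cont)
    show "(\<lambda>x. (cmod (h x))\<^sup>2) integrable_on {0..b}" for b
    proof (cases "0 \<le> b")
      case True
      have c: "continuous_on {0..} (\<lambda>x. cmod (A1 x) + cmod (A2 x))" by (intro continuous_intros A_cont)
      obtain D where D: "\<And>x. 0 \<le> x \<Longrightarrow> x \<le> b \<Longrightarrow> \<bar>cmod (A1 x) + cmod (A2 x)\<bar> \<le> D"
        using continuous_on_halfline_bounded[OF c, of b] by blast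
      obtain C where C: "\<And>x. 0 \<le> x \<Longrightarrow> x \<le> b \<Longrightarrow> \<bar>E x\<bar> \<le> C"
        using continuous_on_halfline_bounded[OF E_cont, of b] by blast
      define g where "g x = (if x \<le> b then h x else 0)" for x
      have "square_integrable g"
      proof (rule square_integrable_bounded_support[OF _ uc, of g b C D])
        show "g \<in> borel_measurable half_line"
        proof -
          have "(\<lambda>x. x) \<in> borel_measurable half_line"
            by (rule borel_measurable_half_line_continuous) (rule continuous_on_id)
          then have "{x \<in> space half_line. x \<le> b} \<in> sets half_line" by measurable
          then have "Measurable.pred half_line (\<lambda>x. x \<le> b)" by (simp add: pred_def)
          then show ?thesis unfolding g_def using hm by measurable
        qed
        show "cmod (g x) \<le> C * cmod (uc x) + D" if x: "0 \<le> x" "x \<le> b" for x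
        proof -
          have "cmod (g x) \<le> cmod (\<omega> x) + cmod (A1 x) + cmod (A2 x)"
            using norm_triangle_ineq[of "\<omega> x - A1 x" "A2 x"] norm_triangle_ineq4[of "\<omega> x" "A1 x"] x
            by (simp add: g_def h_def)
          also have "cmod (\<omega> x) \<le> C * cmod (uc x)"
            using C[OF x] by (auto simp: \<omega>_def intro: mult_right_mono)
          finally show ?thesis using D[OF x] by simp
        qed
      qed (simp add: g_def)
      then have "(\<lambda>x. (cmod (g x))\<^sup>2) integrable_on {0..b}"
        using square_integrable_local[of g 0 b] set_lebesgue_integral_eq_integral(1) by blast
      then show ?thesis
        by (rule integrable_eq) (simp add: g_def)
    qed (simp add: integrable_on_empty)
  next
    fix k :: "real \<Rightarrow> complex" and a b :: real
    assume ab: "0 < a" "a < b" and k: "square_integrable k" "\<And>x. x \<notin> {a<..<b} \<Longrightarrow> k x = 0"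
      and k0: "integral {0..b} k = 0" and k1: "integral {0..b} (\<lambda>x. x *\<^sub>R k x) = 0"
    \<comment> \<open>\<open>v1\<close> and \<open>v\<close> are successive primitives of
      \<open>k\<close>; the two moment conditions are exactly what makes them vanish at
      \<open>b\<close> and beyond.\<close>
    define v1 where "v1 = (\<lambda>x. 0 + integral {0..x} k)"
    have ac_v1: "ac v1 k"
      unfolding v1_def by (rule ac_integral) (rule square_integrable_abs_integrable[OF k(1)], simp)
    define v where "v = (\<lambda>x. 0 + integral {0..x} v1)"
    have ac_v: "ac v v1"
      unfolding v_def by (rule ac_integral_continuous[OF ac_continuous_on_halfline[OF ac_v1]])
    have int0: "integral {c..d} g = 0" if "\<And>x. x \<in> {c..d} \<Longrightarrow> g x = 0" for g :: "real \<Rightarrow> complex" and c d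
      using that by (subst Henstock_Kurzweil_Integration.integral_cong[of _ _ "\<lambda>_. 0"]) auto
    have v1_left: "v1 x = 0" if "x \<le> a" for x
      unfolding v1_def using int0[of 0 x k] k(2) that by auto
    have v1_b: "v1 b = 0" using k0 by (simp add: v1_def)
    have v1_right: "v1 x = 0" if "b \<le> x" for x
      using ac_diff_integral[OF ac_v1 _ that] int0[of b x k] k(2) v1_b ab by auto
    have v_left: "v x = 0" if "x \<le> a" for x
      unfolding v_def using int0[of 0 x v1] v1_left that by auto
    have v_b: "v b = 0"
    proof -
      have id: "ac (\<lambda>x. x) (\<lambda>x. 1 :: real)"
        by (rule ac_has_vector_derivative) (auto intro!: derivative_eq_intros continuous_intros)
      \<comment> \<open>Integration by parts expresses the integral of \<open>v1\<close> through the
        first moment of \<open>k\<close>.\<close>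
      have "b *\<^sub>R v1 b = 0 + integral {0..b} (\<lambda>x. 1 *\<^sub>R v1 x + x *\<^sub>R k x)"
        using ac_eq[OF ac_bilinear[OF bounded_bilinear_scaleR id ac_v1], of b] ab by simp
      also have "integral {0..b} (\<lambda>x. 1 *\<^sub>R v1 x + x *\<^sub>R k x) = integral {0..b} v1 + integral {0..b} (\<lambda>x. x *\<^sub>R k x)"
        unfolding scaleR_one
      proof (rule Henstock_Kurzweil_Integration.integral_add)
        show "v1 integrable_on {0..b}" by (rule ac_integrable[OF ac_v]) simp
        show "(\<lambda>x. x *\<^sub>R k x) integrable_on {0..b}"
          by (rule set_lebesgue_integral_eq_integral(1), rule ai_scale)
            (intro continuous_intros, rule square_integrable_abs_integrable[OF k(1)], simp)
      qed
      finally show ?thesis using k1 v1_b by (simp add: v_def)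
    qed
    have v_right: "v x = 0" if "b \<le> x" for x
      using ac_diff_integral[OF ac_v _ that] int0[of b x v1] v1_right v_b ab by auto
    have supp: "v x = 0 \<and> v1 x = 0 \<and> k x = 0" if "0 \<le> x" "x \<notin> {a..b}" for x
      using that v_left[of x] v1_left[of x] v_right[of x] v1_right[of x] k(2)[of x] by (cases "x < a") auto
    define ft where "ft = (\<lambda>x. - (E x *\<^sub>R (k x + (2 * W x) *\<^sub>R v1 x + (W x)\<^sup>2 *\<^sub>R v x)))"
    have a_le_b: "a \<le> b" using ab by simp
    note test = test_function_in_preminimal[OF ac_v ac_v1 k(1) ab(1) a_le_b supp, folded ft_def]
    have "cinner_L2 U (abs_L2 ft) = cinner_L2 F (abs_L2 (\<lambda>x. E x *\<^sub>R v x))"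
      using adj test(3) unfolding adjoint_operator_def by blast
    then have "(\<integral>x. uc x * ft x \<partial>half_line) = (\<integral>x. fc x * (E x *\<^sub>R v x) \<partial>half_line)"
      unfolding u f using u(1) f(1) test(1,2) by (simp add: cinner_abs_L2 uc_def fc_def)
    moreover have "(\<integral>x. uc x * ft x \<partial>half_line) = integral {0..b} (\<lambda>x. uc x * ft x)"
      unfolding uc_def
      by (rule integral_half_line_compact_support[OF square_integrable_mult[OF u(1) test(2)]])
        (use supp ab in \<open>auto simp: ft_def\<close>)
    moreover have "(\<integral>x. fc x * (E x *\<^sub>R v x) \<partial>half_line) = integral {0..b} (\<lambda>x. fc x * (E x *\<^sub>R v x))"
      unfolding fc_def
      by (rule integral_half_line_compact_support[OF square_integrable_mult[OF f(1) test(1)]])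
        (use supp ab in auto)
    ultimately have weak: "integral {0..b} (\<lambda>x. uc x * ft x) = integral {0..b} (\<lambda>x. fc x * (E x *\<^sub>R v x))"
      by simp
    have i1: "(\<lambda>x. uc x * ft x) integrable_on {0..b}"
      unfolding uc_def using half_line_imp_absolutely_integrable[OF square_integrable_mult[OF u(1) test(2)], of 0 b]
        set_lebesgue_integral_eq_integral(1) by blast
    have mult_cont: "(\<lambda>x. g x * c x) integrable_on {0..b}"
      if "g absolutely_integrable_on {0..b}" "continuous_on {0..} c" for g c :: "real \<Rightarrow> complex"
      using absolutely_integrable_bilinear_continuous[OF bounded_bilinear_mult continuous_on_subset[OF that(2)] that(1)]
        set_lebesgue_integral_eq_integral(1) by (fastforce simp: mult.commute)
    note cont = ac_continuous_on_halfline[OF ac_v] ac_continuous_on_halfline[OF ac_v1] A_cont ac_continuous_on_halfline[OF ac_B]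
    have i2: "(\<lambda>x. fc x * (E x *\<^sub>R v x)) integrable_on {0..b}"
      by (rule mult_cont[OF ai_f]) (intro continuous_intros E_cont cont)
    have ai_W\<omega>: "(\<lambda>t. (2 * W t) *\<^sub>R \<omega> t) absolutely_integrable_on {0..b}"
      by (intro ai_scale ai_\<omega> continuous_intros W_cont)
    have ai_B': "B' absolutely_integrable_on {0..b}"
      using ac_absolutely_integrable[OF ac_B, of 0 b] by simp
    have ai_k: "k absolutely_integrable_on {0..b}" by (rule square_integrable_abs_integrable[OF k(1)]) simp
    have j1: "(\<lambda>x. ((2 * W x) *\<^sub>R \<omega> x) * v1 x) integrable_on {0..b}" by (rule mult_cont[OF ai_W\<omega> cont(2)])
    have j2: "(\<lambda>x. B' x * v x) integrable_on {0..b}" by (rule mult_cont[OF ai_B' cont(1)])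
    have j3: "(\<lambda>x. A1 x * k x) integrable_on {0..b}" using mult_cont[OF ai_k cont(3)] by (simp add: mult.commute)
    have j4: "(\<lambda>x. A2 x * k x) integrable_on {0..b}" using mult_cont[OF ai_k cont(4)] by (simp add: mult.commute)
    have j5: "(\<lambda>x. B x * v1 x) integrable_on {0..b}"
      by (rule integrable_continuous_interval, rule continuous_on_subset[of "{0..}"]) (intro continuous_intros cont, simp)
    \<comment> \<open>Three integrations by parts without boundary terms: \<open>A1\<close>,
      \<open>B\<close> and \<open>A2\<close> vanish at 0, \<open>v\<close> and \<open>v1\<close> at
      \<open>b\<close>.\<close>
    have p1: "integral {0..b} (\<lambda>x. ((2 * W x) *\<^sub>R \<omega> x) * v1 x) + integral {0..b} (\<lambda>x. A1 x * k x) = 0"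
      using ac_eq[OF ac_bilinear[OF bounded_bilinear_mult ac_A1 ac_v1], of b] ab v1_b zero
        Henstock_Kurzweil_Integration.integral_add[OF j1 j3] by simp
    have p2: "integral {0..b} (\<lambda>x. B' x * v x) + integral {0..b} (\<lambda>x. B x * v1 x) = 0"
      using ac_eq[OF ac_bilinear[OF bounded_bilinear_mult ac_B ac_v], of b] ab v_b zero
        Henstock_Kurzweil_Integration.integral_add[OF j2 j5] by simp
    have p3: "integral {0..b} (\<lambda>x. B x * v1 x) + integral {0..b} (\<lambda>x. A2 x * k x) = 0"
      using ac_eq[OF ac_bilinear[OF bounded_bilinear_mult ac_A2 ac_v1], of b] ab v1_b zero
        Henstock_Kurzweil_Integration.integral_add[OF j5 j4] by simp
    have "h x * k x = - (uc x * ft x) - fc x * (E x *\<^sub>R v x) - ((2 * W x) *\<^sub>R \<omega> x) * v1 x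
        - (W x)\<^sup>2 *\<^sub>R \<omega> x * v x + fc x * (E x *\<^sub>R v x) - A1 x * k x + A2 x * k x" for x
      by (simp add: h_def ft_def \<omega>_def scaleR_conv_of_real algebra_simps)
    then have hk: "h x * k x = (- (uc x * ft x) + fc x * (E x *\<^sub>R v x)) - ((2 * W x) *\<^sub>R \<omega> x) * v1 x
        - B' x * v x - A1 x * k x + A2 x * k x" for x
      by (simp add: B'_def \<phi>_def scaleR_conv_of_real algebra_simps)
    have "((\<lambda>x. h x * k x) has_integral (- integral {0..b} (\<lambda>x. uc x * ft x) + integral {0..b} (\<lambda>x. fc x * (E x *\<^sub>R v x)))
        - integral {0..b} (\<lambda>x. ((2 * W x) *\<^sub>R \<omega> x) * v1 x) - integral {0..b} (\<lambda>x. B' x * v x)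
        - integral {0..b} (\<lambda>x. A1 x * k x) + integral {0..b} (\<lambda>x. A2 x * k x)) {0..b}"
      unfolding hk
      by (intro has_integral_add has_integral_diff has_integral_neg integrable_integral i1 i2 j1 j2 j3 j4)
    then have "integral {0..b} (\<lambda>x. h x * k x) = (- integral {0..b} (\<lambda>x. uc x * ft x) + integral {0..b} (\<lambda>x. fc x * (E x *\<^sub>R v x)))
        - integral {0..b} (\<lambda>x. ((2 * W x) *\<^sub>R \<omega> x) * v1 x) - integral {0..b} (\<lambda>x. B' x * v x)
        - integral {0..b} (\<lambda>x. A1 x * k x) + integral {0..b} (\<lambda>x. A2 x * k x)"
      by (rule integral_unique)
    also have "\<dots> = 0"
      using weak p1 p2 p3 by (simp add: add_eq_0_iff)
    finally show "integral {0..b} (\<lambda>x. h x * k x) = 0" .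
  qed
  \<comment> \<open>\<open>\<Omega>\<close> is the absolutely continuous representative of
    \<open>\<omega>\<close>, read off from \<open>h\<close> being affine. Its derivative is
    \<open>2 W \<omega> + (\<beta> - B)\<close>, which identifies \<open>q\<close> as
    \<open>\<beta> - B\<close>.\<close>
  define \<Omega> where "\<Omega> = (\<lambda>x. (\<alpha> + x *\<^sub>R \<beta>) + A1 x - A2 x)"
  define q where "q = (\<lambda>x. \<beta> - B x)"
  define v where "v = (\<lambda>x. (inverse (E x))\<^sup>2 *\<^sub>R \<Omega> x)"
  have AE\<Omega>: "AE x in half_line. \<omega> x = \<Omega> x"
    using h by eventually_elim (simp add: h_def \<Omega>_def algebra_simps)
  have "ac (\<lambda>x. \<alpha> + x *\<^sub>R \<beta>) (\<lambda>x. \<beta>)"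
    by (rule ac_has_vector_derivative) (auto intro!: derivative_eq_intros continuous_intros)
  from ac_diff[OF ac_add[OF this ac_A1] ac_A2]
  have ac_\<Omega>: "ac \<Omega> (\<lambda>x. (2 * W x) *\<^sub>R \<Omega> x + q x)"
    unfolding \<Omega>_def[symmetric]
    by (rule ac_AE_cong) (use AE\<Omega> in \<open>eventually_elim; simp add: q_def\<close>)
  have ac_vv: "ac v (\<lambda>x. (inverse (E x))\<^sup>2 *\<^sub>R q x)"
  proof -
    have "ac (\<lambda>x. (inverse (E x))\<^sup>2) (\<lambda>x. - 2 * W x * (inverse (E x))\<^sup>2)"
      using ac_bilinear[OF bounded_bilinear_mult ac_inverse_E ac_inverse_E]
      by (rule ac_cong) (simp_all add: power2_eq_square)
    from ac_bilinear[OF bounded_bilinear_scaleR this ac_\<Omega>] show ?thesis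
      unfolding v_def by (rule ac_cong) (simp_all add: algebra_simps)
  qed
  have ac_q: "ac q (\<lambda>x. - (E x *\<^sub>R (fc x + (W x)\<^sup>2 *\<^sub>R E x *\<^sub>R v x)))"
  proof -
    have "ac q (\<lambda>x. 0 - B' x)" unfolding q_def by (rule ac_diff[OF ac_const ac_B])
    then show ?thesis
    proof (rule ac_AE_cong)
      show "AE x in half_line. - (E x *\<^sub>R (fc x + (W x)\<^sup>2 *\<^sub>R E x *\<^sub>R v x)) = 0 - B' x"
        using AE\<Omega>
      proof eventually_elim
        case (elim x)
        have "E x * ((W x)\<^sup>2 * (E x * (inverse (E x))\<^sup>2)) = (W x)\<^sup>2"
          by (simp add: power2_eq_square field_simps)
        then show ?case by (simp add: B'_def \<phi>_def v_def elim scaleR_add_right mult_ac)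
      qed
    qed
  qed
  have q_fc: "qsys v q fc" unfolding qsys_def using ac_vv ac_q by simp
  define vc where "vc x = cnj (v x)" for x
  define qc where "qc x = cnj (q x)" for x
  have qs: "qsys vc qc f"
    using qsys_cnj[OF q_fc] by (simp add: vc_def[abs_def] qc_def[abs_def] fc_def)
  have AEu: "AE x in half_line. E x *\<^sub>R vc x = u x"
    using AE\<Omega>
  proof eventually_elim
    case (elim x)
    have "E x *\<^sub>R v x = uc x"
      by (simp add: v_def elim[symmetric] \<omega>_def power2_eq_square field_simps)
    then have "cnj (E x *\<^sub>R v x) = u x" by (simp add: uc_def)
    then show ?case by (simp add: vc_def)
  qed
  have cont: "continuous_on {0..} (\<lambda>x. E x *\<^sub>R vc x)"
    by (rule ac_continuous_on_halfline[OF qsys_ac_u[OF qs]])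
  have sq: "square_integrable (\<lambda>x. E x *\<^sub>R vc x)"
    unfolding square_integrable_def
  proof
    show m: "(\<lambda>x. E x *\<^sub>R vc x) \<in> borel_measurable half_line"
      by (rule borel_measurable_half_line_continuous[OF cont])
    have "integrable half_line (\<lambda>x. (cmod (u x))\<^sup>2)" using u by (simp add: square_integrable_def)
    then show "integrable half_line (\<lambda>x. (cmod (E x *\<^sub>R vc x))\<^sup>2)"
    proof (rule integrable_cong_AE_imp)
      show "(\<lambda>x. (cmod (E x *\<^sub>R vc x))\<^sup>2) \<in> borel_measurable half_line" using m by measurable
      show "AE x in half_line. (cmod (u x))\<^sup>2 = (cmod (E x *\<^sub>R vc x))\<^sup>2"
        using AEu by eventually_elim simp
    qed
  qed
  have "U = abs_L2 (\<lambda>x. E x *\<^sub>R vc x)"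
    unfolding u(2) using AEu by (subst abs_L2_eq_iff[OF u(1) sq]) auto
  then show ?thesis
    unfolding represents_def using qs sq f by blast
qed

text \<open>\<open>H\<close> extends the preminimal operator and adjoints reverse inclusions, so
  \<open>H\<close>, being its own adjoint, lies in the adjoint of the preminimal operator.\<close>

lemma realization_represents:
  assumes H: "self_adjoint_realization V H" and UF: "(U, F) \<in> H"
  shows "\<exists>v q f. represents U F v q f"
proof (rule adjoint_preminimal_represents)
  have "preminimal_operator V \<subseteq> H"
    using H closure_subset unfolding self_adjoint_realization_def minimal_operator_def by blast
  moreover have "\<forall>(A, B)\<in>H. cinner_L2 U B = cinner_L2 F A"
    using self_adjointD(4)[of H U F] H UF unfolding self_adjoint_realization_def by blast
  ultimately show "(U, F) \<in> adjoint_operator (preminimal_operator V)"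
    unfolding adjoint_operator_def by blast
qed

section \<open>Energy estimates\<close>

text \<open>For complex numbers \<open>v x \<bullet> q x\<close> is
  \<open>Re (cnj (v x) * q x)\<close>. Thanks to the weights \<open>W\<close> enters only through
  its square, which has a sign and becomes small at infinity.\<close>

lemma qsys_energy:
  assumes "qsys v q f"
  shows "ac (\<lambda>x. v x \<bullet> q x) (\<lambda>x. (norm (inverse (E x) *\<^sub>R q x))\<^sup>2 - (E x *\<^sub>R v x) \<bullet> f x
    - (W x)\<^sup>2 * (norm (E x *\<^sub>R v x))\<^sup>2)"
proof -
  have "ac v (\<lambda>x. (inverse (E x))\<^sup>2 *\<^sub>R q x)" "ac q (\<lambda>x. - (E x *\<^sub>R (f x + (W x)\<^sup>2 *\<^sub>R E x *\<^sub>R v x)))"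
    using assms by (auto simp: qsys_def)
  from ac_bilinear[OF bounded_bilinear_inner this] show ?thesis
    by (rule ac_cong)
      (simp_all add: power2_norm_eq_inner[symmetric] inner_add_right power_mult_distrib power2_eq_square
        dot_square_norm[symmetric] abs_of_pos algebra_simps)
qed

lemma qsys_energy_identity:
  assumes qs: "qsys v q f" and u: "square_integrable (\<lambda>x. E x *\<^sub>R v x)" and f: "square_integrable f"
    and X: "0 \<le> X" "X \<le> Y"
  shows "(\<lambda>x. (norm (inverse (E x) *\<^sub>R q x))\<^sup>2) integrable_on {X..Y}"
    and "(\<lambda>x. (E x *\<^sub>R v x) \<bullet> f x + (W x)\<^sup>2 * (norm (E x *\<^sub>R v x))\<^sup>2) integrable_on {X..Y}"
    and "integral {X..Y} (\<lambda>x. (norm (inverse (E x) *\<^sub>R q x))\<^sup>2) =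
      v Y \<bullet> q Y - v X \<bullet> q X + integral {X..Y} (\<lambda>x. (E x *\<^sub>R v x) \<bullet> f x + (W x)\<^sup>2 * (norm (E x *\<^sub>R v x))\<^sup>2)"
proof -
  have q_cont: "continuous_on {0..} q"
    using qs ac_continuous_on_halfline by (auto simp: qsys_def)
  show i1: "(\<lambda>x. (norm (inverse (E x) *\<^sub>R q x))\<^sup>2) integrable_on {X..Y}"
    by (rule integrable_continuous_interval, rule continuous_on_subset[of "{0..}"])
      (intro continuous_intros q_cont inverse_E_cont, use X in auto)
  let ?d = "\<lambda>x. (norm (inverse (E x) *\<^sub>R q x))\<^sup>2 - (E x *\<^sub>R v x) \<bullet> f x - (W x)\<^sup>2 * (norm (E x *\<^sub>R v x))\<^sup>2"
  have id: "?d integrable_on {X..Y}" by (rule ac_integrable[OF qsys_energy[OF qs] X(1)])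
  have "(\<lambda>x. (norm (inverse (E x) *\<^sub>R q x))\<^sup>2 - ?d x) integrable_on {X..Y}"
    by (rule integrable_diff[OF i1 id])
  then show i2: "(\<lambda>x. (E x *\<^sub>R v x) \<bullet> f x + (W x)\<^sup>2 * (norm (E x *\<^sub>R v x))\<^sup>2) integrable_on {X..Y}"
    by (rule integrable_eq) simp
  have "integral {X..Y} ?d = integral {X..Y} (\<lambda>x. (norm (inverse (E x) *\<^sub>R q x))\<^sup>2 -
      ((E x *\<^sub>R v x) \<bullet> f x + (W x)\<^sup>2 * (norm (E x *\<^sub>R v x))\<^sup>2))"
    by (rule Henstock_Kurzweil_Integration.integral_cong) simp
  also have "\<dots> = integral {X..Y} (\<lambda>x. (norm (inverse (E x) *\<^sub>R q x))\<^sup>2) -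
      integral {X..Y} (\<lambda>x. (E x *\<^sub>R v x) \<bullet> f x + (W x)\<^sup>2 * (norm (E x *\<^sub>R v x))\<^sup>2)"
    by (rule Henstock_Kurzweil_Integration.integral_diff[OF i1 i2])
  finally show "integral {X..Y} (\<lambda>x. (norm (inverse (E x) *\<^sub>R q x))\<^sup>2) =
      v Y \<bullet> q Y - v X \<bullet> q X + integral {X..Y} (\<lambda>x. (E x *\<^sub>R v x) \<bullet> f x + (W x)\<^sup>2 * (norm (E x *\<^sub>R v x))\<^sup>2)"
    using ac_diff_integral[OF qsys_energy[OF qs] X] by simp
qed

text \<open>Since \<open>(\<bar>u\<bar>\<^sup>2)' = 2 W \<bar>u\<bar>\<^sup>2 + 2 Re (cnj v q)\<close>, a boundary term bounded away from zero would
  force \<open>\<bar>u\<bar>\<^sup>2\<close> to grow.\<close>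

lemma qsys_boundary_term_small:
  assumes qs: "qsys v q f" and u: "square_integrable (\<lambda>x. E x *\<^sub>R v x)" and e: "0 < e"
  shows "\<exists>X\<ge>X0. 0 \<le> X \<and> v X \<bullet> q X < e"
proof (rule ccontr)
  assume "\<not> (\<exists>X\<ge>X0. 0 \<le> X \<and> v X \<bullet> q X < e)"
  then have ge: "e \<le> v X \<bullet> q X" if "max 0 X0 \<le> X" for X using that by force
  define u where "u = (\<lambda>x. E x *\<^sub>R v x)"
  define N where "N = (norm (abs_L2 u))\<^sup>2"
  have sq: "square_integrable u" using u by (simp add: u_def)
  obtain M where M: "0 < M" "\<And>x. 0 \<le> x \<Longrightarrow> \<bar>W x\<bar> \<le> M" by (rule W_bounded) blast
  have ac_g: "ac (\<lambda>x. (cmod (u x))\<^sup>2) (\<lambda>x. 2 * W x * (cmod (u x))\<^sup>2 + 2 * (v x \<bullet> q x))"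
  proof -
    have A: "ac u (\<lambda>x. W x *\<^sub>R u x + inverse (E x) *\<^sub>R q x)"
      unfolding u_def using qsys_ac_u[OF qs] by simp
    have uq: "inverse (E x) * (u x \<bullet> q x) = v x \<bullet> q x" "inverse (E x) * (q x \<bullet> u x) = v x \<bullet> q x" for x
      by (simp_all add: u_def inner_commute)
    show ?thesis
      by (rule ac_cong[OF ac_bilinear[OF bounded_bilinear_inner A A]])
        (simp_all add: power2_norm_eq_inner inner_add_left inner_add_right uq)
  qed
  have i: "(\<lambda>x. (cmod (u x))\<^sup>2) integrable_on {a..b}" if "0 \<le> a" for a b
    using square_integrable_local[OF sq that] set_lebesgue_integral_eq_integral(1) by blast
  define X1 where "X1 = max 0 X0"
  have X1: "0 \<le> X1" by (simp add: X1_def)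
  have grow: "2 * e * (X - X1) - 2 * M * N \<le> (cmod (u X))\<^sup>2" if X: "X1 \<le> X" for X
  proof -
    have "integral {X1..X} (\<lambda>x. 2 * e - 2 * M * (cmod (u x))\<^sup>2)
        \<le> integral {X1..X} (\<lambda>x. 2 * W x * (cmod (u x))\<^sup>2 + 2 * (v x \<bullet> q x))"
    proof (rule integral_le)
      show "(\<lambda>x. 2 * e - 2 * M * (cmod (u x))\<^sup>2) integrable_on {X1..X}"
        by (intro integrable_diff integrable_on_mult_right i X1) auto
      show "(\<lambda>x. 2 * W x * (cmod (u x))\<^sup>2 + 2 * (v x \<bullet> q x)) integrable_on {X1..X}"
        by (rule ac_integrable[OF ac_g X1])
      fix x assume x: "x \<in> {X1..X}"
      have "- M \<le> W x" using M(2)[of x] x X1 by simp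
      then have "- M * (cmod (u x))\<^sup>2 \<le> W x * (cmod (u x))\<^sup>2" by (intro mult_right_mono) auto
      then show "2 * e - 2 * M * (cmod (u x))\<^sup>2 \<le> 2 * W x * (cmod (u x))\<^sup>2 + 2 * (v x \<bullet> q x)"
        using ge[of x] x by (simp add: X1_def)
    qed
    also have "\<dots> = (cmod (u X))\<^sup>2 - (cmod (u X1))\<^sup>2"
      using ac_diff_integral[OF ac_g X1 X] by simp
    finally have "integral {X1..X} (\<lambda>x. 2 * e - 2 * M * (cmod (u x))\<^sup>2) \<le> (cmod (u X))\<^sup>2"
      using zero_le_power2[of "cmod (u X1)"] by linarith
    moreover have "integral {X1..X} (\<lambda>x. 2 * e - 2 * M * (cmod (u x))\<^sup>2)
        = 2 * e * (X - X1) - 2 * M * integral {X1..X} (\<lambda>x. (cmod (u x))\<^sup>2)"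
      using X by (subst Henstock_Kurzweil_Integration.integral_diff)
        (auto intro!: integrable_on_mult_right i X1)
    moreover have "2 * M * integral {X1..X} (\<lambda>x. (cmod (u x))\<^sup>2) \<le> 2 * M * N"
      using M(1) square_integral_le_norm[OF sq X1, of X] by (intro mult_left_mono) (auto simp: N_def)
    ultimately show ?thesis by linarith
  qed
  \<comment> \<open>From \<open>X2\<close> on, the lower bound for
    \<open>(cmod (u x))\<^sup>2\<close> is at least 1; a stretch of length \<open>N + 1\<close> then
    exceeds the total mass \<open>N\<close>.\<close>
  define X2 where "X2 = X1 + (1 + 2 * M * N) / (2 * e)"
  have N: "0 \<le> N" by (simp add: N_def)
  have X2: "X1 \<le> X2" using M(1) N e by (simp add: X2_def)
  have one: "1 \<le> (cmod (u x))\<^sup>2" if "X2 \<le> x" for x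
  proof -
    have "1 = 2 * e * (X2 - X1) - 2 * M * N" using e by (simp add: X2_def)
    also have "\<dots> \<le> 2 * e * (x - X1) - 2 * M * N" using e that by simp
    also have "\<dots> \<le> (cmod (u x))\<^sup>2" using grow X2 that by simp
    finally show ?thesis .
  qed
  have "integral {X2..X2 + (N + 1)} (\<lambda>x. 1 :: real) \<le> integral {X2..X2 + (N + 1)} (\<lambda>x. (cmod (u x))\<^sup>2)"
    using X1 X2 one by (intro integral_le i) auto
  also have "\<dots> \<le> N"
    unfolding N_def using X1 X2 by (intro square_integral_le_norm sq) auto
  finally show False using N by simp
qed

text \<open>The boundary term in the energy identity is not controlled at a given \<open>X\<close>,
  but the integral grows with its upper limit, so \<open>X\<close> may be replaced by some
  \<open>Y \<ge> X\<close> at which that term is below 1.\<close>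

lemma qsys_derivative_bound:
  assumes qs: "qsys v q f" and u: "square_integrable (\<lambda>x. E x *\<^sub>R v x)" and f: "square_integrable f"
  obtains C where "\<And>X. 0 \<le> X \<Longrightarrow> integral {0..X} (\<lambda>x. (norm (inverse (E x) *\<^sub>R q x))\<^sup>2) \<le> C"
proof -
  let ?u = "\<lambda>x. E x *\<^sub>R v x" and ?p = "\<lambda>x. inverse (E x) *\<^sub>R q x"
  obtain M where M: "0 < M" "\<And>x. 0 \<le> x \<Longrightarrow> \<bar>W x\<bar> \<le> M" by (rule W_bounded) blast
  have i: "(\<lambda>x. (cmod (g x))\<^sup>2) integrable_on {0..b}" if "square_integrable g" for g b
    using square_integrable_local[OF that, of 0] set_lebesgue_integral_eq_integral(1) by blast
  define C where "C = 1 - v 0 \<bullet> q 0 + ((1 + M\<^sup>2) * (norm (abs_L2 ?u))\<^sup>2 + (norm (abs_L2 f))\<^sup>2)"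
  have "integral {0..X} (\<lambda>x. (norm (?p x))\<^sup>2) \<le> C" if X: "0 \<le> X" for X
  proof -
    obtain Y where Y: "X \<le> Y" "0 \<le> Y" "v Y \<bullet> q Y < 1"
      using qsys_boundary_term_small[OF qs u, of 1 X] by auto
    have "integral {0..X} (\<lambda>x. (norm (?p x))\<^sup>2) \<le> integral {0..Y} (\<lambda>x. (norm (?p x))\<^sup>2)"
      using Y X by (intro integral_subset_le qsys_energy_identity(1)[OF qs u f]) auto
    also have "\<dots> = v Y \<bullet> q Y - v 0 \<bullet> q 0 + integral {0..Y} (\<lambda>x. ?u x \<bullet> f x + (W x)\<^sup>2 * (norm (?u x))\<^sup>2)"
      using Y by (intro qsys_energy_identity(3)[OF qs u f]) auto
    also have "integral {0..Y} (\<lambda>x. ?u x \<bullet> f x + (W x)\<^sup>2 * (norm (?u x))\<^sup>2)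
        \<le> integral {0..Y} (\<lambda>x. (1 + M\<^sup>2) * (cmod (?u x))\<^sup>2 + (cmod (f x))\<^sup>2)"
    proof (rule integral_le)
      show "(\<lambda>x. ?u x \<bullet> f x + (W x)\<^sup>2 * (norm (?u x))\<^sup>2) integrable_on {0..Y}"
        using Y by (intro qsys_energy_identity(2)[OF qs u f]) auto
      show "(\<lambda>x. (1 + M\<^sup>2) * (cmod (?u x))\<^sup>2 + (cmod (f x))\<^sup>2) integrable_on {0..Y}"
        by (intro integrable_add integrable_on_mult_right i u f)
      fix x assume x: "x \<in> {0..Y}"
      have "?u x \<bullet> f x \<le> cmod (?u x) * cmod (f x)" by (rule norm_cauchy_schwarz)
      also have "\<dots> \<le> (cmod (?u x))\<^sup>2 + (cmod (f x))\<^sup>2"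
        using sum_squares_bound[of "cmod (?u x)" "cmod (f x)"] zero_le_power2[of "cmod (?u x)"] zero_le_power2[of "cmod (f x)"]
        by linarith
      finally have 1: "?u x \<bullet> f x \<le> (cmod (?u x))\<^sup>2 + (cmod (f x))\<^sup>2" .
      have "(W x)\<^sup>2 \<le> M\<^sup>2" using M(2)[of x] x by (simp add: abs_le_square_iff[symmetric])
      then have "(W x)\<^sup>2 * (cmod (?u x))\<^sup>2 \<le> M\<^sup>2 * (cmod (?u x))\<^sup>2" by (intro mult_right_mono) auto
      with 1 show "?u x \<bullet> f x + (W x)\<^sup>2 * (norm (?u x))\<^sup>2 \<le> (1 + M\<^sup>2) * (cmod (?u x))\<^sup>2 + (cmod (f x))\<^sup>2"
        unfolding distrib_right by linarith
    qed
    also have "\<dots> = (1 + M\<^sup>2) * integral {0..Y} (\<lambda>x. (cmod (?u x))\<^sup>2) + integral {0..Y} (\<lambda>x. (cmod (f x))\<^sup>2)"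
      using Henstock_Kurzweil_Integration.integral_add[OF integrable_on_mult_right[OF i[OF u], of "1 + M\<^sup>2"] i[OF f]]
      by simp
    also have "\<dots> \<le> (1 + M\<^sup>2) * (norm (abs_L2 ?u))\<^sup>2 + (norm (abs_L2 f))\<^sup>2"
      by (intro add_mono mult_left_mono square_integral_le_norm u f) auto
    finally show ?thesis using Y(3) unfolding C_def by linarith
  qed
  then show ?thesis by (rule that)
qed

text \<open>The initial values are recovered from \<open>v 0 + x q 0\<close> on \<open>[0, 1]\<close>, which differs from
  \<open>E u\<close> by integrals of \<open>u\<close> and \<open>f\<close>, by integration against linear polynomials.\<close>

lemma trace_bound:
  obtains C where "0 < C"
    "\<And>U F v q f. represents U F v q f \<Longrightarrow> cmod (v 0) + cmod (q 0) \<le> C * (norm U + norm F)"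
proof -
  obtain B1 where B1: "0 < B1" "\<And>x. 0 \<le> x \<Longrightarrow> x \<le> 1 \<Longrightarrow> \<bar>E x\<bar> \<le> B1"
    using continuous_on_halfline_bounded[OF E_cont, of 1] by blast
  obtain B2 where B2: "0 < B2" "\<And>x. 0 \<le> x \<Longrightarrow> x \<le> 1 \<Longrightarrow> \<bar>W x\<bar> \<le> B2"
    using continuous_on_halfline_bounded[OF W_cont, of 1] by blast
  \<comment> \<open>The summand 1 makes \<open>K \<ge> 1\<close>, so that lower powers of
    \<open>K\<close> are absorbed into \<open>K ^ 3\<close>.\<close>
  define K where "K = 1 + B1 + B2"
  have K1: "E x \<le> K \<and> \<bar>W x\<bar> \<le> K" if "0 \<le> x" "x \<le> 1" for x
    using B1(2)[OF that] B2(2)[OF that] B1(1) B2(1) unfolding K_def by linarith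
  have K: "1 \<le> K" "\<And>x. 0 \<le> x \<Longrightarrow> x \<le> 1 \<Longrightarrow> E x \<le> K" "\<And>x. 0 \<le> x \<Longrightarrow> x \<le> 1 \<Longrightarrow> \<bar>W x\<bar> \<le> K"
    using K1 B1(1) B2(1) by (simp_all add: K_def)
  have K0: "0 \<le> K" using K(1) by simp
  have K12: "1 \<le> K\<^sup>2" "K \<le> K ^ 3" "K\<^sup>2 \<le> K ^ 3"
    using K(1) power_increasing[of 1 3 K] power_increasing[of 2 3 K] by (auto simp: one_le_power)
  \<comment> \<open>The constant is \<open>4 * 4 + 6 * 4\<close>: the suprema 4 and 6 of the moduli
    of the two polynomials on \<open>[0, 1]\<close>, each times the 4 in
    \<open>moment\<close>.\<close>
  have "cmod (v 0) + cmod (q 0) \<le> (40 * K ^ 3) * (norm U + norm F)" if R: "represents U F v q f" for U F v q f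
  proof -
    define u where "u = (\<lambda>x. E x *\<^sub>R v x)"
    have qs: "qsys v q f" and u: "square_integrable u" "U = abs_L2 u" and f: "square_integrable f" "F = abs_L2 f"
      using R by (auto simp: represents_def u_def)
    define \<eta> where "\<eta> = norm U + norm F"
    have \<eta>: "0 \<le> \<eta>" "norm U \<le> \<eta>" by (simp_all add: \<eta>_def)
    have i_u: "(\<lambda>x. cmod (u x)) integrable_on {0..x}" and i_f: "(\<lambda>x. cmod (f x)) integrable_on {0..x}" for x
      using square_integrable_abs_integrable[OF u(1), of 0 x] square_integrable_abs_integrable[OF f(1), of 0 x]
      by (auto simp: absolutely_integrable_on_def)
    have I: "integral {0..x} (\<lambda>x. cmod (g x)) \<le> norm (abs_L2 g)" if "square_integrable g" "0 \<le> x" "x \<le> 1" for g x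
    proof -
      have "sqrt (x - 0) * norm (abs_L2 g) \<le> 1 * norm (abs_L2 g)"
        using that by (intro mult_right_mono) auto
      then show ?thesis using integral_cmod_le_norm[OF that(1), of 0 x] that by simp
    qed
    have q: "ac q (\<lambda>x. - (E x *\<^sub>R (f x + (W x)\<^sup>2 *\<^sub>R u x)))" using qs by (simp add: qsys_def u_def)
    have qd: "cmod (q x - q 0) \<le> K ^ 3 * \<eta>" if x: "0 \<le> x" "x \<le> 1" for x
    proof -
      have "cmod (q x - q 0) \<le> integral {0..x} (\<lambda>t. K * cmod (f t) + K ^ 3 * cmod (u t))"
        unfolding ac_diff_integral[OF q order_refl x(1)]
      proof (rule integral_norm_bound_integral)
        show "(\<lambda>x. - (E x *\<^sub>R (f x + (W x)\<^sup>2 *\<^sub>R u x))) integrable_on {0..x}" by (rule ac_integrable[OF q]) simp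
        show "(\<lambda>t. K * cmod (f t) + K ^ 3 * cmod (u t)) integrable_on {0..x}"
          by (intro integrable_add integrable_on_mult_right i_u i_f)
        fix t assume t: "t \<in> {0..x}"
        have W2: "(W t)\<^sup>2 \<le> K\<^sup>2" using K(3)[of t] t x K0 by (simp add: abs_le_square_iff[symmetric])
        have "cmod (f t + (W t)\<^sup>2 *\<^sub>R u t) \<le> cmod (f t) + (W t)\<^sup>2 * cmod (u t)"
          using norm_triangle_ineq[of "f t" "(W t)\<^sup>2 *\<^sub>R u t"] by simp
        also have "\<dots> \<le> cmod (f t) + K\<^sup>2 * cmod (u t)"
          using W2 by (intro add_left_mono mult_right_mono) auto
        finally have "E t * cmod (f t + (W t)\<^sup>2 *\<^sub>R u t) \<le> K * (cmod (f t) + K\<^sup>2 * cmod (u t))"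
          using K(2)[of t] t x K0 by (intro mult_mono) auto
        also have "\<dots> = K * cmod (f t) + K ^ 3 * cmod (u t)"
          by (simp add: power2_eq_square power3_eq_cube algebra_simps)
        finally show "norm (- (E t *\<^sub>R (f t + (W t)\<^sup>2 *\<^sub>R u t))) \<le> K * cmod (f t) + K ^ 3 * cmod (u t)"
          unfolding norm_minus_cancel norm_scaleR abs_of_pos[OF E_pos] .
      qed
      also have "\<dots> = K * integral {0..x} (\<lambda>t. cmod (f t)) + K ^ 3 * integral {0..x} (\<lambda>t. cmod (u t))"
        by (subst Henstock_Kurzweil_Integration.integral_add) (auto intro!: integrable_on_mult_right i_u i_f)
      also have "\<dots> \<le> K ^ 3 * norm F + K ^ 3 * norm U"
        using I[OF u(1) x] I[OF f(1) x] K12 K0 unfolding u(2) f(2)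
        by (intro add_mono mult_mono) (auto intro!: Henstock_Kurzweil_Integration.integral_nonneg i_f i_u)
      finally show ?thesis by (simp add: \<eta>_def algebra_simps)
    qed
    have ac_\<omega>: "ac (\<lambda>x. E x *\<^sub>R u x) (\<lambda>x. (2 * W x * E x) *\<^sub>R u x + q x)"
    proof -
      have "ac u (\<lambda>x. W x *\<^sub>R u x + inverse (E x) *\<^sub>R q x)"
        unfolding u_def using qsys_ac_u[OF qs] by simp
      from ac_bilinear[OF bounded_bilinear_scaleR ac_E this] show ?thesis
        by (rule ac_cong) (simp_all add: scaleR_conv_of_real algebra_simps)
    qed
    have "ac (\<lambda>x. v 0 + x *\<^sub>R q 0) (\<lambda>x. q 0)"
      by (rule ac_has_vector_derivative) (auto intro!: derivative_eq_intros continuous_intros)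
    from ac_diff[OF ac_\<omega> this]
    have ac_r: "ac (\<lambda>x. E x *\<^sub>R u x - (v 0 + x *\<^sub>R q 0)) (\<lambda>x. (2 * W x * E x) *\<^sub>R u x + (q x - q 0))"
      by (rule ac_cong) simp_all
    have lin: "cmod (v 0 + x *\<^sub>R q 0) \<le> K * cmod (u x) + 3 * K ^ 3 * \<eta>" if x: "0 \<le> x" "x \<le> 1" for x
    proof -
      have "cmod (E x *\<^sub>R u x - (v 0 + x *\<^sub>R q 0)) \<le> integral {0..x} (\<lambda>t. (2 * K\<^sup>2) * cmod (u t) + K ^ 3 * \<eta>)"
      proof -
        have "E x *\<^sub>R u x - (v 0 + x *\<^sub>R q 0) = integral {0..x} (\<lambda>x. (2 * W x * E x) *\<^sub>R u x + (q x - q 0))"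
          using ac_eq[OF ac_r x(1)] by (simp add: u_def)
        also have "cmod \<dots> \<le> integral {0..x} (\<lambda>t. (2 * K\<^sup>2) * cmod (u t) + K ^ 3 * \<eta>)"
        proof (rule integral_norm_bound_integral)
          show "(\<lambda>x. (2 * W x * E x) *\<^sub>R u x + (q x - q 0)) integrable_on {0..x}" by (rule ac_integrable[OF ac_r]) simp
          show "(\<lambda>t. (2 * K\<^sup>2) * cmod (u t) + K ^ 3 * \<eta>) integrable_on {0..x}"
            by (intro integrable_add integrable_on_mult_right i_u) auto
          fix t assume t: "t \<in> {0..x}"
          have "\<bar>W t\<bar> * E t \<le> K * K" using K(2,3)[of t] t x K0 by (intro mult_mono) (auto intro: less_imp_le)
          then have "2 * (\<bar>W t\<bar> * E t) * cmod (u t) \<le> 2 * K\<^sup>2 * cmod (u t)"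
            by (intro mult_right_mono) (auto simp: power2_eq_square)
          then have "cmod ((2 * W t * E t) *\<^sub>R u t) \<le> 2 * K\<^sup>2 * cmod (u t)"
            by (simp add: abs_mult abs_of_pos)
          then show "cmod ((2 * W t * E t) *\<^sub>R u t + (q t - q 0)) \<le> (2 * K\<^sup>2) * cmod (u t) + K ^ 3 * \<eta>"
            using norm_triangle_ineq[of "(2 * W t * E t) *\<^sub>R u t" "q t - q 0"] qd[of t] t x by auto
        qed
        finally show ?thesis .
      qed
      also have "\<dots> = (2 * K\<^sup>2) * integral {0..x} (\<lambda>t. cmod (u t)) + x * (K ^ 3 * \<eta>)"
        using x by (subst Henstock_Kurzweil_Integration.integral_add) (auto intro!: integrable_on_mult_right i_u)
      also have "\<dots> \<le> (2 * K ^ 3) * \<eta> + 1 * (K ^ 3 * \<eta>)"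
        using I[OF u(1) x] K12 K0 \<eta> x unfolding u(2)
        by (intro add_mono mult_mono) (auto intro!: Henstock_Kurzweil_Integration.integral_nonneg i_u)
      finally have 1: "cmod (E x *\<^sub>R u x - (v 0 + x *\<^sub>R q 0)) \<le> 3 * K ^ 3 * \<eta>" by (simp add: mult_ac)
      have 2: "cmod (E x *\<^sub>R u x) \<le> K * cmod (u x)"
        using K(2)[OF x] by (simp add: abs_of_pos mult_right_mono)
      have "cmod (v 0 + x *\<^sub>R q 0) \<le> cmod (E x *\<^sub>R u x) + cmod (E x *\<^sub>R u x - (v 0 + x *\<^sub>R q 0))"
        using norm_triangle_ineq4[of "E x *\<^sub>R u x" "E x *\<^sub>R u x - (v 0 + x *\<^sub>R q 0)"] by simp
      then show ?thesis using 1 2 by linarith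
    qed
    have moment: "cmod a \<le> c * (4 * K ^ 3 * \<eta>)"
      if p: "((\<lambda>x. p x *\<^sub>R (v 0 + x *\<^sub>R q 0)) has_integral a) {0..1}" and c: "0 \<le> c" "\<And>x. x \<in> {0..1} \<Longrightarrow> \<bar>p x\<bar> \<le> c" for a p c
    proof -
      have "cmod a \<le> integral {0..1} (\<lambda>x. c * (K * cmod (u x) + 3 * K ^ 3 * \<eta>))"
        unfolding integral_unique[OF p, symmetric]
      proof (rule integral_norm_bound_integral)
        show "(\<lambda>x. c * (K * cmod (u x) + 3 * K ^ 3 * \<eta>)) integrable_on {0..1}"
          by (intro integrable_add integrable_on_mult_right i_u) auto
        show "norm (p x *\<^sub>R (v 0 + x *\<^sub>R q 0)) \<le> c * (K * cmod (u x) + 3 * K ^ 3 * \<eta>)" if "x \<in> {0..1}" for x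
          using c lin[of x] that unfolding norm_scaleR by (intro mult_mono) auto
      qed (use p in blast)
      also have "\<dots> = c * (K * integral {0..1} (\<lambda>x. cmod (u x)) + 3 * K ^ 3 * \<eta>)"
        by (simp, subst Henstock_Kurzweil_Integration.integral_add) (auto intro!: integrable_on_mult_right i_u)
      also have "\<dots> \<le> c * (K ^ 3 * \<eta> + 3 * K ^ 3 * \<eta>)"
        using c(1) I[OF u(1), of 1] K12 K0 \<eta> unfolding u(2)
        by (intro mult_left_mono add_right_mono mult_mono)
          (auto intro!: Henstock_Kurzweil_Integration.integral_nonneg i_u)
      finally show ?thesis by (simp add: algebra_simps)
    qed
    \<comment> \<open>\<open>4 - 6 * x\<close> and \<open>12 * x - 6\<close> form the basis dual to
      \<open>1\<close> and \<open>x\<close> with respect to integration over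
      \<open>[0, 1]\<close>.\<close>
    have v0: "((\<lambda>x. (4 - 6 * x) *\<^sub>R (v 0 + x *\<^sub>R q 0)) has_integral v 0) {0..1}"
    proof -
      have "((\<lambda>x. (4 - 6 * x) *\<^sub>R (v 0 + x *\<^sub>R q 0)) has_integral
          (((4 * 1 - 3 * 1\<^sup>2) *\<^sub>R v 0 + (2 * 1\<^sup>2 - 2 * 1 ^ 3) *\<^sub>R q 0) - ((4 * 0 - 3 * 0\<^sup>2) *\<^sub>R v 0 + (2 * 0\<^sup>2 - 2 * 0 ^ 3) *\<^sub>R q 0))) {0..1}"
        by (rule fundamental_theorem_of_calculus)
          (auto intro!: derivative_eq_intros simp: algebra_simps power2_eq_square scaleR_left_distrib[symmetric])
      then show ?thesis by simp
    qed
    have q0: "((\<lambda>x. (12 * x - 6) *\<^sub>R (v 0 + x *\<^sub>R q 0)) has_integral q 0) {0..1}"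
    proof -
      have "((\<lambda>x. (12 * x - 6) *\<^sub>R (v 0 + x *\<^sub>R q 0)) has_integral
          (((6 * 1\<^sup>2 - 6 * 1) *\<^sub>R v 0 + (4 * 1 ^ 3 - 3 * 1\<^sup>2) *\<^sub>R q 0) - ((6 * 0\<^sup>2 - 6 * 0) *\<^sub>R v 0 + (4 * 0 ^ 3 - 3 * 0\<^sup>2) *\<^sub>R q 0))) {0..1}"
        by (rule fundamental_theorem_of_calculus)
          (auto intro!: derivative_eq_intros simp: algebra_simps power2_eq_square scaleR_left_distrib[symmetric])
      then show ?thesis by simp
    qed
    have "cmod (v 0) \<le> 4 * (4 * K ^ 3 * \<eta>)" by (rule moment[OF v0]) auto
    moreover have "cmod (q 0) \<le> 6 * (4 * K ^ 3 * \<eta>)" by (rule moment[OF q0]) auto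
    ultimately show ?thesis by (simp add: \<eta>_def)
  qed
  then show ?thesis using K(1) by (intro that[of "40 * K ^ 3"]) auto
qed

text \<open>Gronwall's inequality controls \<open>v\<close> and \<open>q\<close> on \<open>[0, R]\<close>, and beyond \<open>R\<close> the energy
  identity does, because \<open>W\<^sup>2\<close> is there small compared to \<open>m = - \<lambda>\<close>.\<close>

lemma apriori_bound:
  assumes m: "0 < m"
  obtains C where "0 < C" "\<And>U F v q f. represents U F v q f \<Longrightarrow>
    norm U \<le> C * (cmod (v 0) + cmod (q 0) + norm (F - scaleC_L2 (- complex_of_real m) U))"
proof -
  \<comment> \<open>With this choice \<open>W\<^sup>2 \<le> m / 4\<close> beyond \<open>R\<close>;
    Young's inequality costs another \<open>m / 4\<close>, and \<open>m / 2\<close> survives in the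
    tail estimate.\<close>
  obtain R where R: "0 \<le> R" "\<And>x. R \<le> x \<Longrightarrow> \<bar>W x\<bar> \<le> sqrt m / 2"
    using W_eventually_le[of "sqrt m / 2"] m by auto
  have W2: "(W x)\<^sup>2 \<le> m / 4" if "R \<le> x" for x
  proof -
    have "(W x)\<^sup>2 \<le> (sqrt m / 2)\<^sup>2"
      using R(2)[OF that] m by (subst abs_le_square_iff[symmetric]) auto
    then show ?thesis using m by (simp add: power_divide)
  qed
  obtain B1 where B1: "0 < B1" "\<And>x. 0 \<le> x \<Longrightarrow> x \<le> R \<Longrightarrow> \<bar>E x\<bar> \<le> B1"
    using continuous_on_halfline_bounded[OF E_cont, of R] by blast
  obtain B2 where B2: "0 < B2" "\<And>x. 0 \<le> x \<Longrightarrow> x \<le> R \<Longrightarrow> \<bar>W x\<bar> \<le> B2"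
    using continuous_on_halfline_bounded[OF W_cont, of R] by blast
  obtain B3 where B3: "0 < B3" "\<And>x. 0 \<le> x \<Longrightarrow> x \<le> R \<Longrightarrow> \<bar>inverse (E x)\<bar> \<le> B3"
    using continuous_on_halfline_bounded[OF inverse_E_cont, of R] by blast
  define K where "K = 1 + B1 + B2 + B3"
  have K1: "E x \<le> K \<and> \<bar>W x\<bar> \<le> K \<and> inverse (E x) \<le> K" if "0 \<le> x" "x \<le> R" for x
    using B1(2)[OF that] B2(2)[OF that] B3(2)[OF that] B1(1) B2(1) B3(1) unfolding K_def by linarith
  have K: "1 \<le> K" "\<And>x. 0 \<le> x \<Longrightarrow> x \<le> R \<Longrightarrow> E x \<le> K" "\<And>x. 0 \<le> x \<Longrightarrow> x \<le> R \<Longrightarrow> \<bar>W x\<bar> \<le> K"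
    "\<And>x. 0 \<le> x \<Longrightarrow> x \<le> R \<Longrightarrow> inverse (E x) \<le> K"
    using K1 B1(1) B2(1) B3(1) by (simp_all add: K_def)
  have K0: "0 \<le> K" using K(1) by simp
  \<comment> \<open>\<open>L\<close> is the Gronwall rate on \<open>[0, R]\<close> and
    \<open>D\<close> the resulting bound for \<open>v\<close> and \<open>q\<close> there. In
    \<open>C2\<close> the first term is the mass on \<open>[0, R]\<close>, the second that of the
    tail after division by \<open>m / 2\<close>.\<close>
  define L where "L = K\<^sup>2 + m * K\<^sup>2 + K ^ 4"
  define D where "D = (1 + K * sqrt R) * exp (L * R)"
  define C2 where "C2 = R * (K * D)\<^sup>2 + 2 / m * (D\<^sup>2 + 1 / m)"
  have L: "0 \<le> L" using m by (simp add: L_def)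
  have D0: "0 \<le> D" using K0 R(1) by (simp add: D_def)
  have C2: "0 < C2" unfolding C2_def using m R(1) by (intro add_nonneg_pos mult_pos_pos) auto
  have "norm U \<le> sqrt C2 * (cmod (v 0) + cmod (q 0) + norm (F - scaleC_L2 (- complex_of_real m) U))"
    if rep: "represents U F v q f" for U F v q f
  proof -
    define u where "u = (\<lambda>x. E x *\<^sub>R v x)"
    have qs: "qsys v q f" and u: "square_integrable u" "U = abs_L2 u" and f: "square_integrable f" "F = abs_L2 f"
      using rep by (auto simp: represents_def u_def)
    have u': "square_integrable (\<lambda>x. E x *\<^sub>R v x)" using u(1) by (simp add: u_def)
    \<comment> \<open>The residual \<open>f - \<lambda> u\<close> at
      \<open>\<lambda> = - m\<close>.\<close>
    define g where "g = (\<lambda>x. f x + m *\<^sub>R u x)"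
    have g: "square_integrable g" "F - scaleC_L2 (- complex_of_real m) U = abs_L2 g"
    proof -
      have "g = (\<lambda>x. f x - (- complex_of_real m) * u x)" by (simp add: g_def scaleR_conv_of_real)
      then show "square_integrable g" "F - scaleC_L2 (- complex_of_real m) U = abs_L2 g"
        unfolding u(2) f(2)
        by (simp_all only: scaleC_abs_L2[OF u(1)] minus_abs_L2[OF f(1) square_integrable_scale[OF u(1)]]
            square_integrable_diff[OF f(1) square_integrable_scale[OF u(1)]])
    qed
    define \<gamma> where "\<gamma> = norm (abs_L2 g)"
    define s where "s = cmod (v 0) + cmod (q 0) + \<gamma>"
    have s: "0 \<le> s" "\<gamma> \<le> s" "cmod (v 0) + cmod (q 0) \<le> s" "0 \<le> \<gamma>" by (simp_all add: s_def \<gamma>_def)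
    have v: "ac v (\<lambda>x. (inverse (E x))\<^sup>2 *\<^sub>R q x)" and q: "ac q (\<lambda>x. - (E x *\<^sub>R (f x + (W x)\<^sup>2 *\<^sub>R u x)))"
      using qs by (simp_all add: qsys_def u_def)
    define \<phi> where "\<phi> = (\<lambda>x. cmod (v x) + cmod (q x))"
    have \<phi>_cont: "continuous_on {0..b} \<phi>" for b
      unfolding \<phi>_def by (intro continuous_intros ac_continuous_on[OF v] ac_continuous_on[OF q])
    have i_g: "(\<lambda>x. cmod (g x)) integrable_on {0..x}" for x
      using square_integrable_abs_integrable[OF g(1), of 0 x] by (auto simp: absolutely_integrable_on_def)
    have i_v: "(\<lambda>x. cmod (v x)) integrable_on {0..x}" and i_q: "(\<lambda>x. cmod (q x)) integrable_on {0..x}" for x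
      by (intro integrable_continuous_interval continuous_intros ac_continuous_on[OF v] ac_continuous_on[OF q])+
    have i_\<phi>: "\<phi> integrable_on {0..x}" for x by (rule integrable_continuous_interval[OF \<phi>_cont])
    have \<phi>_le: "\<phi> x \<le> (1 + K * sqrt R) * s + L * integral {0..x} \<phi>" if x: "0 \<le> x" "x \<le> R" for x
    proof -
      have 1: "cmod (v x - v 0) \<le> integral {0..x} (\<lambda>t. K\<^sup>2 * cmod (q t))"
        unfolding ac_diff_integral[OF v order_refl x(1)]
      proof (rule integral_norm_bound_integral)
        show "(\<lambda>x. (inverse (E x))\<^sup>2 *\<^sub>R q x) integrable_on {0..x}" by (rule ac_integrable[OF v]) simp
        show "(\<lambda>t. K\<^sup>2 * cmod (q t)) integrable_on {0..x}" by (intro integrable_on_mult_right i_q)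
        show "cmod ((inverse (E t))\<^sup>2 *\<^sub>R q t) \<le> K\<^sup>2 * cmod (q t)" if "t \<in> {0..x}" for t
        proof -
          have "(inverse (E t))\<^sup>2 \<le> K\<^sup>2" using K(4)[of t] that x by (intro power_mono) (auto intro: less_imp_le)
          then show ?thesis by (simp add: mult_right_mono)
        qed
      qed
      have 2: "cmod (q x - q 0) \<le> integral {0..x} (\<lambda>t. K * cmod (g t) + (m * K\<^sup>2 + K ^ 4) * cmod (v t))"
        unfolding ac_diff_integral[OF q order_refl x(1)]
      proof (rule integral_norm_bound_integral)
        show "(\<lambda>x. - (E x *\<^sub>R (f x + (W x)\<^sup>2 *\<^sub>R u x))) integrable_on {0..x}" by (rule ac_integrable[OF q]) simp
        show "(\<lambda>t. K * cmod (g t) + (m * K\<^sup>2 + K ^ 4) * cmod (v t)) integrable_on {0..x}"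
          by (intro integrable_add integrable_on_mult_right i_g i_v)
        fix t assume t: "t \<in> {0..x}"
        have W2: "(W t)\<^sup>2 \<le> K\<^sup>2" using K(3)[of t] t x K0 by (simp add: abs_le_square_iff[symmetric])
        have ut: "cmod (u t) \<le> K * cmod (v t)"
          using K(2)[of t] t x by (simp add: u_def abs_of_pos mult_right_mono)
        have "f t + (W t)\<^sup>2 *\<^sub>R u t = g t + ((W t)\<^sup>2 - m) *\<^sub>R u t" by (simp add: g_def scaleR_diff_left)
        then have "cmod (f t + (W t)\<^sup>2 *\<^sub>R u t) \<le> cmod (g t) + \<bar>(W t)\<^sup>2 - m\<bar> * cmod (u t)"
          using norm_triangle_ineq[of "g t" "((W t)\<^sup>2 - m) *\<^sub>R u t"] by simp
        also have "\<dots> \<le> cmod (g t) + (m + K\<^sup>2) * (K * cmod (v t))"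
          using W2 m ut by (intro add_left_mono mult_mono) (auto simp: abs_le_iff intro: order_trans[of _ 0])
        finally have "E t * cmod (f t + (W t)\<^sup>2 *\<^sub>R u t) \<le> K * (cmod (g t) + (m + K\<^sup>2) * (K * cmod (v t)))"
          using K(2)[of t] t x K0 by (intro mult_mono) auto
        also have "\<dots> = K * cmod (g t) + (m * K\<^sup>2 + K ^ 4) * cmod (v t)"
          by (simp add: power2_eq_square power4_eq_xxxx algebra_simps)
        finally show "norm (- (E t *\<^sub>R (f t + (W t)\<^sup>2 *\<^sub>R u t))) \<le> K * cmod (g t) + (m * K\<^sup>2 + K ^ 4) * cmod (v t)"
          unfolding norm_minus_cancel norm_scaleR abs_of_pos[OF E_pos] .
      qed
      have "\<phi> x \<le> \<phi> 0 + cmod (v x - v 0) + cmod (q x - q 0)"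
        using norm_triangle_sub[of "v x" "v 0"] norm_triangle_sub[of "q x" "q 0"] by (simp add: \<phi>_def)
      also have "\<dots> \<le> \<phi> 0 + integral {0..x} (\<lambda>t. K\<^sup>2 * cmod (q t))
          + integral {0..x} (\<lambda>t. K * cmod (g t) + (m * K\<^sup>2 + K ^ 4) * cmod (v t))"
        using 1 2 by simp
      also have "\<dots> = \<phi> 0 + integral {0..x} (\<lambda>t. K\<^sup>2 * cmod (q t) + (K * cmod (g t) + (m * K\<^sup>2 + K ^ 4) * cmod (v t)))"
        using Henstock_Kurzweil_Integration.integral_add[OF integrable_on_mult_right[OF i_q, of "K\<^sup>2"]
            integrable_add[OF integrable_on_mult_right[OF i_g, of K] integrable_on_mult_right[OF i_v, of "m * K\<^sup>2 + K ^ 4"]]]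
        by simp
      also have "\<dots> \<le> \<phi> 0 + integral {0..x} (\<lambda>t. K * cmod (g t) + L * \<phi> t)"
      proof (intro add_left_mono integral_le)
        show "(\<lambda>t. K\<^sup>2 * cmod (q t) + (K * cmod (g t) + (m * K\<^sup>2 + K ^ 4) * cmod (v t))) integrable_on {0..x}"
          "(\<lambda>t. K * cmod (g t) + L * \<phi> t) integrable_on {0..x}"
          by (intro integrable_add integrable_on_mult_right i_g i_v i_q i_\<phi>)+
        fix t
        have "K\<^sup>2 * cmod (q t) \<le> L * cmod (q t)" "(m * K\<^sup>2 + K ^ 4) * cmod (v t) \<le> L * cmod (v t)"
          using m by (intro mult_right_mono; simp add: L_def)+
        then show "K\<^sup>2 * cmod (q t) + (K * cmod (g t) + (m * K\<^sup>2 + K ^ 4) * cmod (v t)) \<le> K * cmod (g t) + L * \<phi> t"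
          unfolding \<phi>_def distrib_left by linarith
      qed
      also have "\<dots> = \<phi> 0 + (K * integral {0..x} (\<lambda>t. cmod (g t)) + L * integral {0..x} \<phi>)"
        using Henstock_Kurzweil_Integration.integral_add[OF integrable_on_mult_right[OF i_g, of K] integrable_on_mult_right[OF i_\<phi>, of L]]
        by simp
      also have "K * integral {0..x} (\<lambda>t. cmod (g t)) \<le> K * (sqrt R * s)"
      proof (rule mult_left_mono[OF _ K0])
        have "integral {0..x} (\<lambda>t. cmod (g t)) \<le> sqrt (x - 0) * \<gamma>"
          unfolding \<gamma>_def by (rule integral_cmod_le_norm[OF g(1)]) (use x in auto)
        also have "\<dots> \<le> sqrt R * s" using x s by (intro mult_mono) auto
        finally show "integral {0..x} (\<lambda>t. cmod (g t)) \<le> sqrt R * s" .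
      qed
      finally show ?thesis using s(3) by (simp add: \<phi>_def algebra_simps)
    qed
    have \<phi>_bound: "\<phi> x \<le> D * s" if x: "0 \<le> x" "x \<le> R" for x
    proof -
      have "\<phi> x \<le> ((1 + K * sqrt R) * s) * exp (L * x)"
        by (rule gronwall[OF \<phi>_cont L \<phi>_le x])
      also have "\<dots> \<le> ((1 + K * sqrt R) * s) * exp (L * R)"
        using x K0 R(1) s(1) L by (intro mult_left_mono) (auto intro!: mult_left_mono)
      finally show ?thesis by (simp add: D_def mult_ac)
    qed
    have Ds: "0 \<le> D * s" using D0 s by simp
    have uR: "(cmod (u x))\<^sup>2 \<le> (K * D)\<^sup>2 * s\<^sup>2" if x: "0 \<le> x" "x \<le> R" for x
    proof -
      have "cmod (u x) = E x * cmod (v x)" by (simp add: u_def abs_of_pos)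
      also have "\<dots> \<le> K * (D * s)"
      proof (rule mult_mono)
        have "cmod (v x) \<le> \<phi> x" by (simp add: \<phi>_def)
        then show "cmod (v x) \<le> D * s" using \<phi>_bound[OF x] by linarith
      qed (use K(2)[OF x] K0 in auto)
      finally have "(cmod (u x))\<^sup>2 \<le> (K * (D * s))\<^sup>2" by (intro power_mono) auto
      then show ?thesis by (simp add: power_mult_distrib)
    qed
    have i_u2: "(\<lambda>x. (cmod (u x))\<^sup>2) integrable_on {a..b}" and i_g2: "(\<lambda>x. (cmod (g x))\<^sup>2) integrable_on {a..b}" if "0 \<le> a" for a b
      using square_integrable_local[OF u(1) that] square_integrable_local[OF g(1) that] set_lebesgue_integral_eq_integral(1) by blast+
    have local: "integral {0..R} (\<lambda>x. (cmod (u x))\<^sup>2) \<le> R * ((K * D)\<^sup>2 * s\<^sup>2)"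
    proof -
      have "integral {0..R} (\<lambda>x. (cmod (u x))\<^sup>2) \<le> integral {0..R} (\<lambda>x. (K * D)\<^sup>2 * s\<^sup>2)"
        by (intro integral_le i_u2) (use uR in auto)
      then show ?thesis using R(1) by (simp add: mult_ac)
    qed
    have tail: "m / 2 * integral {R..Y} (\<lambda>x. (cmod (u x))\<^sup>2) \<le> v Y \<bullet> q Y + (D\<^sup>2 + 1 / m) * s\<^sup>2" if Y: "R \<le> Y" for Y
    proof -
      have vq: "- (v R \<bullet> q R) \<le> D\<^sup>2 * s\<^sup>2"
      proof -
        have "\<bar>v R \<bullet> q R\<bar> \<le> cmod (v R) * cmod (q R)" by (rule Cauchy_Schwarz_ineq2)
        also have "\<dots> \<le> \<phi> R * \<phi> R" by (intro mult_mono) (auto simp: \<phi>_def)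
        also have "\<dots> \<le> (D * s) * (D * s)"
          using \<phi>_bound[OF R(1) order_refl] Ds by (intro mult_mono) (auto simp: \<phi>_def)
        finally show ?thesis by (simp add: power2_eq_square mult_ac)
      qed
      \<comment> \<open>The mass of \<open>q / E\<close> is dropped as nonnegative; what remains
        bounds the mass of \<open>u\<close> by the boundary terms and \<open>g\<close>.\<close>
      have "0 \<le> integral {R..Y} (\<lambda>x. (norm (inverse (E x) *\<^sub>R q x))\<^sup>2)"
        by (rule Henstock_Kurzweil_Integration.integral_nonneg[OF qsys_energy_identity(1)[OF qs u' f(1) R(1) Y]]) simp
      also have "\<dots> = v Y \<bullet> q Y - v R \<bullet> q R + integral {R..Y} (\<lambda>x. (E x *\<^sub>R v x) \<bullet> f x + (W x)\<^sup>2 * (norm (E x *\<^sub>R v x))\<^sup>2)"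
        by (rule qsys_energy_identity(3)[OF qs u' f(1) R(1) Y])
      also have "integral {R..Y} (\<lambda>x. (E x *\<^sub>R v x) \<bullet> f x + (W x)\<^sup>2 * (norm (E x *\<^sub>R v x))\<^sup>2)
          \<le> integral {R..Y} (\<lambda>x. (1 / m) * (cmod (g x))\<^sup>2 - (m / 2) * (cmod (u x))\<^sup>2)"
      proof (rule integral_le)
        show "(\<lambda>x. (E x *\<^sub>R v x) \<bullet> f x + (W x)\<^sup>2 * (norm (E x *\<^sub>R v x))\<^sup>2) integrable_on {R..Y}"
          by (rule qsys_energy_identity(2)[OF qs u' f(1) R(1) Y])
        show "(\<lambda>x. (1 / m) * (cmod (g x))\<^sup>2 - (m / 2) * (cmod (u x))\<^sup>2) integrable_on {R..Y}"
          by (intro integrable_diff integrable_on_mult_right i_u2 i_g2 R)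
        fix x assume x: "x \<in> {R..Y}"
        have "f x = g x - m *\<^sub>R u x" by (simp add: g_def)
        then have "u x \<bullet> f x = u x \<bullet> g x - m * (cmod (u x))\<^sup>2"
          by (simp add: inner_diff_right power2_norm_eq_inner)
        moreover have "u x \<bullet> g x \<le> cmod (u x) * cmod (g x)" by (rule norm_cauchy_schwarz)
        moreover have "cmod (u x) * cmod (g x) \<le> m / 4 * (cmod (u x))\<^sup>2 + (1 / m) * (cmod (g x))\<^sup>2"
        proof -
          have "0 \<le> (m / 2 * cmod (u x) - cmod (g x))\<^sup>2 / m" using m by simp
          also have "\<dots> = m / 4 * (cmod (u x))\<^sup>2 + (1 / m) * (cmod (g x))\<^sup>2 - cmod (u x) * cmod (g x)"
            using m by (simp add: power2_eq_square field_simps)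
          finally show ?thesis by simp
        qed
        moreover have "(W x)\<^sup>2 * (cmod (u x))\<^sup>2 \<le> m / 4 * (cmod (u x))\<^sup>2"
          using W2[of x] x by (intro mult_right_mono) auto
        ultimately have "u x \<bullet> f x + (W x)\<^sup>2 * (cmod (u x))\<^sup>2 \<le> (1 / m) * (cmod (g x))\<^sup>2 - (m / 2) * (cmod (u x))\<^sup>2"
          by linarith
        then show "(E x *\<^sub>R v x) \<bullet> f x + (W x)\<^sup>2 * (norm (E x *\<^sub>R v x))\<^sup>2 \<le> (1 / m) * (cmod (g x))\<^sup>2 - (m / 2) * (cmod (u x))\<^sup>2"
          unfolding u_def .
      qed
      also have "\<dots> = (1 / m) * integral {R..Y} (\<lambda>x. (cmod (g x))\<^sup>2) - (m / 2) * integral {R..Y} (\<lambda>x. (cmod (u x))\<^sup>2)"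
        unfolding Henstock_Kurzweil_Integration.integral_diff[OF integrable_on_mult_right[OF i_g2[OF R(1)]] integrable_on_mult_right[OF i_u2[OF R(1)]]]
          Henstock_Kurzweil_Integration.integral_mult_right ..
      finally have "m / 2 * integral {R..Y} (\<lambda>x. (cmod (u x))\<^sup>2)
          \<le> v Y \<bullet> q Y - v R \<bullet> q R + (1 / m) * integral {R..Y} (\<lambda>x. (cmod (g x))\<^sup>2)"
        by linarith
      moreover have "(1 / m) * integral {R..Y} (\<lambda>x. (cmod (g x))\<^sup>2) \<le> (1 / m) * s\<^sup>2"
      proof -
        have "integral {R..Y} (\<lambda>x. (cmod (g x))\<^sup>2) \<le> \<gamma>\<^sup>2"
          unfolding \<gamma>_def by (rule square_integral_le_norm[OF g(1) R(1)])
        also have "\<dots> \<le> s\<^sup>2" using s by (intro power_mono) auto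
        finally show ?thesis using m by (intro mult_left_mono) auto
      qed
      ultimately show ?thesis using vq unfolding distrib_right by linarith
    qed
    \<comment> \<open>The boundary term is only known to be small at some points arbitrarily far
      out, so an arbitrary \<open>e\<close> is carried along and removed at the end.\<close>
    have "(norm U)\<^sup>2 \<le> C2 * s\<^sup>2 + e" if e: "0 < e" for e
      unfolding u(2)
    proof (rule norm_abs_L2_le[OF u(1)])
      fix b :: real assume "0 \<le> b"
      obtain Y where Y: "max b R \<le> Y" "v Y \<bullet> q Y < m / 2 * e"
        using qsys_boundary_term_small[OF qs u', of "m / 2 * e" "max b R"] e m by auto
      have "integral {0..b} (\<lambda>x. (cmod (u x))\<^sup>2) \<le> integral {0..Y} (\<lambda>x. (cmod (u x))\<^sup>2)"
        using Y by (intro integral_subset_le i_u2) auto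
      also have "\<dots> = integral {0..R} (\<lambda>x. (cmod (u x))\<^sup>2) + integral {R..Y} (\<lambda>x. (cmod (u x))\<^sup>2)"
        using Y R(1) i_u2 by (intro Henstock_Kurzweil_Integration.integral_combine[symmetric]) auto
      also have "integral {R..Y} (\<lambda>x. (cmod (u x))\<^sup>2) \<le> e + 2 / m * ((D\<^sup>2 + 1 / m) * s\<^sup>2)"
      proof -
        have "m / 2 * integral {R..Y} (\<lambda>x. (cmod (u x))\<^sup>2) \<le> m / 2 * e + (D\<^sup>2 + 1 / m) * s\<^sup>2"
          using tail[of Y] Y by linarith
        also have "\<dots> = m / 2 * (e + 2 / m * ((D\<^sup>2 + 1 / m) * s\<^sup>2))"
          unfolding distrib_left using m by simp
        finally show ?thesis using m by (simp only: mult_le_cancel_left_pos half_gt_zero)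
      qed
      finally show "integral {0..b} (\<lambda>x. (cmod (u x))\<^sup>2) \<le> C2 * s\<^sup>2 + e"
        using local by (simp add: C2_def algebra_simps)
    qed
    then have "(norm U)\<^sup>2 \<le> C2 * s\<^sup>2" by (rule field_le_epsilon)
    also have "\<dots> = (sqrt C2 * s)\<^sup>2" using C2 by (simp add: power_mult_distrib)
    finally have "norm U \<le> sqrt C2 * s"
      by (rule power2_le_imp_le) (use C2 s in simp)
    then show ?thesis unfolding g(2) by (simp add: s_def \<gamma>_def)
  qed
  then show ?thesis using C2 by (intro that[of "sqrt C2"]) auto
qed

section \<open>Limit point property and Weyl sequences\<close>

text \<open>The system for the pair \<open>(v, q)\<close> has continuous coefficients even where
  \<open>V\<close> is discontinuous, so \<open>linear_ode_solution\<close> applies and prescribes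
  both initial values.\<close>

lemma eigen_solution:
  obtains v q where "v 0 = a" "q 0 = b" "qsys v q (\<lambda>x. z * (E x *\<^sub>R v x))"
proof -
  define A where "A t y = ((inverse (E t))\<^sup>2 *\<^sub>R snd y, - ((E t)\<^sup>2 *\<^sub>R ((z + of_real ((W t)\<^sup>2)) * fst y)))"
    for t and y :: "complex \<times> complex"
  define k where "k t = (inverse (E t))\<^sup>2 + (E t)\<^sup>2 * (cmod z + (W t)\<^sup>2)" for t
  have "\<exists>Y. Y 0 = (a, b) \<and> ac Y (\<lambda>t. A t (Y t))"
  proof (rule linear_ode_solution)
    show "A t (x - y) = A t x - A t y" for t x y
      by (simp add: A_def algebra_simps)
    show "norm (A t y) \<le> k t * norm y" for t y
    proof -
      have "norm (A t y) \<le> (inverse (E t))\<^sup>2 * norm (snd y) + (E t)\<^sup>2 * (cmod (z + of_real ((W t)\<^sup>2)) * norm (fst y))"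
        unfolding A_def using norm_Pair_le by (rule order_trans) (simp add: norm_mult)
      also have "\<dots> \<le> (inverse (E t))\<^sup>2 * norm y + (E t)\<^sup>2 * ((cmod z + (W t)\<^sup>2) * norm y)"
      proof (intro add_mono mult_left_mono mult_mono)
        show "cmod (z + of_real ((W t)\<^sup>2)) \<le> cmod z + (W t)\<^sup>2"
          using norm_triangle_ineq[of z "of_real ((W t)\<^sup>2)"] unfolding norm_of_real by simp
        show "norm (snd y) \<le> norm y" by (metis norm_snd_le surjective_pairing)
        show "norm (fst y) \<le> norm y" by (metis norm_fst_le surjective_pairing)
      qed auto
      finally show ?thesis by (simp add: k_def algebra_simps)
    qed
    show "continuous_on {0..} (\<lambda>t. A t (y t))" if "continuous_on {0..} y" for y
      unfolding A_def by (intro continuous_intros that inverse_E_cont E_cont W_cont)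
    show "continuous_on {0..} k"
      unfolding k_def by (intro continuous_intros inverse_E_cont E_cont W_cont)
    show "0 \<le> k t" for t by (simp add: k_def)
  qed
  then obtain Y where Y: "Y 0 = (a, b)" "ac Y (\<lambda>t. A t (Y t))" by blast
  show ?thesis
  proof (rule that[of "\<lambda>x. fst (Y x)" "\<lambda>x. snd (Y x)"])
    show "qsys (\<lambda>x. fst (Y x)) (\<lambda>x. snd (Y x)) (\<lambda>x. z * (E x *\<^sub>R fst (Y x)))"
      unfolding qsys_def
    proof
      show "ac (\<lambda>x. fst (Y x)) (\<lambda>x. (inverse (E x))\<^sup>2 *\<^sub>R snd (Y x))"
        using ac_linear[OF Y(2) bounded_linear_fst] by (simp add: A_def)
      show "ac (\<lambda>x. snd (Y x)) (\<lambda>x. - (E x *\<^sub>R (z * (E x *\<^sub>R fst (Y x)) + (W x)\<^sup>2 *\<^sub>R E x *\<^sub>R fst (Y x))))"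
        by (rule ac_cong[OF ac_linear[OF Y(2) bounded_linear_snd]])
          (simp_all add: A_def scaleR_conv_of_real power2_eq_square algebra_simps)
    qed
  qed (simp_all add: Y)
qed

text \<open>If all solutions were square-integrable, then so would be their quasi-derivatives \<open>q / E\<close>, which
  contradicts the constancy of the Wronskian of two solutions.\<close>

lemma limit_point: "limit_point_at_infinity V"
  unfolding limit_point_at_infinity_def limit_circle_at_infinity_def
proof
  assume "\<exists>z. \<forall>u. schroedinger V u (\<lambda>x. z * u x) \<longrightarrow>
    (\<exists>c\<ge>0. set_integrable lebesgue {c..} (\<lambda>x. (cmod (u x))\<^sup>2))"
  then obtain z where z: "\<And>u. schroedinger V u (\<lambda>x. z * u x) \<Longrightarrow>
    \<exists>c\<ge>0. set_integrable lebesgue {c..} (\<lambda>x. (cmod (u x))\<^sup>2)" by blast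
  have sq: "square_integrable (\<lambda>x. E x *\<^sub>R v x)" if "qsys v q (\<lambda>x. z * (E x *\<^sub>R v x))" for v q
    using z[OF qsys_schroedinger[OF that]] ac_continuous_on_halfline[OF qsys_ac_u[OF that]]
      square_integrable_if_near_infinity by blast
  obtain v1 q1 where 1: "v1 0 = 1" "q1 0 = 0" "qsys v1 q1 (\<lambda>x. z * (E x *\<^sub>R v1 x))"
    by (rule eigen_solution)
  obtain v2 q2 where 2: "v2 0 = 0" "q2 0 = 1" "qsys v2 q2 (\<lambda>x. z * (E x *\<^sub>R v2 x))"
    by (rule eigen_solution)
  obtain C1 where C1: "\<And>X. 0 \<le> X \<Longrightarrow> integral {0..X} (\<lambda>x. (norm (inverse (E x) *\<^sub>R q1 x))\<^sup>2) \<le> C1"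
    using qsys_derivative_bound[OF 1(3) sq[OF 1(3)] square_integrable_scale[OF sq[OF 1(3)]]] by blast
  obtain C2 where C2: "\<And>X. 0 \<le> X \<Longrightarrow> integral {0..X} (\<lambda>x. (norm (inverse (E x) *\<^sub>R q2 x))\<^sup>2) \<le> C2"
    using qsys_derivative_bound[OF 2(3) sq[OF 2(3)] square_integrable_scale[OF sq[OF 2(3)]]] by blast
  define N1 where "N1 = (norm (abs_L2 (\<lambda>x. E x *\<^sub>R v1 x)))\<^sup>2"
  define N2 where "N2 = (norm (abs_L2 (\<lambda>x. E x *\<^sub>R v2 x)))\<^sup>2"
  \<comment> \<open>The terms with \<open>z\<close> and \<open>W\<^sup>2\<close> are multiples of
    \<open>v1 * v2\<close> and cancel, as do the multiples of \<open>q1 * q2\<close>.\<close>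
  have wronskian: "v1 x * q2 x - v2 x * q1 x = 1" if "0 \<le> x" for x
  proof -
    have a: "ac v1 (\<lambda>x. (inverse (E x))\<^sup>2 *\<^sub>R q1 x)" "ac v2 (\<lambda>x. (inverse (E x))\<^sup>2 *\<^sub>R q2 x)"
      "ac q1 (\<lambda>x. - (E x *\<^sub>R (z * (E x *\<^sub>R v1 x) + (W x)\<^sup>2 *\<^sub>R E x *\<^sub>R v1 x)))"
      "ac q2 (\<lambda>x. - (E x *\<^sub>R (z * (E x *\<^sub>R v2 x) + (W x)\<^sup>2 *\<^sub>R E x *\<^sub>R v2 x)))"
      using 1(3) 2(3) by (simp_all add: qsys_def)
    have "ac (\<lambda>x. v1 x * q2 x - v2 x * q1 x) (\<lambda>x. 0)"
      by (rule ac_cong[OF ac_diff[OF ac_bilinear[OF bounded_bilinear_mult a(1,4)] ac_bilinear[OF bounded_bilinear_mult a(2,3)]]])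
        (simp_all add: scaleR_conv_of_real algebra_simps)
    from ac_0_iff_const[OF this that] show ?thesis using 1 2 by simp
  qed
  have i: "(\<lambda>x. (cmod (E x *\<^sub>R v x))\<^sup>2) integrable_on {0..X}"
    "(\<lambda>x. (cmod (inverse (E x) *\<^sub>R q x))\<^sup>2) integrable_on {0..X}"
    if "qsys v q f" for v q f X
    using that by (intro integrable_continuous_interval continuous_intros continuous_on_subset[of "{0..}" _ "{0..X}"];
        auto simp: qsys_def intro: ac_continuous_on_halfline E_cont inverse_E_cont)+
  \<comment> \<open>The constant 1 is a combination of products of square-integrable functions, so
    every length \<open>X\<close> would be bounded by the fixed number \<open>S\<close>; this fails
    at \<open>X = S + 1\<close>.\<close>
  define S where "S = N1 + C2 + (N2 + C1)"
  have S: "X \<le> S" if X: "0 \<le> X" for X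
  proof -
    have le: "1 \<le> (cmod (E x *\<^sub>R v1 x))\<^sup>2 + (cmod (inverse (E x) *\<^sub>R q2 x))\<^sup>2
      + ((cmod (E x *\<^sub>R v2 x))\<^sup>2 + (cmod (inverse (E x) *\<^sub>R q1 x))\<^sup>2)" if x: "0 \<le> x" for x
    proof -
      have m: "cmod (v x * q x) \<le> (cmod (E x *\<^sub>R v x))\<^sup>2 + (cmod (inverse (E x) *\<^sub>R q x))\<^sup>2" for v q
      proof -
        \<comment> \<open>The weights cancel in the product, so growth or decay of \<open>E\<close>
          does no harm.\<close>
        have "v x * q x = (E x *\<^sub>R v x) * (inverse (E x) *\<^sub>R q x)" by simp
        then have "cmod (v x * q x) = cmod (E x *\<^sub>R v x) * cmod (inverse (E x) *\<^sub>R q x)"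
          by (metis norm_mult)
        also have "\<dots> \<le> (cmod (E x *\<^sub>R v x))\<^sup>2 + (cmod (inverse (E x) *\<^sub>R q x))\<^sup>2"
          using sum_squares_bound[of "cmod (E x *\<^sub>R v x)" "cmod (inverse (E x) *\<^sub>R q x)"]
            zero_le_power2[of "cmod (E x *\<^sub>R v x)"] zero_le_power2[of "cmod (inverse (E x) *\<^sub>R q x)"] by linarith
        finally show ?thesis .
      qed
      have "1 \<le> cmod (v1 x * q2 x) + cmod (v2 x * q1 x)"
        using norm_triangle_ineq4[of "v1 x * q2 x" "v2 x * q1 x"] wronskian[OF x] by simp
      then show ?thesis using m[of v1 q2] m[of v2 q1] by linarith
    qed
    note I = i(1)[OF 1(3), of X] i(2)[OF 2(3), of X] i(1)[OF 2(3), of X] i(2)[OF 1(3), of X]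
    have "X = integral {0..X} (\<lambda>x. 1)" using X by simp
    also have "\<dots> \<le> integral {0..X} (\<lambda>x. (cmod (E x *\<^sub>R v1 x))\<^sup>2 + (cmod (inverse (E x) *\<^sub>R q2 x))\<^sup>2
      + ((cmod (E x *\<^sub>R v2 x))\<^sup>2 + (cmod (inverse (E x) *\<^sub>R q1 x))\<^sup>2))"
      by (intro integral_le integrable_add I) (use le in auto)
    also have "\<dots> = integral {0..X} (\<lambda>x. (cmod (E x *\<^sub>R v1 x))\<^sup>2) + integral {0..X} (\<lambda>x. (cmod (inverse (E x) *\<^sub>R q2 x))\<^sup>2)
      + (integral {0..X} (\<lambda>x. (cmod (E x *\<^sub>R v2 x))\<^sup>2) + integral {0..X} (\<lambda>x. (cmod (inverse (E x) *\<^sub>R q1 x))\<^sup>2))"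
      unfolding Henstock_Kurzweil_Integration.integral_add[OF integrable_add[OF I(1,2)] integrable_add[OF I(3,4)]]
        Henstock_Kurzweil_Integration.integral_add[OF I(1,2)] Henstock_Kurzweil_Integration.integral_add[OF I(3,4)] ..
    also have "\<dots> \<le> S"
      unfolding S_def N1_def N2_def
      by (intro add_mono C1 C2 square_integral_le_norm sq[OF 1(3)] sq[OF 2(3)] X order_refl)
    finally show ?thesis .
  qed
  from S[of 0] S[of "S + 1"] show False by simp
qed

text \<open>On \<open>[a, a + L]\<close> with \<open>\<bar>W\<bar> \<le> 1 / L\<close> the factor \<open>E\<close> is nearly constant, so \<open>E\<close> times a cut-off plane
  wave is an approximate eigenfunction.\<close>

lemma singular_sequence:
  assumes k: "0 \<le> k" and L: "1 \<le> L"
  obtains U F where "(U, F) \<in> preminimal_operator V" "U \<noteq> 0"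
    "norm (F - scaleC_L2 (complex_of_real (k\<^sup>2)) U) \<le> 400 * (exp 1)\<^sup>2 * (5 + 4 * k) / L * norm U"
proof -
  obtain R where R: "0 \<le> R" "\<And>x. R \<le> x \<Longrightarrow> \<bar>W x\<bar> \<le> 1 / L"
    using W_eventually_le[of "1 / L"] L by auto
  define a where "a = R + 1"
  define b where "b = a + L"
  have a: "0 < a" "a \<le> b" "a < b" using R L by (auto simp: a_def b_def)
  have Wa: "\<bar>W x\<bar> \<le> 1 / L" if "a \<le> x" for x using R that by (simp add: a_def)
  \<comment> \<open>A parabola with zeros \<open>a\<close> and \<open>b\<close> and maximum 1/4,
    independent of \<open>L\<close>. The cube of its positive part has a continuous second
    derivative, and each differentiation gains a factor \<open>1 / L\<close>.\<close>
  define s where "s x = (x - a) * (b - x) / L\<^sup>2" for x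
  define s' where "s' x = (a + b - 2 * x) / L\<^sup>2" for x
  define \<sigma> where "\<sigma> x = max 0 (s x)" for x
  define \<psi> where "\<psi> x = (\<sigma> x) ^ 3" for x
  define \<psi>' where "\<psi>' x = 3 * (\<sigma> x)\<^sup>2 * s' x" for x
  define \<psi>'' where "\<psi>'' x = 6 * \<sigma> x * (s' x)\<^sup>2 - 6 * (\<sigma> x)\<^sup>2 / L\<^sup>2" for x
  have L0: "0 < L" using L by simp
  have ds: "(s has_real_derivative s' x) (at x)" for x
    unfolding s_def s'_def using L0 by (auto intro!: derivative_eq_intros simp: field_simps)
  have ds': "(s' has_real_derivative - 2 / L\<^sup>2) (at x)" for x
    unfolding s'_def by (rule DERIV_cdivide) (auto intro!: derivative_eq_intros)
  have s_cont: "continuous_on S s" and s'_cont: "continuous_on S s'" and \<sigma>_cont: "continuous_on S \<sigma>" for S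
    unfolding \<sigma>_def s_def s'_def using L0 by (intro continuous_intros; simp)+
  have ac\<psi>: "ac \<psi> \<psi>'"
  proof (rule ac_has_vector_derivative)
    fix x
    have "(\<psi> has_real_derivative \<psi>' x) (at x)"
      unfolding \<psi>_def \<psi>'_def \<sigma>_def
      by (rule DERIV_chain2[OF has_real_derivative_positive_part_power3 ds])
    then show "(\<psi> has_vector_derivative \<psi>' x) (at x within {0..})"
      by (simp add: has_real_derivative_iff_has_vector_derivative has_vector_derivative_at_within)
  qed (auto simp: \<psi>'_def intro!: continuous_intros \<sigma>_cont s'_cont)
  have ac\<psi>': "ac \<psi>' \<psi>''"
  proof (rule ac_has_vector_derivative)
    fix x
    have "((\<lambda>x. (\<sigma> x)\<^sup>2) has_real_derivative 2 * \<sigma> x * s' x) (at x)"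
      unfolding \<sigma>_def by (rule DERIV_chain2[OF has_real_derivative_positive_part_power2 ds])
    from DERIV_mult[OF DERIV_cmult[OF this, of 3] ds'[of x]]
    have "(\<psi>' has_real_derivative 3 * (2 * \<sigma> x * s' x) * s' x + - 2 / L\<^sup>2 * (3 * (\<sigma> x)\<^sup>2)) (at x)"
      unfolding \<psi>'_def[abs_def] .
    moreover have "3 * (2 * \<sigma> x * s' x) * s' x + - 2 / L\<^sup>2 * (3 * (\<sigma> x)\<^sup>2) = \<psi>'' x"
      by (simp add: \<psi>''_def power2_eq_square)
    ultimately have "(\<psi>' has_real_derivative \<psi>'' x) (at x)" by (simp only:)
    then show "(\<psi>' has_vector_derivative \<psi>'' x) (at x within {0..})"
      by (simp add: has_real_derivative_iff_has_vector_derivative has_vector_derivative_at_within)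
  qed (use L0 in \<open>auto simp: \<psi>''_def intro!: continuous_intros \<sigma>_cont s'_cont\<close>)
  have out: "\<sigma> x = 0" if "x \<notin> {a<..<b}" for x
  proof -
    have "(x - a) * (b - x) \<le> 0" using that a by (auto simp: mult_le_0_iff)
    then show ?thesis by (simp add: \<sigma>_def s_def divide_nonpos_nonneg)
  qed
  have \<psi>_out: "\<psi> x = 0" "\<psi>' x = 0" "\<psi>'' x = 0" if "x \<notin> {a<..<b}" for x
    using out[OF that] by (simp_all add: \<psi>_def \<psi>'_def \<psi>''_def)
  have \<sigma>_bound: "0 \<le> \<sigma> x" "\<sigma> x \<le> 1 / 4" for x
  proof -
    have "0 \<le> (L / 2 - (x - a))\<^sup>2" by simp
    then have "(x - a) * (b - x) \<le> L\<^sup>2 / 4" by (simp add: b_def power2_eq_square algebra_simps)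
    then have "s x \<le> 1 / 4" using L0 by (simp add: s_def field_simps)
    then show "\<sigma> x \<le> 1 / 4" by (simp add: \<sigma>_def)
  qed (simp add: \<sigma>_def)
  have s'_bound: "\<bar>s' x\<bar> \<le> 1 / L" if "x \<in> {a<..<b}" for x
  proof -
    have "\<bar>a + b - 2 * x\<bar> \<le> L" using that by (auto simp: b_def)
    then have "\<bar>a + b - 2 * x\<bar> / L\<^sup>2 \<le> L / L\<^sup>2" by (intro divide_right_mono) auto
    then show ?thesis using L0 by (simp add: s'_def power2_eq_square)
  qed
  have \<sigma>2: "(\<sigma> x)\<^sup>2 \<le> 1 / 16" for x
    using power_mono[OF \<sigma>_bound(2)[of x] \<sigma>_bound(1)[of x], of 2] by (simp add: power2_eq_square)
  have \<psi>_bound: "\<bar>\<psi> x\<bar> \<le> 1" for x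
    using power_mono[OF \<sigma>_bound(2)[of x] \<sigma>_bound(1)[of x], of 3] \<sigma>_bound(1)[of x] by (simp add: \<psi>_def power3_eq_cube)
  have \<psi>'_bound: "\<bar>\<psi>' x\<bar> \<le> 1 / L" if "x \<in> {a<..<b}" for x
  proof -
    have "\<bar>\<psi>' x\<bar> = 3 * (\<sigma> x)\<^sup>2 * \<bar>s' x\<bar>" by (simp add: \<psi>'_def abs_mult)
    also have "\<dots> \<le> 1 * (1 / L)" using s'_bound[OF that] \<sigma>2[of x] by (intro mult_mono) auto
    finally show ?thesis by simp
  qed
  have \<psi>''_bound: "\<bar>\<psi>'' x\<bar> \<le> 2 / L" if "x \<in> {a<..<b}" for x
  proof -
    have "(s' x)\<^sup>2 \<le> (1 / L)\<^sup>2" using s'_bound[OF that] L0 by (subst abs_le_square_iff[symmetric]) auto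
    then have "6 * \<sigma> x * (s' x)\<^sup>2 \<le> (6 * (1 / 4)) * (1 / L)\<^sup>2"
      using \<sigma>_bound[of x] by (intro mult_mono) auto
    moreover have "6 * (\<sigma> x)\<^sup>2 / L\<^sup>2 \<le> 6 * (1 / 16) * (1 / L)\<^sup>2"
      using divide_right_mono[OF \<sigma>2[of x], of "L\<^sup>2"] by (simp add: power_divide)
    moreover have "0 \<le> 6 * \<sigma> x * (s' x)\<^sup>2" "0 \<le> 6 * (\<sigma> x)\<^sup>2 / L\<^sup>2" using \<sigma>_bound by auto
    moreover have "0 \<le> (1 / L)\<^sup>2" by simp
    ultimately have "\<bar>\<psi>'' x\<bar> \<le> 2 * (1 / L)\<^sup>2"
      unfolding \<psi>''_def abs_le_iff by linarith
    also have "\<dots> \<le> 2 * (1 / L)" using L by (simp add: power2_eq_square field_simps)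
    finally show ?thesis by simp
  qed
  define e where "e x = exp (\<i> * of_real k * of_real x)" for x
  have e_norm: "cmod (e x) = 1" for x by (simp add: e_def norm_exp_eq_Re)
  have e_cont: "continuous_on S e" for S unfolding e_def by (intro continuous_intros)
  have ac_e: "ac e (\<lambda>x. (\<i> * of_real k) * e x)"
  proof (rule ac_has_vector_derivative)
    fix x
    have "((\<lambda>z. exp (\<i> * of_real k * z)) has_field_derivative (\<i> * of_real k) * e x) (at (of_real x))"
      unfolding e_def by (auto intro!: derivative_eq_intros)
    then show "(e has_vector_derivative (\<i> * of_real k) * e x) (at x within {0..})"
      unfolding e_def by (rule has_vector_derivative_real_field)
  qed (intro continuous_intros e_cont)
  have ac_ie: "ac (\<lambda>x. (\<i> * of_real k) * e x) (\<lambda>x. (\<i> * of_real k) * ((\<i> * of_real k) * e x))"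
    by (rule ac_linear[OF ac_e bounded_linear_mult_right])
  define v where "v x = \<psi> x *\<^sub>R e x" for x
  define v' where "v' x = \<psi>' x *\<^sub>R e x + \<psi> x *\<^sub>R ((\<i> * of_real k) * e x)" for x
  define v'' where "v'' x = (\<psi>'' x *\<^sub>R e x + \<psi>' x *\<^sub>R ((\<i> * of_real k) * e x))
    + (\<psi>' x *\<^sub>R ((\<i> * of_real k) * e x) + \<psi> x *\<^sub>R ((\<i> * of_real k) * ((\<i> * of_real k) * e x)))" for x
  have ac_v: "ac v v'"
    unfolding v_def[abs_def] v'_def[abs_def] by (rule ac_bilinear[OF bounded_bilinear_scaleR ac\<psi> ac_e])
  have ac_v': "ac v' v''"
    unfolding v'_def[abs_def] v''_def[abs_def]
    by (rule ac_add[OF ac_bilinear[OF bounded_bilinear_scaleR ac\<psi>' ac_e] ac_bilinear[OF bounded_bilinear_scaleR ac\<psi> ac_ie]])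
  have v_out: "v x = 0 \<and> v' x = 0 \<and> v'' x = 0" if "x \<notin> {a<..<b}" for x
    using \<psi>_out[OF that] by (simp add: v_def v'_def v''_def)
  have v''2: "square_integrable v''"
  proof -
    have c: "continuous_on {0..} v''"
      unfolding v''_def[abs_def] \<psi>_def \<psi>'_def \<psi>''_def using L0
      by (intro continuous_intros \<sigma>_cont s'_cont e_cont) auto
    obtain B where B: "\<And>x. 0 \<le> x \<Longrightarrow> x \<le> b \<Longrightarrow> \<bar>cmod (v'' x)\<bar> \<le> B"
      using continuous_on_halfline_bounded[OF continuous_on_norm[OF c], of b] by blast
    show ?thesis
    proof (rule square_integrable_bounded_support[OF borel_measurable_half_line_continuous[OF c] square_integrable_0, of b 0 B])
      show "cmod (v'' x) \<le> 0 * cmod 0 + B" if "0 \<le> x" "x \<le> b" for x using B[OF that] by linarith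
      show "v'' x = 0" if "b < x" for x using v_out[of x] that by simp
    qed
  qed
  define f where "f = (\<lambda>x. - (E x *\<^sub>R (v'' x + (2 * W x) *\<^sub>R v' x + (W x)\<^sup>2 *\<^sub>R v x)))"
  have supp: "v x = 0 \<and> v' x = 0 \<and> v'' x = 0" if "0 \<le> x" "x \<notin> {a..b}" for x
    using v_out[of x] that by auto
  note test = test_function_in_preminimal[OF ac_v ac_v' v''2 a(1,2) supp, folded f_def]
  define u where "u = (\<lambda>x. E x *\<^sub>R v x)"
  have u: "square_integrable u" using test(1) by (simp add: u_def)
  define g where "g x = f x - complex_of_real (k\<^sup>2) * u x" for x
  have g: "square_integrable g" "abs_L2 f - scaleC_L2 (complex_of_real (k\<^sup>2)) (abs_L2 u) = abs_L2 g"
  proof -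
    have f: "square_integrable f" by (rule test(2))
    show "square_integrable g"
      unfolding g_def[abs_def] by (rule square_integrable_diff[OF f square_integrable_scale[OF u]])
    show "abs_L2 f - scaleC_L2 (complex_of_real (k\<^sup>2)) (abs_L2 u) = abs_L2 g"
      unfolding g_def[abs_def] scaleC_abs_L2[OF u] by (rule minus_abs_L2[OF f square_integrable_scale[OF u]])
  qed
  \<comment> \<open>On an interval of length \<open>L\<close> with
    \<open>\<bar>W\<bar> \<le> 1 / L\<close> the exponent of \<open>E\<close> changes by at most
    1.\<close>
  have E_ratio: "E x \<le> exp 1 * E a" "E a / exp 1 \<le> E x" if x: "a \<le> x" "x \<le> b" for x
  proof -
    define P where "P x = 0 + integral {0..x} W" for x
    have "ac P W" unfolding P_def[abs_def] by (rule ac_integral_continuous[OF W_cont])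
    then have "P x - P a = integral {a..x} W" by (rule ac_diff_integral) (use a x in auto)
    moreover have "norm (integral {a..x} W) \<le> integral {a..x} (\<lambda>x. 1 / L)"
    proof (rule integral_norm_bound_integral)
      show "W integrable_on {a..x}"
        by (rule integrable_continuous_interval, rule continuous_on_subset[OF W_cont]) (use a in auto)
      show "(\<lambda>x. 1 / L) integrable_on {a..x}"
        by (intro integrable_continuous_interval continuous_intros)
    qed (use Wa in auto)
    moreover have "integral {a..x} (\<lambda>x. 1 / L) \<le> 1"
      using x L0 by (simp add: b_def field_simps)
    ultimately have P: "P x \<le> 1 + P a" "P a - 1 \<le> P x" unfolding real_norm_def by linarith+
    have EP: "E x = exp (P x)" for x by (simp add: E_def P_def)
    show "E x \<le> exp 1 * E a" unfolding EP exp_add[symmetric] using P(1) by simp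
    show "E a / exp 1 \<le> E x" unfolding EP exp_diff[symmetric] using P(2) by simp
  qed
  define c where "c = exp 1 * E a * ((5 + 4 * k) / L)"
  have c0: "0 \<le> c" using k L0 by (simp add: c_def less_imp_le)
  have g_out: "g x = 0" if "x \<notin> {a<..<b}" for x
    using v_out[OF that] by (simp add: g_def f_def u_def)
  have g_bound: "cmod (g x) \<le> c" for x
  proof (cases "x \<in> {a<..<b}")
    case True
    \<comment> \<open>The term with \<open>k\<^sup>2\<close> cancels because
      \<open>e'' = - k\<^sup>2 e\<close>. Each remaining term contains a derivative of the cut-off
      or a power of \<open>W\<close>, hence a factor \<open>1 / L\<close>.\<close>
    have "g x = - (E x *\<^sub>R ((\<psi>'' x *\<^sub>R e x + (2 * \<psi>' x) *\<^sub>R ((\<i> * of_real k) * e x)) + (2 * W x) *\<^sub>R v' x + (W x)\<^sup>2 *\<^sub>R v x))"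
      by (simp add: g_def f_def u_def v_def v''_def scaleR_conv_of_real power2_eq_square algebra_simps)
    then have gx: "cmod (g x) = E x * cmod ((\<psi>'' x *\<^sub>R e x + (2 * \<psi>' x) *\<^sub>R ((\<i> * of_real k) * e x)) + (2 * W x) *\<^sub>R v' x + (W x)\<^sup>2 *\<^sub>R v x)"
      by (simp only: norm_minus_cancel norm_scaleR abs_of_pos[OF E_pos])
    have n1: "cmod (\<psi>'' x *\<^sub>R e x) \<le> 2 / L" using \<psi>''_bound[OF True] by (simp add: e_norm)
    have n2: "cmod ((2 * \<psi>' x) *\<^sub>R ((\<i> * of_real k) * e x)) \<le> 2 * k / L"
    proof -
      have "cmod ((2 * \<psi>' x) *\<^sub>R ((\<i> * of_real k) * e x)) = 2 * \<bar>\<psi>' x\<bar> * k"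
        using k by (simp add: e_norm norm_mult abs_mult)
      also have "\<dots> \<le> 2 * (1 / L) * k" using \<psi>'_bound[OF True] k by (intro mult_right_mono) auto
      finally show ?thesis by simp
    qed
    have nv': "cmod (v' x) \<le> 1 + k"
    proof -
      have "cmod (v' x) \<le> \<bar>\<psi>' x\<bar> + \<bar>\<psi> x\<bar> * k"
        unfolding v'_def using k by (intro order_trans[OF norm_triangle_ineq]) (simp add: e_norm norm_mult)
      also have "\<dots> \<le> 1 / L + 1 * k" using \<psi>'_bound[OF True] \<psi>_bound[of x] k by (intro add_mono mult_right_mono) auto
      also have "1 / L \<le> 1" using L by simp
      finally show ?thesis by simp
    qed
    have n3: "cmod ((2 * W x) *\<^sub>R v' x) \<le> 2 * (1 + k) / L"
    proof -
      have "cmod ((2 * W x) *\<^sub>R v' x) = 2 * \<bar>W x\<bar> * cmod (v' x)" by (simp add: abs_mult)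
      also have "\<dots> \<le> 2 * (1 / L) * (1 + k)" using Wa[of x] True nv' L0 by (intro mult_mono) auto
      finally show ?thesis by simp
    qed
    have n4: "cmod ((W x)\<^sup>2 *\<^sub>R v x) \<le> 1 / L"
    proof -
      have "(W x)\<^sup>2 \<le> (1 / L)\<^sup>2" using Wa[of x] True L0 by (subst abs_le_square_iff[symmetric]) auto
      also have "\<dots> \<le> 1 / L" using L by (simp add: power2_eq_square field_simps)
      finally have "(W x)\<^sup>2 * \<bar>\<psi> x\<bar> \<le> 1 / L * 1" using \<psi>_bound[of x] L0 by (intro mult_mono) auto
      then show ?thesis by (simp add: v_def e_norm abs_mult)
    qed
    have "cmod ((\<psi>'' x *\<^sub>R e x + (2 * \<psi>' x) *\<^sub>R ((\<i> * of_real k) * e x)) + (2 * W x) *\<^sub>R v' x + (W x)\<^sup>2 *\<^sub>R v x)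
        \<le> 2 / L + 2 * k / L + 2 * (1 + k) / L + 1 / L"
      using n1 n2 n3 n4 by (intro norm_triangle_le add_mono)
    also have "\<dots> = (5 + 4 * k) / L" by (simp add: add_divide_distrib algebra_simps)
    finally show ?thesis
      unfolding gx c_def using E_ratio(1)[of x] True by (intro mult_mono) (auto intro: less_imp_le)
  qed (simp add: g_out c0)
  have g_norm: "(norm (abs_L2 g))\<^sup>2 \<le> c\<^sup>2 * L"
  proof (rule norm_abs_L2_le[OF g(1)])
    fix X :: real assume "0 \<le> X"
    have "((\<lambda>x. if x \<in> {a..b} then c\<^sup>2 else 0) has_integral (b - a) *\<^sub>R c\<^sup>2) {0..max b X}"
      using has_integral_restrict_closed_subinterval[of "\<lambda>x. c\<^sup>2" "(b - a) *\<^sub>R c\<^sup>2" a b 0 "max b X"]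
        has_integral_const_real[of "c\<^sup>2" a b] a by (simp add: box_real)
    then have hi: "(\<lambda>x. if x \<in> {a..b} then c\<^sup>2 else 0) integrable_on {0..max b X}"
      "integral {0..max b X} (\<lambda>x. if x \<in> {a..b} then c\<^sup>2 else 0) = L * c\<^sup>2"
      by (auto simp: integral_unique b_def)
    have ig: "(\<lambda>x. (cmod (g x))\<^sup>2) integrable_on {0..Y}" for Y
      using square_integrable_local[OF g(1) order_refl] set_lebesgue_integral_eq_integral(1) by blast
    have "integral {0..X} (\<lambda>x. (cmod (g x))\<^sup>2) \<le> integral {0..max b X} (\<lambda>x. (cmod (g x))\<^sup>2)"
      by (intro integral_subset_le ig) auto
    also have "\<dots> \<le> integral {0..max b X} (\<lambda>x. if x \<in> {a..b} then c\<^sup>2 else 0)"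
    proof (rule integral_le[OF ig hi(1)])
      show "(cmod (g x))\<^sup>2 \<le> (if x \<in> {a..b} then c\<^sup>2 else 0)" for x
        using g_bound[of x] g_out[of x] by (auto intro: power_mono)
    qed
    finally show "integral {0..X} (\<lambda>x. (cmod (g x))\<^sup>2) \<le> c\<^sup>2 * L" unfolding hi(2) by (simp add: mult.commute)
  qed
  \<comment> \<open>A lower bound for \<open>cmod (u x)\<close> on the middle half of the interval,
    where \<open>s x \<ge> 3 / 16\<close> and \<open>(3 / 16) ^ 3 \<ge> 1 / 200\<close>.\<close>
  define d where "d = E a / exp 1 * (1 / 200)"
  have d0: "0 < d" by (simp add: d_def)
  have u_norm: "L / 2 * d\<^sup>2 \<le> (norm (abs_L2 u))\<^sup>2"
  proof -
    let ?I = "{a + L / 4..a + 3 * L / 4}"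
    have "L / 2 * d\<^sup>2 = integral ?I (\<lambda>x. d\<^sup>2)" using L0 by (simp add: field_simps)
    also have "\<dots> \<le> integral ?I (\<lambda>x. (cmod (u x))\<^sup>2)"
    proof (rule integral_le)
      show "(\<lambda>x. (cmod (u x))\<^sup>2) integrable_on ?I"
        using square_integrable_local[OF u, of "a + L / 4"] a L0 set_lebesgue_integral_eq_integral(1) by auto
      fix x assume x: "x \<in> ?I"
      \<comment> \<open>The product equals \<open>(x - a) * (b - x) - 3 / 16 * L\<^sup>2\<close>,
        factored at its zeros, the ends of the middle half.\<close>
      have "0 \<le> (x - a - L / 4) * (a + 3 * L / 4 - x)" using x by (intro mult_nonneg_nonneg) auto
      then have "3 / 16 * L\<^sup>2 \<le> (x - a) * (b - x)" by (simp add: b_def power2_eq_square field_simps)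
      then have "3 / 16 \<le> s x" using L0 by (simp add: s_def field_simps)
      then have "(3 / 16) ^ 3 \<le> \<psi> x" unfolding \<psi>_def \<sigma>_def by (intro power_mono) auto
      then have chi: "1 / 200 \<le> \<psi> x" by (simp add: power3_eq_cube)
      have "d \<le> E x * \<psi> x"
        unfolding d_def using E_ratio(2)[of x] x chi L0 by (intro mult_mono) (auto simp: b_def less_imp_le)
      also have "\<dots> = cmod (u x)"
        using chi by (simp add: u_def v_def e_norm abs_of_pos)
      finally show "d\<^sup>2 \<le> (cmod (u x))\<^sup>2" using d0 by (intro power_mono) auto
    qed auto
    also have "\<dots> \<le> (norm (abs_L2 u))\<^sup>2"
      using a L0 by (intro square_integral_le_norm u) auto
    finally show ?thesis .
  qed
  \<comment> \<open>The factor \<open>400 = 2 * 200\<close> and the square of \<open>exp 1\<close>,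
    one power from each half of \<open>E_ratio\<close>, make \<open>c = D / 2 * d\<close>. The
    uncontrolled size \<open>E a\<close> occurs in both \<open>c\<close> and \<open>d\<close> and
    drops out.\<close>
  define D where "D = 400 * (exp 1)\<^sup>2 * (5 + 4 * k) / L"
  have D0: "0 \<le> D" using k L0 by (simp add: D_def)
  have "c = D / 2 * d" by (simp add: c_def D_def d_def power2_eq_square)
  then have "c\<^sup>2 * L = D\<^sup>2 * (L / 2 * d\<^sup>2) / 2" by (simp only:) (simp add: power_mult_distrib power_divide)
  also have "\<dots> \<le> D\<^sup>2 * (L / 2 * d\<^sup>2)" using L0 by simp
  also have "\<dots> \<le> D\<^sup>2 * (norm (abs_L2 u))\<^sup>2" using u_norm by (intro mult_left_mono) auto
  finally have "(norm (abs_L2 g))\<^sup>2 \<le> (D * norm (abs_L2 u))\<^sup>2" using g_norm by (simp add: power_mult_distrib)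
  then have le: "norm (abs_L2 g) \<le> D * norm (abs_L2 u)" by (rule power2_le_imp_le) (use D0 in simp)
  have "0 < L / 2 * d\<^sup>2" using L0 d0 by simp
  then have "abs_L2 u \<noteq> 0" using u_norm by auto
  then show ?thesis
    using that[of "abs_L2 u" "abs_L2 f"] test(3) le g(2) by (simp add: u_def D_def)
qed

text \<open>Elements of the preminimal operator lie in every realization, whatever the boundary
  condition at 0. A resolvent bound at \<open>k\<^sup>2\<close> would contradict
  \<open>singular_sequence\<close> for large \<open>L\<close>.\<close>

lemma nonneg_in_spectrum:
  assumes H: "self_adjoint_realization V H" and k: "0 \<le> k"
  shows "complex_of_real (k\<^sup>2) \<in> spectrum H"
proof (rule ccontr)
  assume "complex_of_real (k\<^sup>2) \<notin> spectrum H"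
  then have "\<exists>C. \<forall>(U, F)\<in>H. norm U \<le> C * norm (F - scaleC_L2 (complex_of_real (k\<^sup>2)) U)"
    by (simp add: spectrum_def resolvent_set_def del: of_real_power)
  then obtain C where C: "\<And>U F. (U, F) \<in> H \<Longrightarrow> norm U \<le> C * norm (F - scaleC_L2 (complex_of_real (k\<^sup>2)) U)"
    by fast
  define D where "D = 400 * (exp 1)\<^sup>2 * (5 + 4 * k)"
  \<comment> \<open>Large enough for \<open>\<bar>C\<bar> * D / L \<le> 1 / 2\<close>, and at least
    1 as \<open>singular_sequence\<close> demands.\<close>
  define L where "L = max 1 (2 * \<bar>C\<bar> * D)"
  have L: "1 \<le> L" "2 * \<bar>C\<bar> * D \<le> L" by (simp_all add: L_def)
  have D: "0 < D" using k by (simp add: D_def)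
  obtain U F where UF: "(U, F) \<in> preminimal_operator V" "U \<noteq> 0"
      "norm (F - scaleC_L2 (complex_of_real (k\<^sup>2)) U) \<le> D / L * norm U"
    using singular_sequence[OF k L(1)] unfolding D_def by blast
  have "(U, F) \<in> H"
    using UF(1) H closure_subset unfolding self_adjoint_realization_def minimal_operator_def by blast
  then have "norm U \<le> C * norm (F - scaleC_L2 (complex_of_real (k\<^sup>2)) U)" by (rule C)
  also have "\<dots> \<le> \<bar>C\<bar> * (D / L * norm U)"
    using UF(3) by (intro mult_mono) auto
  also have "\<dots> = (\<bar>C\<bar> * D / L) * norm U" by simp
  also have "\<dots> \<le> (1 / 2) * norm U"
    using L by (intro mult_right_mono) (auto simp: field_simps)
  finally show False using UF(2) by simp
qed

section \<open>Essential spectrum\<close>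

text \<open>The traces are bounded by \<open>trace_bound\<close> in a two-dimensional complex space,
  hence subconverge, and the residuals converge. Applied to differences,
  \<open>apriori_bound\<close> then makes the subsequence Cauchy in norm.\<close>

lemma singular_sequence_converges:
  assumes H: "self_adjoint_realization V H" and m: "0 < m"
    and XY: "\<And>n. (X n, Y n) \<in> H" "\<And>n. norm (X n) = 1"
    and lim: "(\<lambda>n. Y n - scaleC_L2 (- complex_of_real m) (X n)) \<longlonglongrightarrow> 0"
  shows "\<exists>r. strict_mono (r :: nat \<Rightarrow> nat) \<and> convergent (X \<circ> r)"
proof -
  define z where "z = - complex_of_real m"
  define G where "G n = Y n - scaleC_L2 z (X n)" for n
  have G: "G \<longlonglongrightarrow> 0" using lim by (simp add: G_def[abs_def] z_def)
  have "\<exists>v q f. represents (X n) (Y n) v q f" for n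
    by (rule realization_represents[OF H XY(1)])
  then obtain v q f where rep: "\<And>n. represents (X n) (Y n) (v n) (q n) (f n)"
    by metis
  obtain C where C: "0 < C"
      "\<And>U F v q f. represents U F v q f \<Longrightarrow> cmod (v 0) + cmod (q 0) \<le> C * (norm U + norm F)"
    by (rule trace_bound) blast
  obtain D where D: "0 < D" "\<And>U F v q f. represents U F v q f \<Longrightarrow>
      norm U \<le> D * (cmod (v 0) + cmod (q 0) + norm (F - scaleC_L2 z U))"
    unfolding z_def by (rule apriori_bound[OF m]) blast
  define t where "t n = (v n 0, q n 0)" for n
  obtain B where B: "\<And>n. norm (G n) \<le> B"
    using convergent_imp_Bseq[OF convergentI[OF G]] unfolding Bseq_def by blast
  have "norm (t n) \<le> C * (1 + (B + cmod z))" for n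
  proof -
    have "norm (Y n) \<le> norm (G n) + norm (scaleC_L2 z (X n))"
      using norm_triangle_ineq[of "G n" "scaleC_L2 z (X n)"] by (simp add: G_def)
    then have "norm (Y n) \<le> B + cmod z" using B[of n] by (simp add: norm_scaleC XY(2))
    then have "C * (norm (X n) + norm (Y n)) \<le> C * (1 + (B + cmod z))"
      using C(1) by (intro mult_left_mono) (auto simp: XY(2))
    moreover have "norm (t n) \<le> cmod (v n 0) + cmod (q n 0)"
      unfolding t_def by (rule norm_Pair_le)
    ultimately show ?thesis using C(2)[OF rep, of n] by linarith
  qed
  then have "bounded (range t)" by (auto simp: bounded_iff)
  then obtain t0 r where r: "strict_mono (r :: nat \<Rightarrow> nat)" "(t \<circ> r) \<longlonglongrightarrow> t0"
    using bounded_imp_convergent_subsequence by blast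
  have le: "dist (X i) (X j) \<le> D * (2 * dist (t i) (t j) + dist (G i) (G j))" for i j
  proof -
    have "norm (X i - X j) \<le> D * (cmod (v i 0 - v j 0) + cmod (q i 0 - q j 0)
        + norm (Y i - Y j - scaleC_L2 z (X i - X j)))"
      by (rule D(2)[OF represents_diff[OF rep rep]])
    also have "Y i - Y j - scaleC_L2 z (X i - X j) = G i - G j"
      by (simp add: G_def complex_L2.scale_right_diff_distrib)
    also have "D * (cmod (v i 0 - v j 0) + cmod (q i 0 - q j 0) + norm (G i - G j))
        \<le> D * (dist (t i) (t j) + dist (t i) (t j) + dist (G i) (G j))"
      using D(1) dist_fst_le[of "t i" "t j"] dist_snd_le[of "t i" "t j"]
      by (intro mult_left_mono add_mono) (auto simp: t_def dist_norm)
    finally show ?thesis by (simp add: dist_norm)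
  qed
  have "Cauchy (X \<circ> r)"
    unfolding Cauchy_def
  proof (intro allI impI)
    fix e :: real assume e: "0 < e"
    \<comment> \<open>Three contributions of size \<open>\<delta>\<close>, two from the traces and
      one from the residuals, add up to \<open>3 / 4 * e\<close> after multiplication by
      \<open>D\<close>.\<close>
    define \<delta> where "\<delta> = e / (4 * D)"
    have \<delta>: "0 < \<delta>" using e D(1) by (simp add: \<delta>_def)
    obtain M1 where M1: "\<And>i j. M1 \<le> i \<Longrightarrow> M1 \<le> j \<Longrightarrow> dist (t (r i)) (t (r j)) < \<delta>"
      using LIMSEQ_imp_Cauchy[OF r(2)] \<delta> unfolding Cauchy_def by fastforce
    obtain M2 where M2: "\<And>i j. M2 \<le> i \<Longrightarrow> M2 \<le> j \<Longrightarrow> dist (G (r i)) (G (r j)) < \<delta>"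
      using LIMSEQ_imp_Cauchy[OF LIMSEQ_subseq_LIMSEQ[OF G r(1)]] \<delta> unfolding Cauchy_def by fastforce
    have "dist ((X \<circ> r) i) ((X \<circ> r) j) < e" if "max M1 M2 \<le> i" "max M1 M2 \<le> j" for i j
    proof -
      have "dist (X (r i)) (X (r j)) \<le> D * (2 * dist (t (r i)) (t (r j)) + dist (G (r i)) (G (r j)))" by (rule le)
      also have "\<dots> \<le> D * (2 * \<delta> + \<delta>)"
        using D(1) M1[of i j] M2[of i j] that by (intro mult_left_mono add_mono) auto
      also have "\<dots> < e" using D(1) e by (simp add: \<delta>_def)
      finally show ?thesis by simp
    qed
    then show "\<exists>M. \<forall>i\<ge>M. \<forall>j\<ge>M. dist ((X \<circ> r) i) ((X \<circ> r) j) < e" by blast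
  qed
  then show ?thesis using r(1) Cauchy_convergent by blast
qed

text \<open>An eigenvector has zero residual, so by \<open>apriori_bound\<close> it vanishes as soon
  as its two traces do.\<close>

lemma eigenspace_finite_span:
  assumes H: "self_adjoint_realization V H" and m: "0 < m"
  shows "\<exists>B. finite B \<and> eigenspace H (- complex_of_real m) \<subseteq> complex_span B"
proof -
  define z where "z = - complex_of_real m"
  have sa: "self_adjoint H" using H by (simp add: self_adjoint_realization_def)
  obtain D where D: "0 < D" "\<And>U F v q f. represents U F v q f \<Longrightarrow>
      norm U \<le> D * (cmod (v 0) + cmod (q 0) + norm (F - scaleC_L2 z U))"
    unfolding z_def by (rule apriori_bound[OF m]) blast
  define tr where "tr U a b \<longleftrightarrow> (\<exists>v q f. represents U (scaleC_L2 z U) v q f \<and> v 0 = a \<and> q 0 = b)" for U a b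
  show ?thesis
    unfolding z_def[symmetric]
  proof (rule finite_span_if_two_traces[of _ tr])
    show "\<exists>a b. tr U a b" if "U \<in> eigenspace H z" for U
      using realization_represents[OF H, of U "scaleC_L2 z U"] that by (auto simp: eigenspace_def tr_def)
    show "U - scaleC_L2 c W \<in> eigenspace H z \<and> tr (U - scaleC_L2 c W) (a - c * a') (b - c * b')"
      if UW: "U \<in> eigenspace H z" "W \<in> eigenspace H z" "tr U a b" "tr W a' b'" for U W c a b a' b'
    proof -
      have eq: "scaleC_L2 z (U - scaleC_L2 c W) = scaleC_L2 z U - scaleC_L2 c (scaleC_L2 z W)"
        by (simp add: complex_L2.scale_right_diff_distrib mult.commute)
      have "(U - scaleC_L2 c W, scaleC_L2 z U - scaleC_L2 c (scaleC_L2 z W)) \<in> H"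
        using UW(1,2) unfolding eigenspace_def by (intro self_adjoint_diff[OF sa] self_adjointD(2)[OF sa]) auto
      moreover have "tr (U - scaleC_L2 c W) (a - c * a') (b - c * b')"
      proof -
        obtain v q f where 1: "represents U (scaleC_L2 z U) v q f" "v 0 = a" "q 0 = b"
          using UW(3) by (auto simp: tr_def)
        obtain v' q' f' where 2: "represents W (scaleC_L2 z W) v' q' f'" "v' 0 = a'" "q' 0 = b'"
          using UW(4) by (auto simp: tr_def)
        show ?thesis
          unfolding tr_def eq
          using represents_diff[OF 1(1) represents_scaleC[OF 2(1), of c]] 1(2,3) 2(2,3) by blast
      qed
      ultimately show ?thesis by (simp add: eigenspace_def eq)
    qed
    show "U = 0" if U: "U \<in> eigenspace H z" "tr U 0 0" for U
    proof -
      obtain v q f where "represents U (scaleC_L2 z U) v q f" "v 0 = 0" "q 0 = 0"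
        using U(2) by (auto simp: tr_def)
      then show ?thesis using D(2) by fastforce
    qed
  qed
qed

text \<open>Negative numbers are regular or in the discrete spectrum. A number in
  \<open>[0, \<infinity>)\<close> is never isolated, since the whole ray lies in the spectrum, and
  so remains in the essential spectrum even if it is an eigenvalue.\<close>

lemma essential_spectrum_realization:
  assumes H: "self_adjoint_realization V H"
  shows "essential_spectrum H = complex_of_real ` {0..}"
proof -
  have sa: "self_adjoint H" using H by (simp add: self_adjoint_realization_def)
  have nonneg: "complex_of_real x \<in> spectrum H" if "0 \<le> x" for x
    using nonneg_in_spectrum[OF H, of "sqrt x"] that by simp
  have "z \<in> complex_of_real ` {0..}" if z: "z \<in> essential_spectrum H" for z
  proof -
    have zs: "z \<in> spectrum H" "z \<notin> discrete_spectrum H" using z by (auto simp: essential_spectrum_def)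
    have "Im z = 0"
      using nonreal_in_resolvent_set[OF sa, of z] zs(1) by (auto simp: spectrum_def)
    then have zr: "z = complex_of_real (Re z)" by (simp add: complex_eq_iff)
    have "0 \<le> Re z"
    proof (rule ccontr)
      assume "\<not> 0 \<le> Re z"
      then have m: "0 < - Re z" by simp
      have zm: "z = - complex_of_real (- Re z)" using zr by simp
      have "z \<in> discrete_spectrum H"
      proof (rule discrete_spectrum_if_singular_sequences_converge[OF sa zs(1)])
        show "\<exists>B. finite B \<and> eigenspace H z \<subseteq> complex_span B"
          by (subst zm) (rule eigenspace_finite_span[OF H m])
        show "\<exists>r. strict_mono (r :: nat \<Rightarrow> nat) \<and> convergent (X \<circ> r)"
          if "\<And>n. (X n, Y n) \<in> H" "\<And>n. norm (X n) = 1" "(\<lambda>n. Y n - scaleC_L2 z (X n)) \<longlonglongrightarrow> 0" for X Y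
          using that(3) by (subst (asm) zm) (rule singular_sequence_converges[OF H m that(1,2)])
      qed
      with zs(2) show False ..
    qed
    with zr show ?thesis by (metis atLeast_iff image_eqI)
  qed
  moreover have "complex_of_real x \<in> essential_spectrum H" if x: "0 \<le> x" for x
  proof -
    have "\<not> complex_of_real x isolated_in spectrum H"
    proof
      assume "complex_of_real x isolated_in spectrum H"
      then obtain T where T: "open T" "T \<inter> spectrum H = {complex_of_real x}"
        unfolding isolated_in_def by blast
      then obtain e where e: "0 < e" "ball (complex_of_real x) e \<subseteq> T"
        by (metis Int_iff insertI1 openE)
      have "complex_of_real (x + e / 2) \<in> ball (complex_of_real x) e"
        using e(1) by (simp add: dist_norm)
      then have "complex_of_real (x + e / 2) \<in> T \<inter> spectrum H"
        using e nonneg[of "x + e / 2"] x by auto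
      then show False using T(2) e(1) by auto
    qed
    then show ?thesis
      using nonneg[OF x] by (simp add: essential_spectrum_def discrete_spectrum_def)
  qed
  ultimately show ?thesis by auto
qed

end

theorem corollary1p8:
  fixes V :: "real \<Rightarrow> real"
  assumes "\<And>b. V absolutely_integrable_on {0..b}"
    and "\<exists>l. ((\<lambda>x. integral {0..x} V) \<longlongrightarrow> l) at_top"
  shows "limit_point_at_infinity V \<and>
    (\<forall>H. self_adjoint_realization V H \<longrightarrow> essential_spectrum H = complex_of_real ` {0..})"
proof -
  obtain l where l: "((\<lambda>x. integral {0..x} V) \<longlongrightarrow> l) at_top" using assms(2) by blast
  interpret half_line_potential V l
    by unfold_locales (rule assms(1), rule l)
  show ?thesis using limit_point essential_spectrum_realization by blast
qed

end
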